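(* Let $(K,d,\mu)$ be a compact metric space isometrically embedded in some Euclidean space, where $\mu$ is the Hausdorff measure on $K$, and assume that $(K,d)$ satisfies the midpoint property: for all $x,y\in K$ there is $z\in K$ with $d(x,z)=d(z,y)=\frac12d(x,y)$. Let $(\mathcal{E},\mathcal{F})$ be a strongly local regular Dirichlet form on $L^2(K,\mu)$ with generator $\Delta$, whose semigroup $\{P_t\}$ has a jointly continuous heat kernel $p_t(x,y)$ satisfying, for some $c_1,c_2,c_3,c_4\in(0,\infty)$, $d_h\ge1$, $d_w\in[2,+\infty)$ with $d_w\ge d_h$, $$c_1t^{-d_h/d_w}\exp\left(-c_2\Big(\frac{d(x,y)^{d_w}}{t}\Big)^{\frac1{d_w-1}}\right)\le p_t(x,y)\le c_3t^{-d_h/d_w}\exp\left(-c_4\Big(\frac{d(x,y)^{d_w}}{t}\Big)^{\frac1{d_w-1}}\right)$$ for every $(x,y)\in K\times K$ and $t\in(0,1)$. Let $W$ be a white noise on $L_0^2(K,\mu)$. If $\frac{d_h}{2d_w}<s<1-\frac{d_h}{2d_w}$, then there exists a Gaussian random field $(X(x))_{x\in K}$ which is almost surely Hölder continuous with exponent $H^-$, where $$H=sd_w-\frac{d_h}2$$ (that is, for every $\varepsilon\in(0,H)$ it is $(H-\varepsilon)$-Hölder continuous on $K$ with respect to $d$), and such that for every $f$ in the $L_0^2$-domain of the operator $(-\Delta)^s$, almost surely, $$\int_K(-\Delta)^sf(x)\,X(x)\,d\mu(x)=\int_Kf(x)\,W(dx).$$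
   Context: The generator $\Delta$ is the non-positive self-adjoint operator on $L^2(K,\mu)$ with $\mathcal{E}(f,g)=-\int_K(\Delta f)g\,d\mu$, $P_t=e^{t\Delta}$, and $p_t(x,y)$ is the kernel of $P_t$ with respect to $\mu$. $L_0^2(K,\mu)=\{f\in L^2(K,\mu):\int_Kf\,d\mu=0\}$. The operator $(-\Delta)^s$ on $L_0^2(K,\mu)$ is defined by spectral calculus: if $0<\lambda_1\le\lambda_2\le\cdots$ are the eigenvalues of $-\Delta$ on $L^2_0(K,\mu)$ and $(\Phi_j)_{j\ge1}$ is an orthonormal basis of $L_0^2(K,\mu)$ with $\Delta\Phi_j=-\lambda_j\Phi_j$, its domain is $\{f\in L_0^2(K,\mu):\sum_j\lambda_j^{2s}\langle f,\Phi_j\rangle^2<\infty\}$ and $(-\Delta)^sf=\sum_j\lambda_j^s\langle f,\Phi_j\rangle\Phi_j$. A white noise on $L_0^2(K,\mu)$ is a linear map $f\mapsto W(f)=\int_Kf(x)W(dx)$ from $L_0^2(K,\mu)$ into centered, jointly Gaussian real random variables on a probability space, with $\mathbb{E}(W(f)W(g))=\int_Kfg\,d\mu$. The field $X$ is defined on the same probability space. *)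

theory Defs
  imports "HOL-Probability.Probability"
begin

section \<open>Hausdorff measure and dimension\<close>

text \<open>
  The unnormalised convention: a covering set \<open>U\<close> has weight \<open>(diam U)\<^sup>s\<close>.  The case
  distinction implements \<open>0\<^sup>0 = 1\<close> for nonempty sets (whereas \<open>0 powr 0 = 0\<close>), so
  that the measure for \<open>s = 0\<close> is counting measure.
\<close>

definition hausdorff_weight :: "real \<Rightarrow> 'a::metric_space set \<Rightarrow> ennreal" where
  "hausdorff_weight s U =
     (if U = {} then 0 else if s = 0 then 1 else ennreal (diameter U powr s))"

definition hausdorff_premeasure :: "real \<Rightarrow> real \<Rightarrow> 'a::metric_space set \<Rightarrow> ennreal" where
  "hausdorff_premeasure s \<delta> A =
     Inf {\<Sum>i. hausdorff_weight s (U i) | U :: nat \<Rightarrow> 'a set.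
            A \<subseteq> (\<Union>i. U i) \<and> (\<forall>i. bounded (U i) \<and> diameter (U i) \<le> \<delta>)}"

definition hausdorff_outer_measure :: "real \<Rightarrow> 'a::metric_space set \<Rightarrow> ennreal" where
  "hausdorff_outer_measure s A = (SUP \<delta>\<in>{0<..}. hausdorff_premeasure s \<delta> A)"

text \<open>Real-valued, hence meaningful only for sets of finite dimension, such as subsets of a
  Euclidean space.\<close>

definition hausdorff_dimension :: "'a::metric_space set \<Rightarrow> real" where
  "hausdorff_dimension A = Inf {s. 0 \<le> s \<and> hausdorff_outer_measure s A = 0}"

definition is_hausdorff_measure_on :: "'a::metric_space set \<Rightarrow> 'a measure \<Rightarrow> bool" where
  "is_hausdorff_measure_on K \<mu> \<longleftrightarrow>
     space \<mu> = K \<and> sets \<mu> = sets (restrict_space borel K) \<and>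
     (\<forall>A\<in>sets \<mu>. emeasure \<mu> A = hausdorff_outer_measure (hausdorff_dimension K) A)"

definition midpoint_property :: "'a::metric_space set \<Rightarrow> bool" where
  "midpoint_property K \<longleftrightarrow>
     (\<forall>x\<in>K. \<forall>y\<in>K. \<exists>z\<in>K. dist x z = dist x y / 2 \<and> dist z y = dist x y / 2)"


section \<open>Square integrable functions\<close>

text \<open>
  Elements of \<open>L\<^sup>2\<close> are represented by functions; all notions below are invariant under
  modification on null sets.
\<close>

definition L2 :: "'a measure \<Rightarrow> ('a \<Rightarrow> real) set" where
  "L2 \<mu> = {f \<in> borel_measurable \<mu>. integrable \<mu> (\<lambda>x. (f x)\<^sup>2)}"

definition L2_0 :: "'a measure \<Rightarrow> ('a \<Rightarrow> real) set" where
  "L2_0 \<mu> = {f \<in> L2 \<mu>. (\<integral>x. f x \<partial>\<mu>) = 0}"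

definition L2_inner :: "'a measure \<Rightarrow> ('a \<Rightarrow> real) \<Rightarrow> ('a \<Rightarrow> real) \<Rightarrow> real" where
  "L2_inner \<mu> f g = (\<integral>x. f x * g x \<partial>\<mu>)"

definition L2_dist_sq :: "'a measure \<Rightarrow> ('a \<Rightarrow> real) \<Rightarrow> ('a \<Rightarrow> real) \<Rightarrow> real" where
  "L2_dist_sq \<mu> f g = (\<integral>x. (f x - g x)\<^sup>2 \<partial>\<mu>)"


section \<open>Dirichlet forms\<close>

text \<open>The squared norm of \<open>f - g\<close> for the inner product
  \<open>\<E>\<^sub>1(u,v) = \<E>(u,v) + \<langle>u,v\<rangle>\<close> on the form domain.\<close>

definition E1_dist_sq ::
  "'a measure \<Rightarrow> (('a \<Rightarrow> real) \<Rightarrow> ('a \<Rightarrow> real) \<Rightarrow> real) \<Rightarrow> ('a \<Rightarrow> real) \<Rightarrow> ('a \<Rightarrow> real) \<Rightarrow> real" where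
  "E1_dist_sq \<mu> \<E> f g = \<E> (\<lambda>x. f x - g x) (\<lambda>x. f x - g x) + L2_dist_sq \<mu> f g"

text \<open>The form is only constrained on the domain \<open>\<F>\<close>; the clause on almost everywhere equal
  functions makes it a form on equivalence classes.\<close>

definition symmetric_form ::
  "'a measure \<Rightarrow> (('a \<Rightarrow> real) \<Rightarrow> ('a \<Rightarrow> real) \<Rightarrow> real) \<Rightarrow> ('a \<Rightarrow> real) set \<Rightarrow> bool" where
  "symmetric_form \<mu> \<E> \<F> \<longleftrightarrow>
     \<F> \<subseteq> L2 \<mu> \<and> (\<lambda>_. 0) \<in> \<F> \<and>
     (\<forall>f\<in>\<F>. \<forall>g\<in>\<F>. \<forall>a b. (\<lambda>x. a * f x + b * g x) \<in> \<F>) \<and>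
     (\<forall>f\<in>\<F>. \<forall>g\<in>L2 \<mu>. (AE x in \<mu>. f x = g x) \<longrightarrow> g \<in> \<F> \<and> (\<forall>h\<in>\<F>. \<E> g h = \<E> f h)) \<and>
     (\<forall>f\<in>L2 \<mu>. \<forall>\<epsilon>>0. \<exists>g\<in>\<F>. L2_dist_sq \<mu> f g < \<epsilon>) \<and>
     (\<forall>f\<in>\<F>. \<forall>g\<in>\<F>. \<E> f g = \<E> g f) \<and>
     (\<forall>f\<in>\<F>. \<forall>g\<in>\<F>. \<forall>h\<in>\<F>. \<forall>a b. \<E> (\<lambda>x. a * f x + b * g x) h = a * \<E> f h + b * \<E> g h) \<and>
     (\<forall>f\<in>\<F>. 0 \<le> \<E> f f)"

definition closed_form ::
  "'a measure \<Rightarrow> (('a \<Rightarrow> real) \<Rightarrow> ('a \<Rightarrow> real) \<Rightarrow> real) \<Rightarrow> ('a \<Rightarrow> real) set \<Rightarrow> bool" where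
  "closed_form \<mu> \<E> \<F> \<longleftrightarrow>
     (\<forall>u :: nat \<Rightarrow> 'a \<Rightarrow> real.
        (\<forall>n. u n \<in> \<F>) \<and> (\<forall>\<epsilon>>0. \<exists>N. \<forall>m\<ge>N. \<forall>n\<ge>N. E1_dist_sq \<mu> \<E> (u m) (u n) < \<epsilon>) \<longrightarrow>
        (\<exists>f\<in>\<F>. (\<lambda>n. E1_dist_sq \<mu> \<E> (u n) f) \<longlonglongrightarrow> 0))"

definition markovian_form ::
  "(('a \<Rightarrow> real) \<Rightarrow> ('a \<Rightarrow> real) \<Rightarrow> real) \<Rightarrow> ('a \<Rightarrow> real) set \<Rightarrow> bool" where
  "markovian_form \<E> \<F> \<longleftrightarrow>
     (\<forall>f\<in>\<F>. (\<lambda>x. min (max (f x) 0) 1) \<in> \<F> \<and>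
        \<E> (\<lambda>x. min (max (f x) 0) 1) (\<lambda>x. min (max (f x) 0) 1) \<le> \<E> f f)"

definition dirichlet_form ::
  "'a measure \<Rightarrow> (('a \<Rightarrow> real) \<Rightarrow> ('a \<Rightarrow> real) \<Rightarrow> real) \<Rightarrow> ('a \<Rightarrow> real) set \<Rightarrow> bool" where
  "dirichlet_form \<mu> \<E> \<F> \<longleftrightarrow>
     symmetric_form \<mu> \<E> \<F> \<and> closed_form \<mu> \<E> \<F> \<and> markovian_form \<E> \<F>"

text \<open>
  As usual, regularity presupposes that the reference measure is a Radon measure of full support.
  On a compact metric space, a Borel measure is Radon iff it is finite, and every continuous
  function has compact support.
\<close>

definition regular_dirichlet_form ::
  "'a::metric_space set \<Rightarrow> 'a measure \<Rightarrow>
     (('a \<Rightarrow> real) \<Rightarrow> ('a \<Rightarrow> real) \<Rightarrow> real) \<Rightarrow> ('a \<Rightarrow> real) set \<Rightarrow> bool" where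
  "regular_dirichlet_form K \<mu> \<E> \<F> \<longleftrightarrow>
     dirichlet_form \<mu> \<E> \<F> \<and>
     finite_measure \<mu> \<and> (\<forall>U. open U \<and> U \<inter> K \<noteq> {} \<longrightarrow> 0 < emeasure \<mu> (U \<inter> K)) \<and>
     (\<forall>f\<in>\<F>. \<forall>\<epsilon>>0. \<exists>g\<in>\<F>. continuous_on K g \<and> E1_dist_sq \<mu> \<E> f g < \<epsilon>) \<and>
     (\<forall>f. continuous_on K f \<longrightarrow>
        (\<forall>\<epsilon>>0. \<exists>g\<in>\<F>. continuous_on K g \<and> (\<forall>x\<in>K. \<bar>f x - g x\<bar> < \<epsilon>)))"

text \<open>The support of the signed measure \<open>g d\<mu>\<close>.\<close>

definition ae_support :: "'a::metric_space measure \<Rightarrow> ('a \<Rightarrow> real) \<Rightarrow> 'a set" where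
  "ae_support \<mu> g =
     {x \<in> space \<mu>. \<forall>U. open U \<and> x \<in> U \<longrightarrow> \<not> (AE y in \<mu>. y \<in> U \<longrightarrow> g y = 0)}"

text \<open>The usual requirement that \<open>f\<close> and \<open>g\<close> have compact support is void on a compact space.\<close>

definition strongly_local ::
  "'a::metric_space measure \<Rightarrow>
     (('a \<Rightarrow> real) \<Rightarrow> ('a \<Rightarrow> real) \<Rightarrow> real) \<Rightarrow> ('a \<Rightarrow> real) set \<Rightarrow> bool" where
  "strongly_local \<mu> \<E> \<F> \<longleftrightarrow>
     (\<forall>f\<in>\<F>. \<forall>g\<in>\<F>.
        (\<exists>U c. open U \<and> ae_support \<mu> g \<subseteq> U \<and> (AE y in \<mu>. y \<in> U \<longrightarrow> f y = c)) \<longrightarrow> \<E> f g = 0)"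


section \<open>Generator, semigroup and heat kernel\<close>

text \<open>The graph of the generator: \<open>f\<close> is in the domain and \<open>\<Delta>f = h\<close>.\<close>

definition generator ::
  "'a measure \<Rightarrow> (('a \<Rightarrow> real) \<Rightarrow> ('a \<Rightarrow> real) \<Rightarrow> real) \<Rightarrow> ('a \<Rightarrow> real) set \<Rightarrow>
     ('a \<Rightarrow> real) \<Rightarrow> ('a \<Rightarrow> real) \<Rightarrow> bool" where
  "generator \<mu> \<E> \<F> f h \<longleftrightarrow>
     f \<in> \<F> \<and> h \<in> L2 \<mu> \<and> (\<forall>g\<in>\<F>. \<E> f g = - (\<integral>x. h x * g x \<partial>\<mu>))"

text \<open>
  The semigroup \<open>P\<^sub>t = e\<^bsup>t\<Delta>\<^esup>\<close>: the strongly continuous contraction semigroup on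
  \<open>L\<^sup>2\<close> whose infinitesimal generator (the last clause) is \<open>\<Delta>\<close>, with the same domain.  Such a
  semigroup is uniquely determined by \<open>\<Delta>\<close>.
\<close>

definition heat_semigroup ::
  "'a measure \<Rightarrow> (('a \<Rightarrow> real) \<Rightarrow> ('a \<Rightarrow> real) \<Rightarrow> real) \<Rightarrow> ('a \<Rightarrow> real) set \<Rightarrow>
     (real \<Rightarrow> ('a \<Rightarrow> real) \<Rightarrow> 'a \<Rightarrow> real) \<Rightarrow> bool" where
  "heat_semigroup \<mu> \<E> \<F> P \<longleftrightarrow>
     (\<forall>t\<ge>0. \<forall>f\<in>L2 \<mu>. P t f \<in> L2 \<mu> \<and> (\<integral>x. (P t f x)\<^sup>2 \<partial>\<mu>) \<le> (\<integral>x. (f x)\<^sup>2 \<partial>\<mu>)) \<and>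
     (\<forall>t\<ge>0. \<forall>f\<in>L2 \<mu>. \<forall>g\<in>L2 \<mu>. \<forall>a b.
        AE x in \<mu>. P t (\<lambda>y. a * f y + b * g y) x = a * P t f x + b * P t g x) \<and>
     (\<forall>f\<in>L2 \<mu>. AE x in \<mu>. P 0 f x = f x) \<and>
     (\<forall>r\<ge>0. \<forall>t\<ge>0. \<forall>f\<in>L2 \<mu>. AE x in \<mu>. P (r + t) f x = P r (P t f) x) \<and>
     (\<forall>f\<in>L2 \<mu>. ((\<lambda>t. L2_dist_sq \<mu> (P t f) f) \<longlongrightarrow> 0) (at_right 0)) \<and>
     (\<forall>f\<in>L2 \<mu>. \<forall>h\<in>L2 \<mu>.
        generator \<mu> \<E> \<F> f h \<longleftrightarrow>
        ((\<lambda>t. L2_dist_sq \<mu> (\<lambda>x. (P t f x - f x) / t) h) \<longlongrightarrow> 0) (at_right 0))"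

definition continuous_heat_kernel ::
  "'a::metric_space set \<Rightarrow> 'a measure \<Rightarrow> (real \<Rightarrow> ('a \<Rightarrow> real) \<Rightarrow> 'a \<Rightarrow> real) \<Rightarrow>
     (real \<Rightarrow> 'a \<Rightarrow> 'a \<Rightarrow> real) \<Rightarrow> bool" where
  "continuous_heat_kernel K \<mu> P p \<longleftrightarrow>
     continuous_on ({0<..} \<times> K \<times> K) (\<lambda>(t, x, y). p t x y) \<and>
     (\<forall>t>0. \<forall>f\<in>L2 \<mu>. AE x in \<mu>. P t f x = (\<integral>y. p t x y * f y \<partial>\<mu>))"


section \<open>Fractional powers of the generator\<close>

text \<open>The nondecreasing eigenvalues of \<open>-\<Delta>\<close> on the mean zero functions, with an orthonormal
  eigenbasis; indices start at \<open>0\<close> instead of \<open>1\<close>.\<close>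

definition eigenbasis ::
  "'a measure \<Rightarrow> (('a \<Rightarrow> real) \<Rightarrow> ('a \<Rightarrow> real) \<Rightarrow> real) \<Rightarrow> ('a \<Rightarrow> real) set \<Rightarrow>
     (nat \<Rightarrow> real) \<Rightarrow> (nat \<Rightarrow> 'a \<Rightarrow> real) \<Rightarrow> bool" where
  "eigenbasis \<mu> \<E> \<F> lam \<Phi> \<longleftrightarrow>
     0 < lam 0 \<and> mono lam \<and>
     (\<forall>j. \<Phi> j \<in> L2_0 \<mu> \<and> generator \<mu> \<E> \<F> (\<Phi> j) (\<lambda>x. - lam j * \<Phi> j x)) \<and>
     (\<forall>i j. L2_inner \<mu> (\<Phi> i) (\<Phi> j) = (if i = j then 1 else 0)) \<and>
     (\<forall>f\<in>L2_0 \<mu>. (\<lambda>n. L2_dist_sq \<mu> f (\<lambda>x. \<Sum>j<n. L2_inner \<mu> f (\<Phi> j) * \<Phi> j x)) \<longlonglongrightarrow> 0)"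

text \<open>The graph of \<open>(-\<Delta>)\<^sup>s\<close>: \<open>f\<close> is in the domain and \<open>(-\<Delta>)\<^sup>s f = h\<close>, the series
  being summed in \<open>L\<^sup>2\<close>.  The result does not depend on the choice of the eigenbasis.\<close>

definition frac_power ::
  "'a measure \<Rightarrow> (('a \<Rightarrow> real) \<Rightarrow> ('a \<Rightarrow> real) \<Rightarrow> real) \<Rightarrow> ('a \<Rightarrow> real) set \<Rightarrow> real \<Rightarrow>
     ('a \<Rightarrow> real) \<Rightarrow> ('a \<Rightarrow> real) \<Rightarrow> bool" where
  "frac_power \<mu> \<E> \<F> s f h \<longleftrightarrow>
     (\<exists>lam \<Phi>. eigenbasis \<mu> \<E> \<F> lam \<Phi> \<and>
        f \<in> L2_0 \<mu> \<and> summable (\<lambda>j. lam j powr (2 * s) * (L2_inner \<mu> f (\<Phi> j))\<^sup>2) \<and>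
        h \<in> L2_0 \<mu> \<and>
        (\<lambda>n. L2_dist_sq \<mu> h (\<lambda>x. \<Sum>j<n. lam j powr s * L2_inner \<mu> f (\<Phi> j) * \<Phi> j x)) \<longlonglongrightarrow> 0)"


section \<open>Gaussian fields and white noise\<close>

text \<open>Degenerate (almost surely constant) variables count as Gaussian.\<close>

definition gaussian_rv :: "'w measure \<Rightarrow> ('w \<Rightarrow> real) \<Rightarrow> bool" where
  "gaussian_rv M Y \<longleftrightarrow>
     Y \<in> borel_measurable M \<and>
     (\<exists>m \<sigma>. 0 \<le> \<sigma> \<and>
        distr M borel Y =
          (if \<sigma> = 0 then return borel m
           else density lborel (\<lambda>x. ennreal (normal_density m \<sigma> x))))"

definition gaussian_field :: "'w measure \<Rightarrow> 'i set \<Rightarrow> ('i \<Rightarrow> 'w \<Rightarrow> real) \<Rightarrow> bool" where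
  "gaussian_field M I Y \<longleftrightarrow>
     (\<forall>J c. finite J \<and> J \<subseteq> I \<longrightarrow> gaussian_rv M (\<lambda>\<omega>. \<Sum>i\<in>J. c i * Y i \<omega>))"

definition white_noise ::
  "'w measure \<Rightarrow> 'a measure \<Rightarrow> (('a \<Rightarrow> real) \<Rightarrow> 'w \<Rightarrow> real) \<Rightarrow> bool" where
  "white_noise M \<mu> W \<longleftrightarrow>
     (\<forall>f\<in>L2_0 \<mu>. \<forall>g\<in>L2_0 \<mu>. \<forall>a b.
        AE \<omega> in M. W (\<lambda>x. a * f x + b * g x) \<omega> = a * W f \<omega> + b * W g \<omega>) \<and>
     gaussian_field M (L2_0 \<mu>) W \<and>
     (\<forall>f\<in>L2_0 \<mu>. (\<integral>\<omega>. W f \<omega> \<partial>M) = 0) \<and>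
     (\<forall>f\<in>L2_0 \<mu>. \<forall>g\<in>L2_0 \<mu>. (\<integral>\<omega>. W f \<omega> * W g \<omega> \<partial>M) = (\<integral>x. f x * g x \<partial>\<mu>))"

definition hoelder_continuous_on :: "'a::metric_space set \<Rightarrow> real \<Rightarrow> ('a \<Rightarrow> real) \<Rightarrow> bool" where
  "hoelder_continuous_on S \<alpha> u \<longleftrightarrow>
     (\<exists>C. \<forall>x\<in>S. \<forall>y\<in>S. \<bar>u x - u y\<bar> \<le> C * dist x y powr \<alpha>)"

end

theory Submission
  imports Defs "HOL-Real_Asymp.Real_Asymp"
begin

text \<open>
  Write \<open>\<theta> = d\<^sub>h / d\<^sub>w\<close>, \<open>\<kappa> = d\<^sub>w - d\<^sub>h\<close> and \<open>H = s d\<^sub>w - d\<^sub>h / 2\<close>; the range of \<open>s\<close> forces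
  \<open>\<theta> < 1\<close>.  The field is \<open>X(x) = W(g\<^sub>x)\<close>, where \<open>g\<^sub>x = \<Sum>\<^sub>j \<lambda>\<^sub>j\<^bsup>-s\<^esup> \<Phi>\<^sub>j(x) \<Phi>\<^sub>j\<close> is the kernel of
  \<open>(-\<Delta>)\<^bsup>-s\<^esup>\<close> at \<open>x\<close>, with continuous eigenfunctions \<open>\<Phi>\<^sub>j\<close>.  Since \<open>W\<close> is linear and isometric,
  \<open>\<integral> h X d\<mu> = W(\<integral> h(x) g\<^sub>x d\<mu>(x)) = W((-\<Delta>)\<^bsup>-s\<^esup> h)\<close>, and
  \<open>E |X(x) - X(y)|\<^sup>2 = \<Sum>\<^sub>j \<lambda>\<^sub>j\<^bsup>-2s\<^esup> (\<Phi>\<^sub>j(x) - \<Phi>\<^sub>j(y))\<^sup>2\<close>.  Once this sum is known to be at most a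
  multiple of \<open>d(x,y)\<^bsup>2\<alpha>\<^esup>\<close> for every \<open>\<alpha> < H\<close> (\<open>fractional_increments\<close>), chaining gives the continuous
  version: a bounded subset of a Euclidean space meets only polynomially many cells of a dyadic
  grid, and Gaussian variables have moments of all orders
  (\<open>Gaussian_Kolmogorov_Chentsov\<close>, \<open>white_noise_field\<close>).

  The sum is comparable to \<open>\<Sum>\<^sub>k 2\<^bsup>k(2 - 2s)\<^esup> \<parallel>R\<^sub>\<lambda>(x,\<cdot>) - R\<^sub>\<lambda>(y,\<cdot>)\<parallel>\<^sup>2\<close>, taken over \<open>\<lambda> = 2\<^sup>k\<close>, where
  \<open>R\<^sub>\<lambda>\<close> is the kernel of \<open>(\<lambda> - \<Delta>)\<^bsup>-1\<^esup>\<close>.  The squared norm is bounded both by \<open>\<lambda>\<^bsup>\<theta> - 2\<^esup>\<close> and by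
  \<open>d(x,y)\<^bsup>2\<kappa>\<^esup> \<lambda>\<^bsup>-\<theta>\<^esup>\<close> (\<open>resolvent_difference_bounds\<close>), and interpolating between the two leaves a
  convergent geometric series exactly when \<open>\<alpha> < H\<close>.  The first bound is the on-diagonal upper bound of the heat
  kernel.  The second one rests on two facts that are special to \<open>\<theta> < 1\<close>, where points have positive
  capacity.

  The first is the resistance estimate \<open>|u(x) - u(y)|\<^sup>2 \<le> C d(x,y)\<^sup>\<kappa> \<E>(u,u)\<close>
  (\<open>resistance_estimate\<close>).  By the two-sided bounds \<open>p\<^sub>t(x,z) p\<^sub>t(y,w)\<close> is at most a multiple of
  \<open>t\<^bsup>-\<theta>\<^esup> p\<^bsub>At\<^esub>(z,w)\<close>, so the averages \<open>P\<^sub>t u(x)\<close> and \<open>P\<^sub>t u(y)\<close> differ by a quantity controlled by the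
  energy of \<open>u\<close>; telescoping over the times \<open>t / 2\<^sup>k\<close> removes the averaging.  It yields
  \<open>R\<^sub>\<lambda>(x,x) - 2 R\<^sub>\<lambda>(x,y) + R\<^sub>\<lambda>(y,y) \<le> C d(x,y)\<^sup>\<kappa>\<close>.

  The second is the maximum principle for \<open>R\<^sub>\<lambda>\<close> (\<open>maximum_principle\<close>), which gives
  \<open>R\<^sub>\<lambda>(x,y) R\<^sub>\<lambda>(x,w) \<le> R\<^sub>\<lambda>(x,x) R\<^sub>\<lambda>(y,w)\<close>: probabilistically, \<open>R\<^sub>\<lambda>(x,y) / R\<^sub>\<lambda>(x,x)\<close> is the probability
  of hitting \<open>x\<close> from \<open>y\<close> before an exponential time.  Hence \<open>R\<^sub>\<lambda>(x,w) - R\<^sub>\<lambda>(y,w)\<close> is at most the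
  fraction \<open>(R\<^sub>\<lambda>(x,x) - R\<^sub>\<lambda>(x,y)) / R\<^sub>\<lambda>(x,x)\<close> of \<open>R\<^sub>\<lambda>(x,w)\<close>.  This gains the full power \<open>d(x,y)\<^sup>\<kappa>\<close>
  pointwise, where the resistance estimate alone would give its square root.
\<close>

section \<open>Elementary inequalities\<close>

lemma power_powr: "x > 0 \<Longrightarrow> (x ^ k) powr a = (x powr a) ^ k" for x a :: real
  by (induction k) (auto simp: powr_mult)

lemma half_powr_less_one: "0 < a \<Longrightarrow> (1/2 :: real) powr a < 1"
  using powr_less_mono2[of a "1/2" 1] by simp

lemma abs_mult_le_sum_squares: "\<bar>a * b\<bar> \<le> a\<^sup>2 + b\<^sup>2" for a b :: real
proof -
  have "2 * (\<bar>a\<bar> * \<bar>b\<bar>) \<le> a\<^sup>2 + b\<^sup>2"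
    using sum_squares_bound[of "\<bar>a\<bar>" "\<bar>b\<bar>"] by (simp add: mult.assoc)
  moreover have "0 \<le> \<bar>a\<bar> * \<bar>b\<bar>" by simp
  ultimately show ?thesis unfolding abs_mult by linarith
qed

section \<open>Square integrable functions\<close>

lemma L2_measurable [measurable_dest]: "f \<in> L2 \<mu> \<Longrightarrow> f \<in> borel_measurable \<mu>"
  by (simp add: L2_def)

lemma L2_mult_integrable:
  assumes "f \<in> L2 \<mu>" "g \<in> L2 \<mu>"
  shows "integrable \<mu> (\<lambda>x. f x * g x)"
proof (rule Bochner_Integration.integrable_bound)
  show "integrable \<mu> (\<lambda>x. (f x)\<^sup>2 + (g x)\<^sup>2)"
    using assms by (auto simp: L2_def)
  show "(\<lambda>x. f x * g x) \<in> borel_measurable \<mu>"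
    using assms by (auto simp: L2_def)
  show "AE x in \<mu>. norm (f x * g x) \<le> norm ((f x)\<^sup>2 + (g x)\<^sup>2)"
    using abs_mult_le_sum_squares by (auto simp del: abs_mult)
qed

lemma L2_lincomb:
  assumes "f \<in> L2 \<mu>" "g \<in> L2 \<mu>"
  shows "(\<lambda>x. a * f x + b * g x) \<in> L2 \<mu>"
proof -
  have "integrable \<mu> (\<lambda>x. a\<^sup>2 * (f x)\<^sup>2 + 2 * a * b * (f x * g x) + b\<^sup>2 * (g x)\<^sup>2)"
    using L2_mult_integrable[OF assms] assms by (auto simp: L2_def)
  also have "(\<lambda>x. a\<^sup>2 * (f x)\<^sup>2 + 2 * a * b * (f x * g x) + b\<^sup>2 * (g x)\<^sup>2) = (\<lambda>x. (a * f x + b * g x)\<^sup>2)"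
    by (auto simp: power2_eq_square algebra_simps)
  finally show ?thesis using assms by (auto simp: L2_def)
qed

lemma L2_scale: "f \<in> L2 \<mu> \<Longrightarrow> (\<lambda>x. a * f x) \<in> L2 \<mu>"
  using L2_lincomb[of f \<mu> f a 0] by simp

lemma L2_add: "f \<in> L2 \<mu> \<Longrightarrow> g \<in> L2 \<mu> \<Longrightarrow> (\<lambda>x. f x + g x) \<in> L2 \<mu>"
  using L2_lincomb[of f \<mu> g 1 1] by simp

lemma L2_diff: "f \<in> L2 \<mu> \<Longrightarrow> g \<in> L2 \<mu> \<Longrightarrow> (\<lambda>x. f x - g x) \<in> L2 \<mu>"
  using L2_lincomb[of f \<mu> g 1 "-1"] by simp

lemma L2_zero: "(\<lambda>x. 0) \<in> L2 \<mu>"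
  by (simp add: L2_def)

lemma L2_sum: "(\<And>i. i \<in> I \<Longrightarrow> f i \<in> L2 \<mu>) \<Longrightarrow> (\<lambda>x. \<Sum>i\<in>I. c i * f i x) \<in> L2 \<mu>"
  by (induction I rule: infinite_finite_induct) (auto intro!: L2_zero L2_add L2_scale)

lemma L2_inner_commute: "L2_inner \<mu> f g = L2_inner \<mu> g f"
  by (simp add: L2_inner_def mult.commute)

lemma L2_inner_lincomb:
  assumes "f \<in> L2 \<mu>" "g \<in> L2 \<mu>" "h \<in> L2 \<mu>"
  shows "L2_inner \<mu> (\<lambda>x. a * f x + b * g x) h = a * L2_inner \<mu> f h + b * L2_inner \<mu> g h"
proof -
  have "L2_inner \<mu> (\<lambda>x. a * f x + b * g x) h = (\<integral>x. a * (f x * h x) + b * (g x * h x) \<partial>\<mu>)"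
    unfolding L2_inner_def by (auto simp: algebra_simps intro: Bochner_Integration.integral_cong)
  also have "\<dots> = a * L2_inner \<mu> f h + b * L2_inner \<mu> g h"
    unfolding L2_inner_def by (simp add: L2_mult_integrable assms)
  finally show ?thesis .
qed

lemma L2_inner_diff:
  assumes "f \<in> L2 \<mu>" "g \<in> L2 \<mu>" "h \<in> L2 \<mu>"
  shows "L2_inner \<mu> (\<lambda>x. f x - g x) h = L2_inner \<mu> f h - L2_inner \<mu> g h"
  using L2_inner_lincomb[OF assms, of 1 "-1"] by simp

lemma L2_inner_scale: "L2_inner \<mu> (\<lambda>x. a * f x) h = a * L2_inner \<mu> f h"
  by (simp add: L2_inner_def mult.assoc)

lemma L2_inner_sum:
  assumes "\<And>i. i \<in> I \<Longrightarrow> f i \<in> L2 \<mu>" "h \<in> L2 \<mu>"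
  shows "L2_inner \<mu> (\<lambda>x. \<Sum>i\<in>I. c i * f i x) h = (\<Sum>i\<in>I. c i * L2_inner \<mu> (f i) h)"
  using assms
proof (induction I rule: infinite_finite_induct)
  case (insert i I)
  then show ?case
    using L2_inner_lincomb[of "f i" \<mu> "\<lambda>x. \<Sum>i\<in>I. c i * f i x" h "c i" 1] by (simp add: L2_sum)
qed (auto simp: L2_inner_def)

lemma L2_inner_cong_AE:
  assumes "AE x in \<mu>. f x = f' x" "f \<in> borel_measurable \<mu>" "f' \<in> borel_measurable \<mu>"
    "h \<in> borel_measurable \<mu>"
  shows "L2_inner \<mu> f h = L2_inner \<mu> f' h"
  unfolding L2_inner_def by (rule integral_cong_AE) (use assms in auto)

definition L2_norm :: "'a measure \<Rightarrow> ('a \<Rightarrow> real) \<Rightarrow> real" where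
  "L2_norm \<mu> f = sqrt (L2_inner \<mu> f f)"

lemma L2_inner_self_nonneg: "0 \<le> L2_inner \<mu> f f"
  by (simp add: L2_inner_def)

lemma L2_norm_nonneg [simp]: "0 \<le> L2_norm \<mu> f"
  by (simp add: L2_norm_def L2_inner_self_nonneg)

lemma L2_norm_sq: "(L2_norm \<mu> f)\<^sup>2 = L2_inner \<mu> f f"
  by (simp add: L2_norm_def L2_inner_self_nonneg)

lemma L2_dist_sq_norm: "L2_dist_sq \<mu> f g = (L2_norm \<mu> (\<lambda>x. f x - g x))\<^sup>2"
  unfolding L2_norm_sq by (simp add: L2_dist_sq_def L2_inner_def power2_eq_square)

lemma sqrt_L2_dist_sq: "sqrt (L2_dist_sq \<mu> f g) = L2_norm \<mu> (\<lambda>x. g x - f x)"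
  unfolding L2_norm_def L2_dist_sq_def L2_inner_def by (simp add: power2_eq_square algebra_simps)

lemma L2_inner_self_zero:
  assumes "f \<in> L2 \<mu>" "L2_inner \<mu> f f = 0"
  shows "AE x in \<mu>. f x = 0"
proof -
  have "AE x in \<mu>. f x * f x = 0"
    using integral_nonneg_eq_0_iff_AE[OF L2_mult_integrable[OF assms(1) assms(1)]] assms(2)
    by (simp add: L2_inner_def)
  then show ?thesis by simp
qed

lemma L2_Cauchy_Schwarz:
  assumes "f \<in> L2 \<mu>" "g \<in> L2 \<mu>"
  shows "\<bar>L2_inner \<mu> f g\<bar> \<le> L2_norm \<mu> f * L2_norm \<mu> g"
proof (cases "L2_inner \<mu> g g = 0")
  case True
  then have "AE x in \<mu>. g x = 0" using L2_inner_self_zero assms by blast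
  then have "L2_inner \<mu> g f = L2_inner \<mu> (\<lambda>x. 0) f"
    by (intro L2_inner_cong_AE) (use assms in \<open>auto simp: L2_def\<close>)
  then show ?thesis by (simp add: L2_inner_commute[of _ f] L2_inner_def[of _ "\<lambda>x. 0"])
next
  case False
  let ?a = "L2_inner \<mu> g g" and ?b = "L2_inner \<mu> f g"
  let ?h = "\<lambda>x. ?a * f x + (- ?b) * g x"
  have a: "?a > 0" using False L2_inner_self_nonneg[of \<mu> g] by simp
  have hL: "?h \<in> L2 \<mu>" by (rule L2_lincomb[OF assms])
  have "0 \<le> L2_inner \<mu> ?h ?h" by (rule L2_inner_self_nonneg)
  also have "L2_inner \<mu> ?h ?h = ?a * L2_inner \<mu> ?h f - ?b * L2_inner \<mu> ?h g"
    unfolding L2_inner_lincomb[OF assms hL] L2_inner_commute[of \<mu> f ?h] L2_inner_commute[of \<mu> g ?h]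
    by simp
  also have "\<dots> = ?a * (?a * L2_inner \<mu> f f - ?b * ?b)"
    unfolding L2_inner_lincomb[OF assms assms(1)] L2_inner_lincomb[OF assms assms(2)]
    by (simp add: L2_inner_commute[of \<mu> g f] algebra_simps)
  finally have "?b\<^sup>2 \<le> L2_inner \<mu> f f * ?a"
    using a by (auto simp: zero_le_mult_iff power2_eq_square mult.commute)
  then show ?thesis
    by (metis L2_norm_def real_sqrt_abs real_sqrt_le_iff real_sqrt_mult)
qed

lemma L2_norm_add_le:
  assumes "f \<in> L2 \<mu>" "g \<in> L2 \<mu>"
  shows "L2_norm \<mu> (\<lambda>x. f x + g x) \<le> L2_norm \<mu> f + L2_norm \<mu> g"
proof (rule power2_le_imp_le)
  have "L2_inner \<mu> (\<lambda>x. f x + g x) (\<lambda>x. f x + g x) =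
     L2_inner \<mu> f (\<lambda>x. f x + g x) + L2_inner \<mu> g (\<lambda>x. f x + g x)"
    using L2_inner_lincomb[OF assms L2_add[OF assms], of 1 1] by simp
  also have "\<dots> = L2_inner \<mu> f f + 2 * L2_inner \<mu> f g + L2_inner \<mu> g g"
    using L2_inner_lincomb[OF assms assms(1), of 1 1] L2_inner_lincomb[OF assms assms(2), of 1 1]
    by (simp add: L2_inner_commute[of \<mu> _ "\<lambda>x. f x + g x"] L2_inner_commute[of \<mu> g f])
  finally show "(L2_norm \<mu> (\<lambda>x. f x + g x))\<^sup>2 \<le> (L2_norm \<mu> f + L2_norm \<mu> g)\<^sup>2"
    using L2_Cauchy_Schwarz[OF assms] by (simp add: L2_norm_sq power2_sum)
qed simp

lemma L2_norm_scale: "L2_norm \<mu> (\<lambda>x. a * f x) = \<bar>a\<bar> * L2_norm \<mu> f"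
proof -
  have "L2_inner \<mu> (\<lambda>x. a * f x) (\<lambda>x. a * f x) = a\<^sup>2 * L2_inner \<mu> f f"
    by (simp add: L2_inner_scale L2_inner_commute[of \<mu> f "\<lambda>x. a * f x"] power2_eq_square)
  then show ?thesis by (simp add: L2_norm_def real_sqrt_mult)
qed

lemma L2_norm_cong_AE:
  assumes "AE x in \<mu>. f x = g x" "f \<in> borel_measurable \<mu>" "g \<in> borel_measurable \<mu>"
  shows "L2_norm \<mu> f = L2_norm \<mu> g"
  unfolding L2_norm_def L2_inner_def
  by (rule arg_cong[where f = sqrt], rule integral_cong_AE) (use assms in auto)

lemma L2_integrable:
  assumes "finite_measure \<mu>" "f \<in> L2 \<mu>"
  shows "integrable \<mu> f"
proof -
  interpret finite_measure \<mu> by fact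
  have "(\<lambda>x. 1) \<in> L2 \<mu>" by (simp add: L2_def)
  from L2_mult_integrable[OF this assms(2)] show ?thesis by simp
qed

text \<open>
  Lets coefficients of a limit be computed on the approximations, which are finite sums below.
\<close>

lemma L2_inner_tendsto:
  assumes "\<And>n. f n \<in> L2 \<mu>" "g \<in> L2 \<mu>" "h \<in> L2 \<mu>"
    and "(\<lambda>n. L2_norm \<mu> (\<lambda>x. f n x - g x)) \<longlonglongrightarrow> 0"
  shows "(\<lambda>n. L2_inner \<mu> (f n) h) \<longlonglongrightarrow> L2_inner \<mu> g h"
proof (rule LIM_zero_cancel, rule Lim_null_comparison)
  show "\<forall>\<^sub>F n in sequentially. norm (L2_inner \<mu> (f n) h - L2_inner \<mu> g h)
      \<le> L2_norm \<mu> (\<lambda>x. f n x - g x) * L2_norm \<mu> h"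
    using L2_Cauchy_Schwarz[OF L2_diff[OF assms(1,2)] assms(3)]
    by (auto simp: L2_inner_diff[OF assms(1,2,3)])
  show "(\<lambda>n. L2_norm \<mu> (\<lambda>x. f n x - g x) * L2_norm \<mu> h) \<longlonglongrightarrow> 0"
    using tendsto_mult_right[OF assms(4), of "L2_norm \<mu> h"] by simp
qed

section \<open>Orthonormal bases\<close>

locale L2_basis = finite_measure \<mu> for \<mu> :: "'a measure" +
  fixes e :: "nat \<Rightarrow> 'a \<Rightarrow> real"
  assumes basis_L2: "e j \<in> L2 \<mu>"
    and orthonormal: "L2_inner \<mu> (e i) (e j) = (if i = j then 1 else 0)"
    and complete: "f \<in> L2 \<mu> \<Longrightarrow>
      (\<lambda>n. L2_dist_sq \<mu> f (\<lambda>x. \<Sum>j<n. L2_inner \<mu> f (e j) * e j x)) \<longlonglongrightarrow> 0"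
begin

lemma const_L2: "(\<lambda>x. c) \<in> L2 \<mu>"
  by (simp add: L2_def)

lemma partial_sum_norm:
  assumes "finite I"
  shows "(L2_norm \<mu> (\<lambda>x. \<Sum>j\<in>I. c j * e j x))\<^sup>2 = (\<Sum>j\<in>I. (c j)\<^sup>2)"
proof -
  let ?S = "\<lambda>x. \<Sum>j\<in>I. c j * e j x"
  have S: "?S \<in> L2 \<mu>" by (intro L2_sum basis_L2)
  have "L2_inner \<mu> (e i) ?S = c i" if "i \<in> I" for i
    using that assms unfolding L2_inner_commute[of \<mu> "e i" ?S]
    by (simp add: L2_inner_sum[OF basis_L2 basis_L2] orthonormal mult_delta_right)
  then show ?thesis
    unfolding L2_norm_sq
    by (subst L2_inner_sum) (auto intro: basis_L2 S simp: power2_eq_square)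
qed

lemma complete_norm:
  assumes "f \<in> L2 \<mu>"
  shows "(\<lambda>n. L2_norm \<mu> (\<lambda>x. (\<Sum>j<n. L2_inner \<mu> f (e j) * e j x) - f x)) \<longlonglongrightarrow> 0"
proof -
  have "(\<lambda>n. sqrt (L2_dist_sq \<mu> f (\<lambda>x. \<Sum>j<n. L2_inner \<mu> f (e j) * e j x))) \<longlonglongrightarrow> sqrt 0"
    by (intro tendsto_real_sqrt complete assms)
  then show ?thesis by (simp add: sqrt_L2_dist_sq)
qed

lemma Parseval:
  assumes "f \<in> L2 \<mu>" "g \<in> L2 \<mu>"
  shows "(\<lambda>j. L2_inner \<mu> f (e j) * L2_inner \<mu> g (e j)) sums L2_inner \<mu> f g"
proof -
  have "(\<lambda>n. L2_inner \<mu> (\<lambda>x. \<Sum>j<n. L2_inner \<mu> f (e j) * e j x) g) \<longlonglongrightarrow> L2_inner \<mu> f g"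
    by (intro L2_inner_tendsto L2_sum basis_L2 assms complete_norm)
  then show ?thesis
    unfolding sums_def L2_inner_sum[OF basis_L2 assms(2)]
    by (simp add: L2_inner_commute[of \<mu> "e j" g for j])
qed

lemma Parseval_norm:
  assumes "f \<in> L2 \<mu>"
  shows "(\<lambda>j. (L2_inner \<mu> f (e j))\<^sup>2) sums (L2_norm \<mu> f)\<^sup>2"
  using Parseval[OF assms assms] by (simp add: power2_eq_square L2_norm_sq[symmetric])

lemma eq_AE_if_coeffs_eq:
  assumes "f \<in> L2 \<mu>" "g \<in> L2 \<mu>" "\<And>j. L2_inner \<mu> f (e j) = L2_inner \<mu> g (e j)"
  shows "AE x in \<mu>. f x = g x"
proof -
  let ?h = "\<lambda>x. f x - g x"
  have "(\<lambda>j. 0 :: real) sums L2_inner \<mu> ?h ?h"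
    using Parseval[OF L2_diff[OF assms(1,2)] L2_diff[OF assms(1,2)]]
    by (simp add: L2_inner_diff[OF assms(1,2) basis_L2] assms(3))
  then have "L2_inner \<mu> ?h ?h = 0" using sums_unique2 sums_zero by blast
  from L2_inner_self_zero[OF L2_diff[OF assms(1,2)] this] show ?thesis by simp
qed

text \<open>
  The partial sums are Cauchy, and along indices \<open>r\<^sub>k\<close> whose tails are below \<open>4\<^bsup>-k\<^esup>\<close> their increments
  are summable in \<open>L\<^sup>1\<close>, hence almost everywhere.  The pointwise limit along \<open>r\<^sub>k\<close> is the \<open>L\<^sup>2\<close> limit
  by Fatou's lemma.
\<close>

lemma Riesz_Fischer:
  assumes c: "summable (\<lambda>j. (c j)\<^sup>2)"
  shows "\<exists>g\<in>L2 \<mu>. \<forall>j. L2_inner \<mu> g (e j) = c j"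
proof -
  have half_pow: "((1/2)^k)\<^sup>2 = ((1/4)^k :: real)" for k
    unfolding power_mult[symmetric] mult.commute[of k] unfolding power_mult by (simp add: power2_eq_square)
  define S where "S n x = (\<Sum>j<n. c j * e j x)" for n x
  have SL: "S n \<in> L2 \<mu>" for n unfolding S_def by (intro L2_sum basis_L2)
  have [measurable]: "S n \<in> borel_measurable \<mu>" for n using SL L2_measurable by blast
  have S_diff: "(L2_norm \<mu> (\<lambda>x. S m x - S n x))\<^sup>2 = (\<Sum>j\<in>{n..<m}. (c j)\<^sup>2)" if "n \<le> m" for n m
  proof -
    have "S m x - S n x = (\<Sum>j\<in>{n..<m}. c j * e j x)" for x
      unfolding S_def using that sum_diff_nat_ivl[of 0 n m "\<lambda>j. c j * e j x"]
      by (simp add: atLeast0LessThan)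
    then show ?thesis using partial_sum_norm[of "{n..<m}" c] by simp
  qed
  have "\<exists>N. \<forall>n\<ge>N. norm (suminf (\<lambda>i. (c (i + n))\<^sup>2)) < (1/4)^k" for k
    by (rule suminf_exist_split[OF _ c]) simp
  then obtain N where N: "\<And>k n. n \<ge> N k \<Longrightarrow> norm (suminf (\<lambda>i. (c (i + n))\<^sup>2)) < (1/4)^k"
    by metis
  define r where "r k = (\<Sum>i\<le>k. N i)" for k
  have r_mono: "r k \<le> r l" if "k \<le> l" for k l
    unfolding r_def using that by (intro sum_mono2) auto
  have rN: "r k \<ge> N k" for k unfolding r_def by (rule member_le_sum) auto
  have tail: "(L2_norm \<mu> (\<lambda>x. S m x - S (r k) x))\<^sup>2 \<le> (1/4)^k" if "r k \<le> m" for m k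
  proof -
    have "(\<Sum>j\<in>{r k..<m}. (c j)\<^sup>2) = (\<Sum>i<m - r k. (c (i + r k))\<^sup>2)"
      by (rule sum.reindex_bij_witness[where i = "\<lambda>i. i + r k" and j = "\<lambda>j. j - r k"]) auto
    also have "\<dots> \<le> suminf (\<lambda>i. (c (i + r k))\<^sup>2)"
      by (rule sum_le_suminf) (auto intro: summable_ignore_initial_segment[OF c])
    also have "\<dots> \<le> (1/4)^k" using N[OF rN[of k]] by simp
    finally show ?thesis using S_diff[OF that] by simp
  qed
  have tail': "L2_norm \<mu> (\<lambda>x. S m x - S (r k) x) \<le> (1/2)^k" if "r k \<le> m" for m k
  proof (rule power2_le_imp_le)
    show "(L2_norm \<mu> (\<lambda>x. S m x - S (r k) x))\<^sup>2 \<le> ((1/2)^k)\<^sup>2"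
      using tail[OF that] by (simp add: half_pow)
  qed simp
  define D where "D k x = S (r (Suc k)) x - S (r k) x" for k x
  have DL: "D k \<in> L2 \<mu>" for k unfolding D_def by (intro L2_diff SL)
  have [measurable]: "D k \<in> borel_measurable \<mu>" for k using DL L2_measurable by blast
  define B where "B = L2_norm \<mu> (\<lambda>x. 1)"
  have D_L1: "(\<integral>x. \<bar>D k x\<bar> \<partial>\<mu>) \<le> (1/2)^k * B" for k
  proof -
    have aL: "(\<lambda>x. \<bar>D k x\<bar>) \<in> L2 \<mu>" using DL[of k] by (auto simp: L2_def)
    have "L2_inner \<mu> (\<lambda>x. \<bar>D k x\<bar>) (\<lambda>x. 1) \<le> L2_norm \<mu> (\<lambda>x. \<bar>D k x\<bar>) * B"
      using L2_Cauchy_Schwarz[OF aL const_L2[of 1]] unfolding B_def by simp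
    also have "L2_norm \<mu> (\<lambda>x. \<bar>D k x\<bar>) = L2_norm \<mu> (D k)"
      unfolding L2_norm_def L2_inner_def by simp
    also have "\<dots> \<le> (1/2)^k" unfolding D_def by (rule tail') (simp add: r_mono)
    finally show ?thesis unfolding L2_inner_def B_def by (simp add: mult_right_mono)
  qed
  have "AE x in \<mu>. summable (\<lambda>k. \<bar>D k x\<bar>)"
  proof -
    have "(\<integral>\<^sup>+x. (\<Sum>k. ennreal \<bar>D k x\<bar>) \<partial>\<mu>) = (\<Sum>k. \<integral>\<^sup>+x. ennreal \<bar>D k x\<bar> \<partial>\<mu>)"
      by (rule nn_integral_suminf) simp
    also have "\<dots> \<le> (\<Sum>k. ennreal ((1/2)^k * B))"
    proof (intro suminf_le allI)
      fix k
      have "integrable \<mu> (\<lambda>x. \<bar>D k x\<bar>)"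
        using L2_integrable[OF finite_measure_axioms DL] by simp
      then have "(\<integral>\<^sup>+x. ennreal \<bar>D k x\<bar> \<partial>\<mu>) = ennreal (\<integral>x. \<bar>D k x\<bar> \<partial>\<mu>)"
        by (rule nn_integral_eq_integral) simp
      then show "(\<integral>\<^sup>+x. ennreal \<bar>D k x\<bar> \<partial>\<mu>) \<le> ennreal ((1/2)^k * B)"
        using D_L1[of k] by (simp add: ennreal_leI)
    qed auto
    also have "\<dots> = ennreal (\<Sum>k. (1/2)^k * B)"
      by (rule suminf_ennreal2) (auto simp: B_def intro!: summable_mult2)
    also have "\<dots> < \<infinity>" by simp
    finally have "(\<integral>\<^sup>+x. (\<Sum>k. ennreal \<bar>D k x\<bar>) \<partial>\<mu>) \<noteq> \<infinity>" by simp
    then have "AE x in \<mu>. (\<Sum>k. ennreal \<bar>D k x\<bar>) \<noteq> \<infinity>"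
      by (intro nn_integral_noteq_infinite) auto
    then show ?thesis
      by eventually_elim (auto intro: summable_suminf_not_top)
  qed
  then have conv: "AE x in \<mu>. convergent (\<lambda>k. S (r k) x)"
  proof eventually_elim
    case (elim x)
    then have "summable (\<lambda>k. D k x)" by (rule summable_rabs_cancel)
    then have "convergent (\<lambda>n. \<Sum>k<n. D k x)" by (simp add: summable_iff_convergent)
    moreover have "(\<Sum>k<n. D k x) = S (r n) x - S (r 0) x" for n
      unfolding D_def by (rule sum_lessThan_telescope)
    ultimately have "convergent (\<lambda>n. S (r n) x - S (r 0) x)" by simp
    from convergent_add[OF this convergent_const[of "S (r 0) x"]] show ?case by simp
  qed
  define g where "g x = lim (\<lambda>k. S (r k) x)" for x
  have [measurable]: "g \<in> borel_measurable \<mu>" unfolding g_def by measurable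
  have g_lim: "AE x in \<mu>. (\<lambda>k. S (r k) x) \<longlonglongrightarrow> g x"
    using conv by eventually_elim (auto simp: g_def convergent_LIMSEQ_iff)
  have Fatou: "(\<integral>\<^sup>+x. ennreal ((g x - S (r k) x)\<^sup>2) \<partial>\<mu>) \<le> ennreal ((1/4)^k)" for k
  proof -
    have "(\<integral>\<^sup>+x. ennreal ((g x - S (r k) x)\<^sup>2) \<partial>\<mu>)
      = (\<integral>\<^sup>+x. liminf (\<lambda>l. ennreal ((S (r l) x - S (r k) x)\<^sup>2)) \<partial>\<mu>)"
    proof (rule nn_integral_cong_AE, use g_lim in eventually_elim)
      case (elim x)
      then have "(\<lambda>l. ennreal ((S (r l) x - S (r k) x)\<^sup>2)) \<longlonglongrightarrow> ennreal ((g x - S (r k) x)\<^sup>2)"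
        by (intro tendsto_intros)
      then show ?case using lim_imp_Liminf trivial_limit_sequentially by metis
    qed
    also have "\<dots> \<le> liminf (\<lambda>l. \<integral>\<^sup>+x. ennreal ((S (r l) x - S (r k) x)\<^sup>2) \<partial>\<mu>)"
      by (rule nn_integral_liminf) simp
    also have "\<dots> \<le> ennreal ((1/4)^k)"
    proof (rule Liminf_le)
      have "(\<integral>\<^sup>+x. ennreal ((S (r l) x - S (r k) x)\<^sup>2) \<partial>\<mu>) \<le> ennreal ((1/4)^k)" if "l \<ge> k" for l
      proof -
        have "(\<integral>\<^sup>+x. ennreal ((S (r l) x - S (r k) x)\<^sup>2) \<partial>\<mu>)
           = ennreal (\<integral>x. (S (r l) x - S (r k) x)\<^sup>2 \<partial>\<mu>)"
          by (rule nn_integral_eq_integral)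
            (use L2_diff[OF SL SL, of "r l" "r k"] in \<open>auto simp: L2_def\<close>)
        also have "(\<integral>x. (S (r l) x - S (r k) x)\<^sup>2 \<partial>\<mu>) = (L2_norm \<mu> (\<lambda>x. S (r l) x - S (r k) x))\<^sup>2"
          unfolding L2_norm_sq by (simp add: L2_inner_def power2_eq_square)
        finally show ?thesis using tail[OF r_mono[OF that]] by (simp add: ennreal_leI)
      qed
      then show "\<forall>\<^sub>F l in sequentially. (\<integral>\<^sup>+x. ennreal ((S (r l) x - S (r k) x)\<^sup>2) \<partial>\<mu>) \<le> ennreal ((1/4)^k)"
        by (auto simp: eventually_sequentially)
    qed simp
    finally show ?thesis .
  qed
  have gd: "(\<lambda>x. g x - S (r k) x) \<in> L2 \<mu>" for k
    unfolding L2_def using le_less_trans[OF Fatou[of k]]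
    by (auto intro!: integrableI_bounded)
  have gL: "g \<in> L2 \<mu>" using L2_add[OF gd[of 0] SL[of "r 0"]] by simp
  have g_norm: "L2_norm \<mu> (\<lambda>x. S (r k) x - g x) \<le> (1/2)^k" for k
  proof (rule power2_le_imp_le)
    have "ennreal (\<integral>x. (g x - S (r k) x)\<^sup>2 \<partial>\<mu>) \<le> ennreal ((1/4)^k)"
      using Fatou[of k] gd[of k] by (subst nn_integral_eq_integral[symmetric]) (auto simp: L2_def)
    then have "(\<integral>x. (g x - S (r k) x)\<^sup>2 \<partial>\<mu>) \<le> (1/4)^k" by (simp add: ennreal_le_iff)
    moreover have "(L2_norm \<mu> (\<lambda>x. S (r k) x - g x))\<^sup>2 = (\<integral>x. (g x - S (r k) x)\<^sup>2 \<partial>\<mu>)"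
      unfolding L2_norm_sq L2_inner_def by (simp add: power2_eq_square algebra_simps)
    ultimately show "(L2_norm \<mu> (\<lambda>x. S (r k) x - g x))\<^sup>2 \<le> ((1/2)^k)\<^sup>2"
      by (simp add: half_pow)
  qed simp
  have "L2_inner \<mu> g (e j) = c j" for j
  proof -
    have "(\<lambda>k. L2_norm \<mu> (\<lambda>x. S (r k) x - g x)) \<longlonglongrightarrow> 0"
      by (rule real_tendsto_sandwich[OF _ _ tendsto_const, where h = "\<lambda>k. (1/2)^k"])
        (auto simp: g_norm intro!: LIMSEQ_power_zero)
    then have lim: "(\<lambda>k. L2_inner \<mu> (S (r k)) (e j)) \<longlonglongrightarrow> L2_inner \<mu> g (e j)"
      by (intro L2_inner_tendsto SL gL basis_L2)
    have coeff: "L2_inner \<mu> (S n) (e j) = (if j < n then c j else 0)" for n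
      unfolding S_def by (subst L2_inner_sum) (auto simp: basis_L2 orthonormal mult_delta_right)
    \<comment> \<open>\<open>r\<close> need not be unbounded: it may stop once all later coefficients vanish\<close>
    show ?thesis
    proof (cases "c j = 0")
      case True
      then have "(\<lambda>k. L2_inner \<mu> (S (r k)) (e j)) = (\<lambda>k. 0)" by (auto simp: coeff)
      then show ?thesis using lim True by (simp add: LIMSEQ_const_iff)
    next
      case False
      have "\<forall>\<^sub>F k in sequentially. j < r k"
      proof -
        have "\<exists>k. (1/4)^k < (c j)\<^sup>2"
          using False by (intro real_arch_pow_inv) auto
        then obtain k where k: "(1/4)^k < (c j)\<^sup>2" by blast
        have "j < r l" if "l \<ge> k" for l
        proof (rule ccontr)
          assume "\<not> j < r l"
          then have "r k \<le> j" using r_mono[OF that] by simp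
          then have "(c j)\<^sup>2 \<le> (\<Sum>i\<in>{r k..<Suc j}. (c i)\<^sup>2)"
            by (intro member_le_sum) auto
          also have "\<dots> \<le> (1/4)^k"
            using tail[of k "Suc j"] S_diff[of "r k" "Suc j"] \<open>r k \<le> j\<close> by simp
          finally show False using k by simp
        qed
        then show ?thesis by (auto simp: eventually_sequentially)
      qed
      then have "(\<lambda>k. L2_inner \<mu> (S (r k)) (e j)) \<longlonglongrightarrow> c j"
        unfolding coeff by (intro tendsto_eventually) (erule eventually_mono, simp)
      then show ?thesis using lim LIMSEQ_unique by blast
    qed
  qed
  then show ?thesis using gL by blast
qed

end

section \<open>Spectral expansion of the heat kernel\<close>

text \<open>
  The generator describes the semigroup to first order, \<open>\<parallel>P\<^sub>h \<Phi> - e\<^bsup>-lam h\<^esup> \<Phi>\<parallel> = o(h)\<close>.  As \<open>P\<^sub>h\<close> is a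
  contraction, \<open>n\<close> steps of length \<open>t / n\<close> accumulate an error of at most \<open>n o(t / n)\<close>, which tends
  to \<open>0\<close>.
\<close>

lemma semigroup_eigenfunction:
  assumes HS: "heat_semigroup \<mu> \<E> \<F> P" and Phi: "\<Phi> \<in> L2 \<mu>"
    and G: "generator \<mu> \<E> \<F> \<Phi> (\<lambda>x. - lam * \<Phi> x)"
    and "0 \<le> lam" "0 \<le> t"
  shows "AE x in \<mu>. P t \<Phi> x = exp (- lam * t) * \<Phi> x"
proof -
  have PL: "P t f \<in> L2 \<mu>" if "t \<ge> 0" "f \<in> L2 \<mu>" for t f
    using HS that unfolding heat_semigroup_def by blast
  note [measurable] = L2_measurable[OF Phi]
  have [measurable]: "P t \<Phi> \<in> borel_measurable \<mu>" if "t \<ge> 0" for t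
    using PL[OF that Phi] L2_measurable by blast
  have contr: "L2_norm \<mu> (P t f) \<le> L2_norm \<mu> f" if "t \<ge> 0" "f \<in> L2 \<mu>" for t f
    using HS that unfolding heat_semigroup_def L2_norm_def L2_inner_def
    by (auto simp: power2_eq_square)
  have lin: "AE x in \<mu>. P t (\<lambda>y. a * f y + b * g y) x = a * P t f x + b * P t g x"
    if "t \<ge> 0" "f \<in> L2 \<mu>" "g \<in> L2 \<mu>" for t f g a b
    using HS that unfolding heat_semigroup_def by blast
  have P0: "AE x in \<mu>. P 0 \<Phi> x = \<Phi> x"
    using HS Phi unfolding heat_semigroup_def by blast
  have semi: "AE x in \<mu>. P (r + t) \<Phi> x = P r (P t \<Phi>) x" if "r \<ge> 0" "t \<ge> 0" for r t
    using HS Phi that unfolding heat_semigroup_def by blast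
  define D where "D h x = P h \<Phi> x - exp (- lam * h) * \<Phi> x" for h x
  have DL: "D h \<in> L2 \<mu>" if "h \<ge> 0" for h
    unfolding D_def using that by (intro L2_diff L2_scale PL Phi)
  have [measurable]: "D h \<in> borel_measurable \<mu>" if "h \<ge> 0" for h
    using DL[OF that] L2_measurable by blast

  have small: "((\<lambda>h. L2_norm \<mu> (D h) / h) \<longlongrightarrow> 0) (at_right 0)"
  proof (rule real_tendsto_sandwich[OF _ _ tendsto_const])
    let ?A = "\<lambda>h x. (P h \<Phi> x - \<Phi> x) / h - - lam * \<Phi> x"
    let ?c = "\<lambda>h. (exp (- lam * h) - 1) / h + lam"
    show "\<forall>\<^sub>F h in at_right 0. 0 \<le> L2_norm \<mu> (D h) / h"
      by (auto simp: eventually_at_filter)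
    show "\<forall>\<^sub>F h in at_right 0. L2_norm \<mu> (D h) / h
        \<le> sqrt (L2_dist_sq \<mu> (\<lambda>x. (P h \<Phi> x - \<Phi> x) / h) (\<lambda>x. - lam * \<Phi> x)) + \<bar>?c h\<bar> * L2_norm \<mu> \<Phi>"
    proof -
      have "L2_norm \<mu> (D h) / h \<le> sqrt (L2_dist_sq \<mu> (\<lambda>x. (P h \<Phi> x - \<Phi> x) / h) (\<lambda>x. - lam * \<Phi> x)) + \<bar>?c h\<bar> * L2_norm \<mu> \<Phi>"
        if "h > 0" for h
      proof -
        have "(\<lambda>x. (1/h) * P h \<Phi> x + (lam - 1/h) * \<Phi> x) \<in> L2 \<mu>"
          using that by (intro L2_lincomb PL Phi) auto
        then have AL: "?A h \<in> L2 \<mu>" using that by (simp add: field_simps)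
        have "L2_norm \<mu> (D h) / h = L2_norm \<mu> (\<lambda>x. (1/h) * D h x)"
          using that unfolding L2_norm_scale by simp
        also have "(\<lambda>x. (1/h) * D h x) = (\<lambda>x. ?A h x + (- ?c h) * \<Phi> x)"
          using that by (auto simp: D_def field_simps)
        also have "L2_norm \<mu> \<dots> \<le> L2_norm \<mu> (?A h) + L2_norm \<mu> (\<lambda>x. (- ?c h) * \<Phi> x)"
          by (intro L2_norm_add_le AL L2_scale Phi)
        also have "L2_norm \<mu> (\<lambda>x. (- ?c h) * \<Phi> x) = \<bar>?c h\<bar> * L2_norm \<mu> \<Phi>"
          by (simp only: L2_norm_scale abs_minus_cancel)
        also have "L2_norm \<mu> (?A h) = sqrt (L2_dist_sq \<mu> (\<lambda>x. (P h \<Phi> x - \<Phi> x) / h) (\<lambda>x. - lam * \<Phi> x))"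
          unfolding L2_dist_sq_norm by simp
        finally show ?thesis .
      qed
      then show ?thesis by (auto simp: eventually_at_filter)
    qed
    have "((\<lambda>h. L2_dist_sq \<mu> (\<lambda>x. (P h \<Phi> x - \<Phi> x) / h) (\<lambda>x. - lam * \<Phi> x)) \<longlongrightarrow> 0) (at_right 0)"
      using HS G Phi L2_scale[OF Phi, of "- lam"] unfolding heat_semigroup_def by blast
    from tendsto_real_sqrt[OF this]
    have 1: "((\<lambda>h. sqrt (L2_dist_sq \<mu> (\<lambda>x. (P h \<Phi> x - \<Phi> x) / h) (\<lambda>x. - lam * \<Phi> x))) \<longlongrightarrow> 0) (at_right 0)"
      by simp
    have "((\<lambda>h. exp (- lam * h)) has_field_derivative - lam) (at 0)"
      by (auto intro!: derivative_eq_intros)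
    then have "((\<lambda>h. (exp (- lam * h) - 1) / h) \<longlongrightarrow> - lam) (at 0)"
      by (simp add: DERIV_def)
    then have "((\<lambda>h. (exp (- lam * h) - 1) / h) \<longlongrightarrow> - lam) (at_right 0)"
      by (rule filterlim_mono) (auto intro: at_le)
    then have "(?c \<longlongrightarrow> - lam + lam) (at_right 0)" by (intro tendsto_intros)
    then have 2: "((\<lambda>h. \<bar>?c h\<bar> * L2_norm \<mu> \<Phi>) \<longlongrightarrow> \<bar>- lam + lam\<bar> * L2_norm \<mu> \<Phi>) (at_right 0)"
      by (intro tendsto_mult tendsto_rabs tendsto_const)
    show "((\<lambda>h. sqrt (L2_dist_sq \<mu> (\<lambda>x. (P h \<Phi> x - \<Phi> x) / h) (\<lambda>x. - lam * \<Phi> x)) + \<bar>?c h\<bar> * L2_norm \<mu> \<Phi>) \<longlongrightarrow> 0) (at_right 0)"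
      using tendsto_add[OF 1 2] by simp
  qed
  have step: "L2_norm \<mu> (D (real n * h)) \<le> real n * L2_norm \<mu> (D h)" if "h \<ge> 0" for n h
  proof (induction n)
    case 0
    have "L2_norm \<mu> (D 0) = L2_norm \<mu> (\<lambda>x. 0)"
      by (rule L2_norm_cong_AE) (use P0 in \<open>auto simp: D_def\<close>)
    then show ?case by (simp add: L2_norm_def L2_inner_def)
  next
    case (Suc n)
    define r where "r = real n * h"
    have r: "r \<ge> 0" using that by (simp add: r_def)
    have eq: "real (Suc n) * h = r + h" by (simp add: r_def algebra_simps)
    have PD: "P r (D h) \<in> L2 \<mu>" by (intro PL DL r that)
    have "AE x in \<mu>. D (r + h) x = P r (D h) x + exp (- lam * h) * D r x"
    proof -
      have "AE x in \<mu>. P r (\<lambda>y. 1 * P h \<Phi> y + (- exp (- lam * h)) * \<Phi> y) x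
          = 1 * P r (P h \<Phi>) x + (- exp (- lam * h)) * P r \<Phi> x"
        by (rule lin) (use r that PL Phi in auto)
      moreover have "(\<lambda>y. 1 * P h \<Phi> y + (- exp (- lam * h)) * \<Phi> y) = D h"
        by (auto simp: D_def)
      ultimately have "AE x in \<mu>. P r (D h) x = P r (P h \<Phi>) x - exp (- lam * h) * P r \<Phi> x"
        by simp
      with semi[OF r that] show ?thesis
        by eventually_elim (simp add: D_def algebra_simps exp_add[symmetric])
    qed
    then have "L2_norm \<mu> (D (r + h)) = L2_norm \<mu> (\<lambda>x. P r (D h) x + exp (- lam * h) * D r x)"
      using r that L2_measurable[OF PD] by (intro L2_norm_cong_AE) auto
    also have "\<dots> \<le> L2_norm \<mu> (P r (D h)) + L2_norm \<mu> (\<lambda>x. exp (- lam * h) * D r x)"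
      by (intro L2_norm_add_le PD L2_scale DL r)
    also have "L2_norm \<mu> (P r (D h)) \<le> L2_norm \<mu> (D h)" by (intro contr DL r that)
    also have "L2_norm \<mu> (\<lambda>x. exp (- lam * h) * D r x) \<le> 1 * L2_norm \<mu> (D r)"
      unfolding L2_norm_scale using \<open>0 \<le> lam\<close> that by (intro mult_right_mono) auto
    finally show ?case using Suc.IH unfolding eq by (simp add: r_def algebra_simps)
  qed
  have "L2_norm \<mu> (D t) \<le> 0"
  proof (cases "t = 0")
    case True
    then show ?thesis using step[of t 0] by simp
  next
    case False
    then have t: "t > 0" using \<open>0 \<le> t\<close> by simp
    have h0: "filterlim (\<lambda>n. t / real (Suc n)) (at_right 0) sequentially"
      by (rule tendsto_imp_filterlim_at_right[OF LIMSEQ_Suc[OF lim_const_over_n[of t]]])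
        (use t in \<open>auto intro!: always_eventually\<close>)
    have "(\<lambda>n. t * (L2_norm \<mu> (D (t / real (Suc n))) / (t / real (Suc n)))) \<longlonglongrightarrow> t * 0"
      by (intro tendsto_mult tendsto_const filterlim_compose[OF small h0])
    moreover have "L2_norm \<mu> (D t) \<le> t * (L2_norm \<mu> (D (t / real (Suc n))) / (t / real (Suc n)))" for n
      using step[of "t / real (Suc n)" "Suc n"] t by (simp add: field_simps del: of_nat_Suc)
    ultimately show ?thesis by (intro LIMSEQ_le_const) auto
  qed
  then have "L2_inner \<mu> (D t) (D t) = 0"
    using L2_norm_nonneg[of \<mu> "D t"] L2_norm_sq[of \<mu> "D t"] by simp
  from L2_inner_self_zero[OF DL[OF \<open>0 \<le> t\<close>] this] show ?thesis
    by (auto simp: D_def)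
qed

locale compact_space_measure =
  fixes K :: "'a::metric_space set" and \<mu> :: "'a measure"
  assumes compact_K: "compact K" and space_mu: "space \<mu> = K"
    and sets_mu: "sets \<mu> = sets (restrict_space borel K)"
    and finite_mu: "finite_measure \<mu>"
    and full_support: "open U \<Longrightarrow> U \<inter> K \<noteq> {} \<Longrightarrow> 0 < emeasure \<mu> (U \<inter> K)"
begin

lemma continuous_measurable:
  fixes f :: "'a \<Rightarrow> real"
  shows "continuous_on K f \<Longrightarrow> f \<in> borel_measurable \<mu>"
  unfolding measurable_cong_sets[OF sets_mu refl] by (rule borel_measurable_continuous_on_restrict)

lemma continuous_bounded:
  fixes f :: "'a \<Rightarrow> real"
  assumes "continuous_on K f"
  obtains B where "B > 0" "\<And>x. x \<in> K \<Longrightarrow> \<bar>f x\<bar> \<le> B"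
proof -
  have "bounded (f ` K)"
    using compact_continuous_image[OF assms compact_K] compact_imp_bounded by blast
  then show ?thesis using that unfolding bounded_pos by auto
qed

lemma continuous_L2:
  fixes f :: "'a \<Rightarrow> real"
  assumes "continuous_on K f"
  shows "f \<in> L2 \<mu>"
proof -
  interpret finite_measure \<mu> by (rule finite_mu)
  have c: "continuous_on K (\<lambda>x. (f x)\<^sup>2)" by (intro continuous_intros assms)
  obtain B where B: "\<And>x. x \<in> K \<Longrightarrow> \<bar>(f x)\<^sup>2\<bar> \<le> B" using continuous_bounded[OF c] by metis
  have "integrable \<mu> (\<lambda>x. (f x)\<^sup>2)"
    by (rule integrable_const_bound[of _ B])
      (use B space_mu continuous_measurable[OF c] in \<open>auto intro!: AE_I2\<close>)
  then show ?thesis using continuous_measurable[OF assms] by (simp add: L2_def)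
qed

lemma continuous_integrable:
  fixes f :: "'a \<Rightarrow> real"
  shows "continuous_on K f \<Longrightarrow> integrable \<mu> f"
  using L2_integrable[OF finite_mu continuous_L2] .

text \<open>
  The set where the two functions differ is relatively open, so by full support it is empty if it
  is null.  This upgrades the \<open>L\<^sup>2\<close> identities below to pointwise ones.
\<close>

lemma continuous_eq_if_AE_eq:
  fixes f g :: "'a \<Rightarrow> real"
  assumes f: "continuous_on K f" and g: "continuous_on K g" and AE: "AE x in \<mu>. f x = g x"
    and "x \<in> K"
  shows "f x = g x"
proof (rule ccontr)
  assume ne: "f x \<noteq> g x"
  have "continuous_on K (\<lambda>x. f x - g x)" by (intro continuous_intros f g)
  then obtain U where U: "open U" "U \<inter> K = (\<lambda>x. f x - g x) -` (- {0}) \<inter> K"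
    by (metis continuous_on_open_invariant open_Compl closed_singleton)
  have "x \<in> U \<inter> K" using U ne \<open>x \<in> K\<close> by auto
  then have pos: "0 < emeasure \<mu> (U \<inter> K)" using full_support U(1) by blast
  have "AE x in \<mu>. x \<notin> U \<inter> K" using AE U(2) by (auto elim: eventually_mono)
  then have "emeasure \<mu> {x \<in> space \<mu>. x \<in> U \<inter> K} = 0" by (rule emeasure_eq_0_AE)
  moreover have "{x \<in> space \<mu>. x \<in> U \<inter> K} = U \<inter> K" by (auto simp: space_mu)
  ultimately have "emeasure \<mu> (U \<inter> K) = 0" by simp
  then show False using pos by simp
qed

lemma continuous_section:
  fixes F :: "'a \<Rightarrow> 'a \<Rightarrow> real"
  assumes F: "continuous_on (K \<times> K) (\<lambda>(x, y). F x y)" and "x \<in> K"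
  shows "continuous_on K (F x)"
proof -
  have "continuous_on K (\<lambda>y. (\<lambda>(x, y). F x y) (x, y))"
    by (rule continuous_on_compose2[OF F]) (auto intro!: continuous_intros assms)
  then show ?thesis by simp
qed

lemma continuous_integral_kernel:
  fixes F :: "'a \<Rightarrow> 'a \<Rightarrow> real"
  assumes F: "continuous_on (K \<times> K) (\<lambda>(x, y). F x y)" and f: "integrable \<mu> f"
  shows "continuous_on K (\<lambda>x. \<integral>y. F x y * f y \<partial>\<mu>)"
proof (unfold continuous_on_sequentially, intro ballI allI impI, elim conjE)
  fix u x assume x: "x \<in> K" and u: "\<forall>n. u n \<in> K" and lim: "u \<longlonglongrightarrow> x"
  note sec = continuous_section[OF F]
  have "bounded ((\<lambda>(x, y). F x y) ` (K \<times> K))"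
    using compact_continuous_image[OF F compact_Times[OF compact_K compact_K]] compact_imp_bounded by blast
  then obtain B where B: "\<And>x y. x \<in> K \<Longrightarrow> y \<in> K \<Longrightarrow> \<bar>F x y\<bar> \<le> B"
    unfolding bounded_iff by auto
  show "((\<lambda>x. \<integral>y. F x y * f y \<partial>\<mu>) \<circ> u) \<longlonglongrightarrow> (\<integral>y. F x y * f y \<partial>\<mu>)"
    unfolding o_def
  proof (rule integral_dominated_convergence[where w = "\<lambda>y. B * \<bar>f y\<bar>"])
    show "integrable \<mu> (\<lambda>y. B * \<bar>f y\<bar>)" using f by simp
    show "AE y in \<mu>. (\<lambda>n. F (u n) y * f y) \<longlonglongrightarrow> F x y * f y"
    proof (rule AE_I2)
      fix y assume "y \<in> space \<mu>"
      then have y: "y \<in> K" by (simp add: space_mu)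
      have "continuous_on K (\<lambda>x. (\<lambda>(x, y). F x y) (x, y))"
        by (rule continuous_on_compose2[OF F]) (auto intro!: continuous_intros y)
      then have "(\<lambda>n. F (u n) y) \<longlonglongrightarrow> F x y"
        unfolding continuous_on_sequentially using x u lim by (auto simp: o_def)
      then show "(\<lambda>n. F (u n) y * f y) \<longlonglongrightarrow> F x y * f y" by (intro tendsto_intros)
    qed
    show "AE y in \<mu>. norm (F (u n) y * f y) \<le> B * \<bar>f y\<bar>" for n
      using B u by (intro AE_I2) (auto simp: space_mu abs_mult intro!: mult_right_mono)
    show "(\<lambda>y. F (u n) y * f y) \<in> borel_measurable \<mu>" for n
      using continuous_measurable[OF sec] u f by auto
    show "(\<lambda>y. F x y * f y) \<in> borel_measurable \<mu>"
      using continuous_measurable[OF sec[OF x]] f by auto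
  qed
qed

end

text \<open>
  What remains of the Dirichlet form once its semigroup has been diagonalised.
\<close>

locale diagonal_semigroup = compact_space_measure K \<mu> + L2_basis \<mu> e
  for K :: "'a::metric_space set" and \<mu> e +
  fixes P :: "real \<Rightarrow> ('a \<Rightarrow> real) \<Rightarrow> 'a \<Rightarrow> real" and p :: "real \<Rightarrow> 'a \<Rightarrow> 'a \<Rightarrow> real"
    and \<nu> :: "nat \<Rightarrow> real"
  assumes P_L2: "t > 0 \<Longrightarrow> f \<in> L2 \<mu> \<Longrightarrow> P t f \<in> L2 \<mu>"
    and P_contraction: "t > 0 \<Longrightarrow> f \<in> L2 \<mu> \<Longrightarrow> L2_norm \<mu> (P t f) \<le> L2_norm \<mu> f"
    and P_linear: "t > 0 \<Longrightarrow> f \<in> L2 \<mu> \<Longrightarrow> g \<in> L2 \<mu> \<Longrightarrow>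
      AE x in \<mu>. P t (\<lambda>y. a * f y + b * g y) x = a * P t f x + b * P t g x"
    and P_eigen: "t > 0 \<Longrightarrow> AE x in \<mu>. P t (e j) x = exp (- \<nu> j * t) * e j x"
    and P_kernel: "t > 0 \<Longrightarrow> f \<in> L2 \<mu> \<Longrightarrow> AE x in \<mu>. P t f x = (\<integral>y. p t x y * f y \<partial>\<mu>)"
    and p_continuous: "t > 0 \<Longrightarrow> continuous_on (K \<times> K) (\<lambda>(x, y). p t x y)"
begin

lemma p_section:
  assumes "t > 0" "x \<in> K"
  shows "continuous_on K (p t x)"
  by (rule continuous_section[OF p_continuous[OF assms(1)] assms(2)])

lemma P_sum:
  assumes "t > 0" "finite I"
  shows "AE x in \<mu>. P t (\<lambda>y. \<Sum>j\<in>I. c j * e j y) x = (\<Sum>j\<in>I. c j * (exp (- \<nu> j * t) * e j x))"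
  using assms(2)
proof induction
  case empty
  show ?case using P_linear[OF assms(1) L2_zero L2_zero, of 0 0] by simp
next
  case (insert i I)
  have "AE x in \<mu>. P t (\<lambda>y. c i * e i y + 1 * (\<Sum>j\<in>I. c j * e j y)) x
      = c i * P t (e i) x + 1 * P t (\<lambda>y. \<Sum>j\<in>I. c j * e j y) x"
    by (intro P_linear assms(1) basis_L2 L2_sum)
  with P_eigen[OF assms(1), of i] insert.IH show ?case
    by eventually_elim (use insert.hyps in simp)
qed

text \<open>
  True for finite combinations of the basis, and both sides are continuous in \<open>f\<close>.
\<close>

lemma P_coeff:
  assumes "t > 0" "f \<in> L2 \<mu>"
  shows "L2_inner \<mu> (P t f) (e j) = exp (- \<nu> j * t) * L2_inner \<mu> f (e j)"
proof -
  define S where "S n y = (\<Sum>j<n. L2_inner \<mu> f (e j) * e j y)" for n y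
  have SL: "S n \<in> L2 \<mu>" for n unfolding S_def by (intro L2_sum basis_L2)
  have "L2_norm \<mu> (\<lambda>x. P t (S n) x - P t f x) \<le> L2_norm \<mu> (\<lambda>x. S n x - f x)" for n
  proof -
    have "AE x in \<mu>. P t (\<lambda>y. 1 * S n y + (-1) * f y) x = 1 * P t (S n) x + (-1) * P t f x"
      by (intro P_linear assms SL)
    then have "L2_norm \<mu> (P t (\<lambda>y. S n y - f y)) = L2_norm \<mu> (\<lambda>x. P t (S n) x - P t f x)"
      by (intro L2_norm_cong_AE L2_measurable P_L2 L2_diff SL assms) simp
    then show ?thesis using P_contraction[OF assms(1) L2_diff[OF SL assms(2)], of n] by simp
  qed
  then have "(\<lambda>n. L2_norm \<mu> (\<lambda>x. P t (S n) x - P t f x)) \<longlonglongrightarrow> 0"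
    by (intro real_tendsto_sandwich[OF _ _ tendsto_const complete_norm[OF assms(2)]])
      (auto simp: S_def)
  then have lim: "(\<lambda>n. L2_inner \<mu> (P t (S n)) (e j)) \<longlonglongrightarrow> L2_inner \<mu> (P t f) (e j)"
    by (intro L2_inner_tendsto P_L2 SL assms basis_L2)
  have "L2_inner \<mu> (P t (S n)) (e j) = exp (- \<nu> j * t) * L2_inner \<mu> f (e j)" if "n > j" for n
  proof -
    have "L2_inner \<mu> (P t (S n)) (e j)
      = L2_inner \<mu> (\<lambda>x. \<Sum>i<n. (L2_inner \<mu> f (e i) * exp (- \<nu> i * t)) * e i x) (e j)"
    proof (rule L2_inner_cong_AE)
      show "AE x in \<mu>. P t (S n) x = (\<Sum>i<n. (L2_inner \<mu> f (e i) * exp (- \<nu> i * t)) * e i x)"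
        using P_sum[OF assms(1), of "{..<n}" "\<lambda>i. L2_inner \<mu> f (e i)"]
        unfolding S_def by (simp add: mult.assoc)
    qed (intro L2_measurable P_L2 L2_sum basis_L2 SL assms)+
    also have "\<dots> = exp (- \<nu> j * t) * L2_inner \<mu> f (e j)"
      by (subst L2_inner_sum) (use that in \<open>auto simp: basis_L2 orthonormal mult_delta_right\<close>)
    finally show ?thesis .
  qed
  then have "(\<lambda>n. L2_inner \<mu> (P t (S n)) (e j)) \<longlonglongrightarrow> exp (- \<nu> j * t) * L2_inner \<mu> f (e j)"
    by (intro tendsto_eventually) (auto simp: eventually_at_top_dense)
  then show ?thesis using lim LIMSEQ_unique by blast
qed

text \<open>
  The continuous version of the basis: \<open>P\<^sub>1\<close> multiplies \<open>e\<^sub>j\<close> by \<open>exp (- \<nu>\<^sub>j)\<close> and, through its kernel, maps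
  into the continuous functions.
\<close>

definition cont_basis :: "nat \<Rightarrow> 'a \<Rightarrow> real" where
  "cont_basis j x = exp (\<nu> j) * (\<integral>y. p 1 x y * e j y \<partial>\<mu>)"

lemma cont_basis_continuous: "continuous_on K (cont_basis j)"
  unfolding cont_basis_def
  by (intro continuous_intros continuous_integral_kernel p_continuous
      L2_integrable[OF finite_mu basis_L2]) simp

lemma cont_basis_AE: "AE x in \<mu>. cont_basis j x = e j x"
  using P_kernel[OF zero_less_one basis_L2, of j] P_eigen[OF zero_less_one, of j]
proof eventually_elim
  case (elim x)
  then have "cont_basis j x = (exp (\<nu> j) * exp (- \<nu> j)) * e j x"
    by (simp add: cont_basis_def)
  then show ?case by (simp add: exp_minus)
qed

lemma p_inner_basis:
  assumes "t > 0" "x \<in> K"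
  shows "L2_inner \<mu> (p t x) (e j) = exp (- \<nu> j * t) * cont_basis j x"
proof -
  have "(\<integral>y. p t x y * e j y \<partial>\<mu>) = exp (- \<nu> j * t) * cont_basis j x"
  proof (rule continuous_eq_if_AE_eq[OF _ _ _ assms(2)])
    show "continuous_on K (\<lambda>x. \<integral>y. p t x y * e j y \<partial>\<mu>)"
      by (intro continuous_integral_kernel p_continuous assms L2_integrable[OF finite_mu basis_L2])
    show "continuous_on K (\<lambda>x. exp (- \<nu> j * t) * cont_basis j x)"
      by (intro continuous_intros cont_basis_continuous)
    show "AE x in \<mu>. (\<integral>y. p t x y * e j y \<partial>\<mu>) = exp (- \<nu> j * t) * cont_basis j x"
      using P_kernel[OF assms(1) basis_L2, of j] P_eigen[OF assms(1), of j] cont_basis_AE[of j]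
      by eventually_elim simp
  qed
  then show ?thesis by (simp add: L2_inner_def)
qed

text \<open>
  Both \<open>p\<^sub>t(x,\<cdot>)\<close> and \<open>z \<mapsto> \<langle>p\<^bsub>t/2\<^esub>(x,\<cdot>), p\<^bsub>t/2\<^esub>(z,\<cdot>)\<rangle>\<close> are continuous and have the coefficients
  \<open>e\<^bsup>-\<nu> t\<^esup> e\<^sub>j(x)\<close>, so they agree everywhere; Parseval's identity expands the latter pointwise.  Symmetry
  of the kernel and the Chapman-Kolmogorov equation are contained in the expansion.
\<close>

theorem Mercer:
  assumes "t > 0" "x \<in> K" "y \<in> K"
  shows "(\<lambda>j. exp (- \<nu> j * t) * cont_basis j x * cont_basis j y) sums p t x y"
proof -
  define r where "r = t / 2"
  have r: "r > 0" "r + r = t" using assms by (auto simp: r_def)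
  let ?G = "\<lambda>z. \<integral>w. p r z w * p r x w \<partial>\<mu>"
  have pL: "p s z \<in> L2 \<mu>" if "s > 0" "z \<in> K" for s z
    by (intro continuous_L2 p_section that)
  have Gc: "continuous_on K ?G"
    by (intro continuous_integral_kernel p_continuous continuous_integrable p_section r assms)
  have "AE z in \<mu>. ?G z = p t x z"
  proof (rule eq_AE_if_coeffs_eq)
    show "?G \<in> L2 \<mu>" by (rule continuous_L2[OF Gc])
    show "p t x \<in> L2 \<mu>" by (intro pL assms)
    have "AE z in \<mu>. ?G z = P r (p r x) z"
      using P_kernel[OF r(1) pL[OF r(1) assms(2)]] by eventually_elim simp
    then have "L2_inner \<mu> ?G (e j) = L2_inner \<mu> (P r (p r x)) (e j)" for j
      by (rule L2_inner_cong_AE)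
        (intro L2_measurable P_L2 pL r assms basis_L2 continuous_L2[OF Gc])+
    then show "L2_inner \<mu> ?G (e j) = L2_inner \<mu> (p t x) (e j)" for j
      using r by (simp add: P_coeff pL p_inner_basis assms r_def exp_add[symmetric])
  qed
  then have "?G y = p t x y"
    by (rule continuous_eq_if_AE_eq[OF Gc p_section[OF assms(1,2)] _ assms(3)])
  moreover have "?G y = L2_inner \<mu> (p r x) (p r y)"
    by (simp add: L2_inner_def mult.commute)
  moreover have "(\<lambda>j. L2_inner \<mu> (p r x) (e j) * L2_inner \<mu> (p r y) (e j)) sums L2_inner \<mu> (p r x) (p r y)"
    by (intro Parseval pL r assms)
  moreover have "L2_inner \<mu> (p r x) (e j) * L2_inner \<mu> (p r y) (e j)
     = exp (- \<nu> j * t) * cont_basis j x * cont_basis j y" for j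
    using r by (simp add: p_inner_basis assms r_def exp_add[symmetric])
  ultimately show ?thesis by simp
qed

lemma cont_basis_is_basis: "L2_basis \<mu> cont_basis"
proof
  have m: "cont_basis j \<in> borel_measurable \<mu>" "e j \<in> borel_measurable \<mu>" for j
    using continuous_measurable[OF cont_basis_continuous] L2_measurable[OF basis_L2] by auto
  show L: "cont_basis j \<in> L2 \<mu>" for j by (rule continuous_L2[OF cont_basis_continuous])
  have co: "L2_inner \<mu> f (cont_basis j) = L2_inner \<mu> f (e j)" if "f \<in> borel_measurable \<mu>" for f j
    unfolding L2_inner_commute[of \<mu> f]
    by (intro L2_inner_cong_AE cont_basis_AE m that)
  show "L2_inner \<mu> (cont_basis i) (cont_basis j) = (if i = j then 1 else 0)" for i j
    unfolding co[OF m(1)] L2_inner_commute[of \<mu> "cont_basis i"] co[OF m(2)]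
    by (simp add: orthonormal)
  show "(\<lambda>n. L2_dist_sq \<mu> f (\<lambda>x. \<Sum>j<n. L2_inner \<mu> f (cont_basis j) * cont_basis j x)) \<longlonglongrightarrow> 0"
    if f: "f \<in> L2 \<mu>" for f
  proof -
    have "L2_dist_sq \<mu> f (\<lambda>x. \<Sum>j<n. L2_inner \<mu> f (cont_basis j) * cont_basis j x)
       = L2_dist_sq \<mu> f (\<lambda>x. \<Sum>j<n. L2_inner \<mu> f (e j) * e j x)" for n
      unfolding L2_dist_sq_def
    proof (rule integral_cong_AE)
      have "AE x in \<mu>. \<forall>j. cont_basis j x = e j x"
        by (simp add: AE_all_countable cont_basis_AE)
      then show "AE x in \<mu>. (f x - (\<Sum>j<n. L2_inner \<mu> f (cont_basis j) * cont_basis j x))\<^sup>2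
         = (f x - (\<Sum>j<n. L2_inner \<mu> f (e j) * e j x))\<^sup>2"
        by eventually_elim (simp add: co L2_measurable[OF f])
    qed (use m L2_measurable[OF f] in auto)
    then show ?thesis using complete[OF f] by simp
  qed
qed

end

section \<open>Resistance estimate\<close>

text \<open>
  A heat kernel together with a continuous eigenbasis.  It is a basis of all of \<open>L\<^sup>2\<close>, the
  constants included, so that Parseval's identity applies to functions of any mean.
\<close>

locale heat_expansion = compact_space_measure K \<mu> + L2_basis \<mu> \<psi>
  for K :: "'a::metric_space set" and \<mu> \<psi> +
  fixes p :: "real \<Rightarrow> 'a \<Rightarrow> 'a \<Rightarrow> real" and \<nu> :: "nat \<Rightarrow> real"
  assumes psi_continuous: "continuous_on K (\<psi> j)"
    and nu_nonneg: "0 \<le> \<nu> j"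
    and p_continuous: "t > 0 \<Longrightarrow> continuous_on (K \<times> K) (\<lambda>(x, y). p t x y)"
    and p_coeff: "t > 0 \<Longrightarrow> x \<in> K \<Longrightarrow> L2_inner \<mu> (p t x) (\<psi> j) = exp (- \<nu> j * t) * \<psi> j x"
    and p_expansion: "t > 0 \<Longrightarrow> x \<in> K \<Longrightarrow> y \<in> K \<Longrightarrow>
      (\<lambda>j. exp (- \<nu> j * t) * \<psi> j x * \<psi> j y) sums p t x y"
    and p_total: "t > 0 \<Longrightarrow> x \<in> K \<Longrightarrow> (\<integral>y. p t x y \<partial>\<mu>) = 1"
    and heat_coeff: "t > 0 \<Longrightarrow> f \<in> L2 \<mu> \<Longrightarrow>
      L2_inner \<mu> (\<lambda>x. \<integral>y. p t x y * f y \<partial>\<mu>) (\<psi> j) = exp (- \<nu> j * t) * L2_inner \<mu> f (\<psi> j)"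
begin

definition heat :: "real \<Rightarrow> ('a \<Rightarrow> real) \<Rightarrow> 'a \<Rightarrow> real" where
  "heat t f x = (\<integral>y. p t x y * f y \<partial>\<mu>)"

lemma heat_continuous: "t > 0 \<Longrightarrow> f \<in> L2 \<mu> \<Longrightarrow> continuous_on K (heat t f)"
  unfolding heat_def
  by (intro continuous_integral_kernel p_continuous L2_integrable[OF finite_mu])

lemma p_section:
  assumes "t > 0" "x \<in> K"
  shows "continuous_on K (p t x)"
  by (rule continuous_section[OF p_continuous[OF assms(1)] assms(2)])

lemma heat_sums:
  assumes "t > 0" "x \<in> K" "f \<in> L2 \<mu>"
  shows "(\<lambda>j. exp (- \<nu> j * t) * \<psi> j x * L2_inner \<mu> f (\<psi> j)) sums heat t f x"
proof -
  have "heat t f x = L2_inner \<mu> (p t x) f" by (simp add: L2_inner_def heat_def)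
  then show ?thesis
    using Parseval[OF continuous_L2[OF p_section[OF assms(1,2)]] assms(3)] by (simp add: p_coeff assms)
qed

lemma heat_selfadjoint:
  assumes "t > 0" "f \<in> L2 \<mu>" "g \<in> L2 \<mu>"
  shows "L2_inner \<mu> (heat t f) g = L2_inner \<mu> f (heat t g)"
proof -
  have co: "L2_inner \<mu> (heat t h) (\<psi> j) = exp (- \<nu> j * t) * L2_inner \<mu> h (\<psi> j)" if "h \<in> L2 \<mu>" for h j
    using heat_coeff[OF assms(1) that] by (simp add: heat_def[abs_def])
  have hL: "heat t h \<in> L2 \<mu>" if "h \<in> L2 \<mu>" for h
    by (rule continuous_L2[OF heat_continuous[OF assms(1) that]])
  have "(\<lambda>j. L2_inner \<mu> (heat t f) (\<psi> j) * L2_inner \<mu> g (\<psi> j)) sums L2_inner \<mu> (heat t f) g"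
    by (intro Parseval hL assms)
  moreover have "(\<lambda>j. L2_inner \<mu> f (\<psi> j) * L2_inner \<mu> (heat t g) (\<psi> j)) sums L2_inner \<mu> f (heat t g)"
    by (intro Parseval hL assms)
  ultimately show ?thesis
    using sums_unique2 by (simp add: co assms mult.assoc mult.left_commute)
qed

lemma heat_one: "t > 0 \<Longrightarrow> x \<in> K \<Longrightarrow> heat t (\<lambda>_. 1) x = 1"
  by (simp add: heat_def p_total)

lemma heat_integral:
  assumes "t > 0" "f \<in> L2 \<mu>"
  shows "(\<integral>x. heat t f x \<partial>\<mu>) = (\<integral>x. f x \<partial>\<mu>)"
proof -
  have "L2_inner \<mu> (heat t f) (\<lambda>_. 1) = L2_inner \<mu> f (heat t (\<lambda>_. 1))"
    by (intro heat_selfadjoint assms const_L2)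
  also have "\<dots> = L2_inner \<mu> f (\<lambda>_. 1)"
    unfolding L2_inner_def
    by (rule Bochner_Integration.integral_cong) (auto simp: space_mu heat_one assms)
  finally show ?thesis by (simp add: L2_inner_def)
qed

text \<open>
  Expanding the square reduces the dependence on \<open>a\<close> and \<open>x\<close> to that of \<open>heat t\<close>, and the double
  integrals below to iterated single ones.
\<close>

lemma heat_sq_dev:
  assumes "t > 0" "x \<in> K" and u: "continuous_on K u"
  shows "integrable \<mu> (\<lambda>y. p t x y * (a - u y)\<^sup>2)"
    and "(\<integral>y. p t x y * (a - u y)\<^sup>2 \<partial>\<mu>) = a\<^sup>2 - 2 * a * heat t u x + heat t (\<lambda>y. (u y)\<^sup>2) x"
proof -
  have c: "continuous_on K (\<lambda>y. p t x y * (a - u y)\<^sup>2)"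
    by (intro continuous_intros p_section assms)
  show "integrable \<mu> (\<lambda>y. p t x y * (a - u y)\<^sup>2)" by (rule continuous_integrable[OF c])
  have i: "integrable \<mu> (p t x)" "integrable \<mu> (\<lambda>y. p t x y * u y)" "integrable \<mu> (\<lambda>y. p t x y * (u y)\<^sup>2)"
    by (intro continuous_integrable continuous_intros p_section assms)+
  have "(\<integral>y. p t x y * (a - u y)\<^sup>2 \<partial>\<mu>)
     = (\<integral>y. a\<^sup>2 * p t x y - 2 * a * (p t x y * u y) + p t x y * (u y)\<^sup>2 \<partial>\<mu>)"
    by (rule Bochner_Integration.integral_cong) (auto simp: power2_eq_square algebra_simps)
  also have "\<dots> = a\<^sup>2 * (\<integral>y. p t x y \<partial>\<mu>) - 2 * a * heat t u x + heat t (\<lambda>y. (u y)\<^sup>2) x"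
    using i by (simp add: heat_def)
  finally show "(\<integral>y. p t x y * (a - u y)\<^sup>2 \<partial>\<mu>) = a\<^sup>2 - 2 * a * heat t u x + heat t (\<lambda>y. (u y)\<^sup>2) x"
    by (simp add: p_total assms)
qed

lemma heat_dev_continuous:
  assumes "t > 0" and u: "continuous_on K u"
  shows "continuous_on K (\<lambda>z. \<integral>y. p t z y * (u z - u y)\<^sup>2 \<partial>\<mu>)"
proof -
  have u2: "continuous_on K (\<lambda>y. (u y)\<^sup>2)" by (intro continuous_intros u)
  have "continuous_on K (\<lambda>z. (u z)\<^sup>2 - 2 * u z * heat t u z + heat t (\<lambda>y. (u y)\<^sup>2) z)"
    by (intro continuous_intros u heat_continuous assms continuous_L2 u2)
  then show ?thesis
    by (rule continuous_on_eq) (simp add: heat_sq_dev(2)[OF assms(1) _ u])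
qed

definition eig_sum :: "nat \<Rightarrow> (nat \<Rightarrow> real) \<Rightarrow> 'a \<Rightarrow> real" where
  "eig_sum n c x = (\<Sum>j<n. c j * \<psi> j x)"

definition energy :: "nat \<Rightarrow> (nat \<Rightarrow> real) \<Rightarrow> real" where
  "energy n c = (\<Sum>j<n. \<nu> j * (c j)\<^sup>2)"

lemma energy_nonneg: "0 \<le> energy n c"
  unfolding energy_def by (intro sum_nonneg mult_nonneg_nonneg nu_nonneg) simp

lemma eig_sum_continuous: "continuous_on K (eig_sum n c)"
  unfolding eig_sum_def by (intro continuous_intros psi_continuous)

lemma eig_sum_coeff: "L2_inner \<mu> (eig_sum n c) (\<psi> j) = (if j < n then c j else 0)"
  unfolding eig_sum_def by (subst L2_inner_sum) (auto simp: basis_L2 orthonormal mult_delta_right)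

lemma heat_eig_sum:
  assumes "t > 0" "x \<in> K"
  shows "heat t (eig_sum n c) x = (\<Sum>j<n. exp (- \<nu> j * t) * c j * \<psi> j x)"
proof -
  have "(\<lambda>j. exp (- \<nu> j * t) * \<psi> j x * (if j < n then c j else 0)) sums heat t (eig_sum n c) x"
    using heat_sums[OF assms continuous_L2[OF eig_sum_continuous], of n c] by (simp add: eig_sum_coeff)
  moreover have "(\<lambda>j. exp (- \<nu> j * t) * \<psi> j x * (if j < n then c j else 0)) sums
     (\<Sum>j<n. exp (- \<nu> j * t) * \<psi> j x * (if j < n then c j else 0))"
    by (rule sums_finite) auto
  ultimately have "heat t (eig_sum n c) x = (\<Sum>j<n. exp (- \<nu> j * t) * \<psi> j x * (if j < n then c j else 0))"
    by (rule sums_unique2)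
  also have "\<dots> = (\<Sum>j<n. exp (- \<nu> j * t) * c j * \<psi> j x)"
    by (rule sum.cong) auto
  finally show ?thesis .
qed

text \<open>
  The double integral is \<open>2 \<langle>u - P\<^sub>t u, u\<rangle> = 2 \<Sum>\<^sub>j (1 - e\<^bsup>-\<nu> t\<^esup>) c\<^sub>j\<^sup>2\<close>, the approximate Dirichlet energy
  times \<open>2 t\<close>.
\<close>

lemma heat_energy_le:
  assumes "t > 0"
  shows "(\<integral>z. (\<integral>w. p t z w * (eig_sum n c z - eig_sum n c w)\<^sup>2 \<partial>\<mu>) \<partial>\<mu>) \<le> 2 * t * energy n c"
proof -
  define u where "u = eig_sum n c"
  have u: "continuous_on K u" unfolding u_def by (rule eig_sum_continuous)
  have u2: "continuous_on K (\<lambda>y. (u y)\<^sup>2)" by (intro continuous_intros u)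
  have uL: "u \<in> L2 \<mu>" "(\<lambda>y. (u y)\<^sup>2) \<in> L2 \<mu>" using u u2 by (auto intro: continuous_L2)
  have hc: "continuous_on K (heat t u)" "continuous_on K (heat t (\<lambda>y. (u y)\<^sup>2))"
    using uL by (auto intro: heat_continuous assms)
  have co: "L2_inner \<mu> u (\<psi> j) = (if j < n then c j else 0)" for j
    unfolding u_def by (rule eig_sum_coeff)
  have 1: "(\<integral>z. (u z)\<^sup>2 \<partial>\<mu>) = (\<Sum>j<n. (c j)\<^sup>2)"
    using partial_sum_norm[of "{..<n}" c, unfolded L2_norm_sq]
    by (simp add: u_def eig_sum_def[abs_def] L2_inner_def power2_eq_square)
  have 2: "(\<integral>z. u z * heat t u z \<partial>\<mu>) = (\<Sum>j<n. exp (- \<nu> j * t) * (c j)\<^sup>2)"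
  proof -
    have "(\<lambda>j. L2_inner \<mu> u (\<psi> j) * L2_inner \<mu> (heat t u) (\<psi> j)) sums L2_inner \<mu> u (heat t u)"
      by (intro Parseval uL continuous_L2 hc)
    moreover have "L2_inner \<mu> (heat t u) (\<psi> j) = exp (- \<nu> j * t) * L2_inner \<mu> u (\<psi> j)" for j
      using heat_coeff[OF assms uL(1)] by (simp add: heat_def[abs_def])
    ultimately have "(\<lambda>j. (if j < n then exp (- \<nu> j * t) * (c j)\<^sup>2 else 0)) sums L2_inner \<mu> u (heat t u)"
      by (simp add: co if_distrib power2_eq_square mult_ac cong: if_cong)
    moreover have "(\<lambda>j. (if j < n then exp (- \<nu> j * t) * (c j)\<^sup>2 else 0)) sums
        (\<Sum>j<n. (if j < n then exp (- \<nu> j * t) * (c j)\<^sup>2 else 0))"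
      by (rule sums_finite) auto
    ultimately have "L2_inner \<mu> u (heat t u) = (\<Sum>j<n. (if j < n then exp (- \<nu> j * t) * (c j)\<^sup>2 else 0))"
      by (rule sums_unique2)
    also have "\<dots> = (\<Sum>j<n. exp (- \<nu> j * t) * (c j)\<^sup>2)" by (rule sum.cong) auto
    finally show ?thesis by (simp add: L2_inner_def)
  qed
  have "(\<integral>z. (\<integral>w. p t z w * (u z - u w)\<^sup>2 \<partial>\<mu>) \<partial>\<mu>)
     = (\<integral>z. (u z)\<^sup>2 - 2 * (u z * heat t u z) + heat t (\<lambda>y. (u y)\<^sup>2) z \<partial>\<mu>)"
    by (rule Bochner_Integration.integral_cong)
      (auto simp: space_mu heat_sq_dev(2)[OF assms _ u])
  also have "\<dots> = (\<integral>z. (u z)\<^sup>2 \<partial>\<mu>) - 2 * (\<integral>z. u z * heat t u z \<partial>\<mu>) + (\<integral>z. heat t (\<lambda>y. (u y)\<^sup>2) z \<partial>\<mu>)"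
    using u u2 hc by (simp add: continuous_integrable continuous_intros)
  also have "\<dots> = (\<Sum>j<n. 2 * (1 - exp (- \<nu> j * t)) * (c j)\<^sup>2)"
    unfolding heat_integral[OF assms uL(2)] 1 2
    by (simp add: sum_distrib_left sum_subtractf[symmetric] sum.distrib[symmetric] algebra_simps)
  also have "\<dots> \<le> (\<Sum>j<n. 2 * (t * \<nu> j) * (c j)\<^sup>2)"
  proof (intro sum_mono mult_right_mono mult_left_mono)
    fix j
    show "1 - exp (- \<nu> j * t) \<le> t * \<nu> j"
      using exp_ge_add_one_self[of "- \<nu> j * t"] by (simp add: mult.commute)
  qed auto
  finally show ?thesis
    by (simp add: u_def energy_def sum_distrib_left mult.assoc)
qed

end

text \<open>
  The volume exponent enters only through \<open>\<theta>\<close>, the exponent of the on-diagonal decay.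
\<close>

locale subgaussian_kernel = heat_expansion K \<mu> \<psi> p \<nu>
  for K :: "'a::metric_space set" and \<mu> \<psi> p \<nu> +
  fixes c1 c2 c3 c4 \<theta> d_w :: real
  assumes c_pos: "c1 > 0" "c2 > 0" "c3 > 0" "c4 > 0"
    and d_w: "d_w > 1" and theta: "0 < \<theta>" "\<theta> < 1"
    and p_lower: "0 < t \<Longrightarrow> t < 1 \<Longrightarrow> x \<in> K \<Longrightarrow> y \<in> K \<Longrightarrow>
      c1 * t powr (- \<theta>) * exp (- c2 * (dist x y powr d_w / t) powr (1 / (d_w - 1))) \<le> p t x y"
    and p_upper: "0 < t \<Longrightarrow> t < 1 \<Longrightarrow> x \<in> K \<Longrightarrow> y \<in> K \<Longrightarrow>
      p t x y \<le> c3 * t powr (- \<theta>) * exp (- c4 * (dist x y powr d_w / t) powr (1 / (d_w - 1)))"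
begin

definition \<gamma> :: real where "\<gamma> = 1 / (d_w - 1)"

definition \<kappa> :: real where "\<kappa> = d_w * (1 - \<theta>)"

lemma gamma_pos: "\<gamma> > 0" and kappa_pos: "\<kappa> > 0"
  using d_w theta by (auto simp: \<gamma>_def \<kappa>_def)

lemma p_nonneg: "0 < t \<Longrightarrow> t < 1 \<Longrightarrow> x \<in> K \<Longrightarrow> y \<in> K \<Longrightarrow> 0 \<le> p t x y"
  by (rule order_trans[OF _ p_lower]) (use c_pos in auto)

text \<open>
  With \<open>N(a) = (a\<^bsup>d\<^sub>w\<^esup> / t)\<^sup>\<gamma>\<close>, the triangle inequality gives
  \<open>N(d(z,w)) \<le> 3\<^bsup>d\<^sub>w \<gamma>\<^esup> (N(d(x,z)) + N(d(x,y)) + N(d(y,w)))\<close>.  Running the kernel on the right for the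
  longer time \<open>A t\<close> scales \<open>N(d(z,w))\<close> by \<open>A\<^bsup>-\<gamma>\<^esup>\<close>, and \<open>A\<close> is chosen so large that the decay \<open>c2\<close> of
  the lower bound is weaker than the decay \<open>c4\<close> of the two upper bounds.
\<close>

lemma kernel_product_bound:
  obtains A C where "A \<ge> 1" "C > 0"
    "\<And>t r x y z w. 0 < t \<Longrightarrow> A * t < 1 \<Longrightarrow> t / 2 \<le> r \<Longrightarrow> r \<le> t \<Longrightarrow>
       x \<in> K \<Longrightarrow> y \<in> K \<Longrightarrow> z \<in> K \<Longrightarrow> w \<in> K \<Longrightarrow>
       p r x z * p t y w \<le> C * exp (c4 * (dist x y powr d_w / t) powr \<gamma>) * t powr (- \<theta>) * p (A * t) z w"
proof -
  define E where "E = 3 powr (d_w * \<gamma>)"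
  define A where "A = max 1 ((c2 * E / c4) powr (1 / \<gamma>))"
  define C where "C = c3\<^sup>2 * 2 powr \<theta> * A powr \<theta> / c1"
  have E: "E > 0" by (simp add: E_def)
  have A: "A \<ge> 1" by (simp add: A_def)
  have C: "C > 0" using c_pos A by (simp add: C_def)
  have A_gamma: "c2 * E * A powr (- \<gamma>) \<le> c4"
  proof -
    have "c2 * E / c4 = ((c2 * E / c4) powr (1 / \<gamma>)) powr \<gamma>"
      using c_pos E gamma_pos by (simp add: powr_powr)
    also have "\<dots> \<le> A powr \<gamma>"
      using gamma_pos by (intro powr_mono2) (auto simp: A_def)
    finally show ?thesis using c_pos A by (simp add: powr_minus field_simps)
  qed
  have "p r x z * p t y w \<le> C * exp (c4 * (dist x y powr d_w / t) powr \<gamma>) * t powr (- \<theta>) * p (A * t) z w"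
    if t: "0 < t" "A * t < 1" and r: "t / 2 \<le> r" "r \<le> t" and K: "x \<in> K" "y \<in> K" "z \<in> K" "w \<in> K"
    for t r x y z w
  proof -
    define N where "N a = (a powr d_w / t) powr \<gamma>" for a
    have N_nonneg: "0 \<le> N a" for a by (simp add: N_def)
    have N_mono: "N a \<le> N b" if "0 \<le> a" "a \<le> b" for a b
      unfolding N_def using that t(1) d_w gamma_pos
      by (intro powr_mono2 divide_right_mono) auto
    have N3: "N (3 * a) = E * N a" if "a \<ge> 0" for a
      unfolding N_def E_def using that t(1) by (simp add: powr_mult powr_divide powr_powr)
    have tri: "N (dist z w) \<le> E * (N (dist x z) + N (dist x y) + N (dist y w))"
    proof -
      define m where "m = max (dist x z) (max (dist x y) (dist y w))"
      have "dist z w \<le> dist x z + dist x y + dist y w"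
        using dist_triangle[of z w x] dist_triangle[of x w y] by (simp add: dist_commute)
      also have "\<dots> \<le> 3 * m" by (simp add: m_def)
      finally have "N (dist z w) \<le> N (3 * m)" by (intro N_mono) auto
      also have "\<dots> = E * N m" by (intro N3) (simp add: m_def le_max_iff_disj)
      also have "N m \<le> N (dist x z) + N (dist x y) + N (dist y w)"
        using N_nonneg[of "dist x z"] N_nonneg[of "dist x y"] N_nonneg[of "dist y w"]
        unfolding m_def by (auto simp: max_def)
      finally show ?thesis using E by simp
    qed
    have "t \<le> A * t" using A t(1) by simp
    then have t1: "t < 1" using t(2) by simp
    have r0: "0 < r" "r < 1" using t t1 r by auto
    have up1: "p r x z \<le> c3 * (2 powr \<theta> * t powr (- \<theta>)) * exp (- c4 * N (dist x z))"
    proof -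
      have "p r x z \<le> c3 * r powr (- \<theta>) * exp (- c4 * (dist x z powr d_w / r) powr \<gamma>)"
        using p_upper[OF r0 K(1,3)] by (simp add: \<gamma>_def)
      also have "\<dots> \<le> c3 * (2 powr \<theta> * t powr (- \<theta>)) * exp (- c4 * N (dist x z))"
      proof (intro mult_mono)
        have "r powr (- \<theta>) \<le> (t / 2) powr (- \<theta>)"
          using r t(1) theta by (intro powr_mono2') auto
        also have "\<dots> = 2 powr \<theta> * t powr (- \<theta>)"
          using t(1) by (simp add: powr_divide powr_minus field_simps)
        finally show "r powr (- \<theta>) \<le> 2 powr \<theta> * t powr (- \<theta>)" .
        have "N (dist x z) \<le> (dist x z powr d_w / r) powr \<gamma>"
          unfolding N_def using r r0 gamma_pos by (intro powr_mono2 divide_left_mono) auto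
        then show "exp (- c4 * (dist x z powr d_w / r) powr \<gamma>) \<le> exp (- c4 * N (dist x z))"
          using c_pos by simp
      qed (use c_pos in auto)
      finally show ?thesis .
    qed
    have up2: "p t y w \<le> c3 * t powr (- \<theta>) * exp (- c4 * N (dist y w))"
      using p_upper[OF t(1) t1 K(2,4)] by (simp add: \<gamma>_def N_def)
    have At: "0 < A * t" using A t(1) by simp
    have low: "c1 * (A powr (- \<theta>) * t powr (- \<theta>)) * exp (- c2 * (A powr (- \<gamma>) * N (dist z w))) \<le> p (A * t) z w"
    proof -
      have "(dist z w powr d_w / (A * t)) powr \<gamma> = A powr (- \<gamma>) * N (dist z w)"
        unfolding N_def using A t(1) by (simp add: powr_divide powr_mult powr_minus field_simps)
      moreover have "(A * t) powr (- \<theta>) = A powr (- \<theta>) * t powr (- \<theta>)"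
        using A t(1) by (simp add: powr_mult)
      ultimately show ?thesis
        using p_lower[OF At t(2) K(3,4)] by (simp add: \<gamma>_def)
    qed
    have expo: "- c4 * N (dist x z) + - c4 * N (dist y w) \<le> c4 * N (dist x y) + - c2 * (A powr (- \<gamma>) * N (dist z w))"
    proof -
      have "c2 * (A powr (- \<gamma>) * N (dist z w)) \<le> c2 * (A powr (- \<gamma>) * (E * (N (dist x z) + N (dist x y) + N (dist y w))))"
        using c_pos tri by (intro mult_left_mono) auto
      also have "\<dots> = (c2 * E * A powr (- \<gamma>)) * (N (dist x z) + N (dist x y) + N (dist y w))"
        by (simp add: mult_ac)
      also have "\<dots> \<le> c4 * (N (dist x z) + N (dist x y) + N (dist y w))"
        using N_nonneg by (intro mult_right_mono A_gamma) (auto intro!: add_nonneg_nonneg)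
      finally show ?thesis by (simp add: algebra_simps)
    qed
    have "p r x z * p t y w \<le> (c3 * (2 powr \<theta> * t powr (- \<theta>)) * exp (- c4 * N (dist x z)))
        * (c3 * t powr (- \<theta>) * exp (- c4 * N (dist y w)))"
      using c_pos p_nonneg[OF t(1) t1 K(2,4)] by (intro mult_mono up1 up2) auto
    also have "\<dots> = c3\<^sup>2 * 2 powr \<theta> * (t powr (- \<theta>))\<^sup>2 * exp (- c4 * N (dist x z) + - c4 * N (dist y w))"
      unfolding exp_add by (simp add: power2_eq_square mult_ac)
    also have "\<dots> \<le> c3\<^sup>2 * 2 powr \<theta> * (t powr (- \<theta>))\<^sup>2 *
        exp (c4 * N (dist x y) + - c2 * (A powr (- \<gamma>) * N (dist z w)))"
      using expo by (intro mult_left_mono) auto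
    also have "\<dots> = C * exp (c4 * N (dist x y)) * t powr (- \<theta>) *
        (c1 * (A powr (- \<theta>) * t powr (- \<theta>)) * exp (- c2 * (A powr (- \<gamma>) * N (dist z w))))"
      unfolding exp_add C_def using c_pos A by (simp add: powr_minus field_simps power2_eq_square)
    also have "\<dots> \<le> C * exp (c4 * N (dist x y)) * t powr (- \<theta>) * p (A * t) z w"
      using C low by (intro mult_left_mono) auto
    finally show ?thesis by (simp add: N_def)
  qed
  then show ?thesis using that A C by blast
qed

text \<open>
  The two averages are means of \<open>u\<close> under the probability densities \<open>p\<^sub>r(x,\<cdot>)\<close> and \<open>p\<^sub>t(y,\<cdot>)\<close>, so the
  square of their difference is at most \<open>\<integral>\<integral> p\<^sub>r(x,z) p\<^sub>t(y,w) (u(z) - u(w))\<^sup>2\<close>.  The product bound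
  turns this into the approximate energy at time \<open>A t\<close>.
\<close>

lemma heat_average_diff:
  obtains A C where "A \<ge> 1" "C > 0"
    "\<And>t r x y n c. 0 < t \<Longrightarrow> A * t < 1 \<Longrightarrow> t / 2 \<le> r \<Longrightarrow> r \<le> t \<Longrightarrow> x \<in> K \<Longrightarrow> y \<in> K \<Longrightarrow>
       (heat r (eig_sum n c) x - heat t (eig_sum n c) y)\<^sup>2
         \<le> C * exp (c4 * (dist x y powr d_w / t) powr \<gamma>) * t powr (1 - \<theta>) * energy n c"
proof -
  obtain A C where A: "A \<ge> 1" and C: "C > 0" and AC:
    "\<And>t r x y z w. 0 < t \<Longrightarrow> A * t < 1 \<Longrightarrow> t / 2 \<le> r \<Longrightarrow> r \<le> t \<Longrightarrow>
       x \<in> K \<Longrightarrow> y \<in> K \<Longrightarrow> z \<in> K \<Longrightarrow> w \<in> K \<Longrightarrow>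
       p r x z * p t y w \<le> C * exp (c4 * (dist x y powr d_w / t) powr \<gamma>) * t powr (- \<theta>) * p (A * t) z w"
    using kernel_product_bound by blast
  have "(heat r (eig_sum n c) x - heat t (eig_sum n c) y)\<^sup>2
         \<le> (2 * A * C) * exp (c4 * (dist x y powr d_w / t) powr \<gamma>) * t powr (1 - \<theta>) * energy n c"
    if t: "0 < t" "A * t < 1" and r: "t / 2 \<le> r" "r \<le> t" and K: "x \<in> K" "y \<in> K" for t r x y n c
  proof -
    define u where "u = eig_sum n c"
    define B where "B = C * exp (c4 * (dist x y powr d_w / t) powr \<gamma>) * t powr (- \<theta>)"
    have u: "continuous_on K u" unfolding u_def by (rule eig_sum_continuous)
    have r0: "0 < r" using r t by simp
    have "t \<le> A * t" using A t(1) by simp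
    then have t1: "t < 1" "r < 1" using t(2) r by auto
    have At: "0 < A * t" using A t by simp
    define J where "J z = (\<integral>w. p t y w * (u z - u w)\<^sup>2 \<partial>\<mu>)" for z
    define I where "I z = (\<integral>w. p (A * t) z w * (u z - u w)\<^sup>2 \<partial>\<mu>)" for z
    have J: "J z = (u z)\<^sup>2 - 2 * u z * heat t u y + heat t (\<lambda>y. (u y)\<^sup>2) y" for z
      unfolding J_def by (rule heat_sq_dev(2)[OF t(1) K(2) u])
    have Jc: "continuous_on K J"
      unfolding J[abs_def] by (intro continuous_intros u)
    have Ic: "continuous_on K I" unfolding I_def by (rule heat_dev_continuous[OF At u])
    have JI: "p r x z * J z \<le> B * I z" if "z \<in> K" for z
    proof -
      have "p r x z * J z = (\<integral>w. p r x z * (p t y w * (u z - u w)\<^sup>2) \<partial>\<mu>)"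
        unfolding J_def by simp
      also have "\<dots> \<le> (\<integral>w. B * (p (A * t) z w * (u z - u w)\<^sup>2) \<partial>\<mu>)"
      proof (rule integral_mono)
        show "integrable \<mu> (\<lambda>w. p r x z * (p t y w * (u z - u w)\<^sup>2))"
          by (intro integrable_mult_right heat_sq_dev(1) t K u)
        show "integrable \<mu> (\<lambda>w. B * (p (A * t) z w * (u z - u w)\<^sup>2))"
          by (intro integrable_mult_right heat_sq_dev(1) At that u)
        fix w assume "w \<in> space \<mu>"
        then have w: "w \<in> K" by (simp add: space_mu)
        have "p r x z * p t y w * (u z - u w)\<^sup>2 \<le> B * p (A * t) z w * (u z - u w)\<^sup>2"
          unfolding B_def by (intro mult_right_mono AC t r K that w) auto
        then show "p r x z * (p t y w * (u z - u w)\<^sup>2) \<le> B * (p (A * t) z w * (u z - u w)\<^sup>2)"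
          by (simp add: mult.assoc)
      qed
      also have "\<dots> = B * I z" unfolding I_def by simp
      finally show ?thesis .
    qed
    define a b where "a = heat r u x" and "b = heat t u y"
    have a2: "a\<^sup>2 \<le> heat r (\<lambda>y. (u y)\<^sup>2) x" and b2: "b\<^sup>2 \<le> heat t (\<lambda>y. (u y)\<^sup>2) y"
    proof -
      have "0 \<le> (\<integral>y. p r x y * (a - u y)\<^sup>2 \<partial>\<mu>)" "0 \<le> (\<integral>w. p t y w * (b - u w)\<^sup>2 \<partial>\<mu>)"
        by (auto intro!: integral_nonneg_AE AE_I2 mult_nonneg_nonneg p_nonneg simp: space_mu r0 t t1 K)
      then show "a\<^sup>2 \<le> heat r (\<lambda>y. (u y)\<^sup>2) x" "b\<^sup>2 \<le> heat t (\<lambda>y. (u y)\<^sup>2) y"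
        unfolding heat_sq_dev(2)[OF r0 K(1) u] heat_sq_dev(2)[OF t(1) K(2) u]
        by (auto simp: a_def b_def power2_eq_square)
    qed
    have "(a - b)\<^sup>2 \<le> heat r (\<lambda>y. (u y)\<^sup>2) x - 2 * a * b + heat t (\<lambda>y. (u y)\<^sup>2) y"
      using a2 b2 by (simp add: power2_diff)
    also have "\<dots> = (\<integral>z. p r x z * J z \<partial>\<mu>)"
    proof -
      have i: "integrable \<mu> (p r x)" "integrable \<mu> (\<lambda>y. p r x y * u y)" "integrable \<mu> (\<lambda>y. p r x y * (u y)\<^sup>2)"
        by (intro continuous_integrable continuous_intros p_section u r0 K)+
      have "(\<integral>z. p r x z * J z \<partial>\<mu>) = (\<integral>z. p r x z * (u z)\<^sup>2 - 2 * b * (p r x z * u z)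
          + heat t (\<lambda>y. (u y)\<^sup>2) y * p r x z \<partial>\<mu>)"
        unfolding J b_def[symmetric] by (simp add: algebra_simps)
      also have "\<dots> = heat r (\<lambda>y. (u y)\<^sup>2) x - 2 * b * a + heat t (\<lambda>y. (u y)\<^sup>2) y"
        using i by (simp add: heat_def[of r] a_def p_total r0 K)
      finally show ?thesis by simp
    qed
    also have "\<dots> \<le> (\<integral>z. B * I z \<partial>\<mu>)"
      by (intro integral_mono continuous_integrable continuous_intros p_section r0 K Jc Ic)
        (auto simp: space_mu intro: JI)
    also have "\<dots> = B * (\<integral>z. I z \<partial>\<mu>)" by simp
    also have "\<dots> \<le> B * (2 * (A * t) * energy n c)"
      unfolding I_def u_def using C
      by (intro mult_left_mono heat_energy_le At) (auto simp: B_def)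
    also have "\<dots> = (2 * A * C) * exp (c4 * (dist x y powr d_w / t) powr \<gamma>) * (t powr (- \<theta>) * t) * energy n c"
      by (simp add: B_def mult_ac)
    also have "t powr (- \<theta>) * t = t powr (1 - \<theta>)"
      using t(1) powr_add[of t "- \<theta>" 1] by (simp add: algebra_simps)
    finally show ?thesis by (simp add: a_def b_def u_def)
  qed
  then show ?thesis using that[of A "2 * A * C"] A C by simp
qed

end

context subgaussian_kernel
begin

text \<open>
  Averages at times \<open>t\<close> and \<open>t / 2\<close> around the same point differ by \<open>O(t\<^bsup>(1 - \<theta>)/2\<^esup>)\<close>; as \<open>\<theta> < 1\<close>, these
  differences sum up over \<open>t, t/2, t/4, \<dots>\<close> and compare \<open>u(x)\<close> with its average at time \<open>t\<close>.  The
  averages around \<open>x\<close> and \<open>y\<close> are compared at \<open>t = d(x,y)\<^bsup>d\<^sub>w\<^esup>\<close>.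
\<close>

theorem resistance_estimate:
  obtains C where "C > 0"
    "\<And>n c x y. x \<in> K \<Longrightarrow> y \<in> K \<Longrightarrow>
      (eig_sum n c x - eig_sum n c y)\<^sup>2 \<le> C * dist x y powr \<kappa> * energy n c"
proof -
  obtain A C where A: "A \<ge> 1" and C: "C > 0" and AC:
    "\<And>t r x y n c. 0 < t \<Longrightarrow> A * t < 1 \<Longrightarrow> t / 2 \<le> r \<Longrightarrow> r \<le> t \<Longrightarrow> x \<in> K \<Longrightarrow> y \<in> K \<Longrightarrow>
       (heat r (eig_sum n c) x - heat t (eig_sum n c) y)\<^sup>2
         \<le> C * exp (c4 * (dist x y powr d_w / t) powr \<gamma>) * t powr (1 - \<theta>) * energy n c"
    using heat_average_diff by blast
  define b where "b = (1/2) powr (1 - \<theta>)"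
  define q where "q = sqrt b"
  have b: "0 < b" "b < 1" using theta by (auto simp: b_def half_powr_less_one)
  have q: "0 < q" "q < 1" using b by (auto simp: q_def)
  have tele: "\<bar>eig_sum n c x - heat t (eig_sum n c) x\<bar> \<le> sqrt (C * t powr (1 - \<theta>) * energy n c) / (1 - q)"
    if t: "0 < t" "A * t < 1" and x: "x \<in> K" for t x n c
  proof -
    define u where "u = eig_sum n c"
    define S where "S = sqrt (C * t powr (1 - \<theta>) * energy n c)"
    have S: "0 \<le> S" using C energy_nonneg by (simp add: S_def)
    define h where "h k = heat (t / 2 ^ k) u x" for k
    have step: "\<bar>h (Suc k) - h k\<bar> \<le> S * q ^ k" for k
    proof (rule power2_le_imp_le)
      have "t / 2 ^ k \<le> t" using t(1) by (simp add: field_simps)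
      then have "A * (t / 2 ^ k) \<le> A * t" using A by (intro mult_left_mono) auto
      then have At: "A * (t / 2 ^ k) < 1" using t(2) by (rule le_less_trans)
      have "(h (Suc k) - h k)\<^sup>2 \<le> C * (t / 2 ^ k) powr (1 - \<theta>) * energy n c"
        using AC[OF _ At, of "t / 2 ^ k / 2" x x n c] t(1) x d_w gamma_pos
        by (simp add: h_def u_def field_simps)
      also have "(t / 2 ^ k) powr (1 - \<theta>) = t powr (1 - \<theta>) * b ^ k"
      proof -
        have "t / 2 ^ k = t * (1/2) ^ k" by (simp add: power_divide)
        then show ?thesis using t(1) by (simp only: powr_mult) (simp add: power_powr b_def)
      qed
      also have "C * (t powr (1 - \<theta>) * b ^ k) * energy n c = (S * q ^ k)\<^sup>2"
      proof -
        have "(q ^ k)\<^sup>2 = b ^ k"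
          using b by (simp add: q_def power_mult[symmetric] mult.commute[of k]) (simp add: power_mult)
        moreover have "S\<^sup>2 = C * t powr (1 - \<theta>) * energy n c"
          unfolding S_def using C energy_nonneg by (subst real_sqrt_pow2) auto
        ultimately show ?thesis by (simp add: power_mult_distrib mult_ac)
      qed
      finally show "\<bar>h (Suc k) - h k\<bar>\<^sup>2 \<le> (S * q ^ k)\<^sup>2" by simp
    qed (use S q in simp)
    have bound: "\<bar>h m - h 0\<bar> \<le> S / (1 - q)" for m
    proof -
      have "\<bar>h m - h 0\<bar> = \<bar>\<Sum>k<m. h (Suc k) - h k\<bar>" by (simp add: sum_lessThan_telescope)
      also have "\<dots> \<le> (\<Sum>k<m. S * q ^ k)" by (rule order_trans[OF sum_abs sum_mono]) (rule step)
      also have "\<dots> = S * ((1 - q ^ m) / (1 - q))" using q by (simp add: sum_distrib_left[symmetric] sum_gp_strict)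
      also have "\<dots> \<le> S * (1 / (1 - q))" using S q by (intro mult_left_mono divide_right_mono) auto
      finally show ?thesis by simp
    qed
    have "h \<longlonglongrightarrow> u x"
    proof -
      have lim: "(\<lambda>k. t / 2 ^ k) \<longlonglongrightarrow> 0" by (rule LIMSEQ_divide_realpow_zero) simp
      have "(\<lambda>k. \<Sum>j<n. exp (- \<nu> j * (t / 2 ^ k)) * c j * \<psi> j x) \<longlonglongrightarrow> (\<Sum>j<n. exp (- \<nu> j * 0) * c j * \<psi> j x)"
        by (intro tendsto_intros lim)
      then show ?thesis
        using t(1) x by (simp add: h_def[abs_def] u_def heat_eig_sum eig_sum_def)
    qed
    then have "(\<lambda>m. \<bar>h m - h 0\<bar>) \<longlonglongrightarrow> \<bar>u x - h 0\<bar>" by (intro tendsto_intros)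
    from LIMSEQ_le_const2[OF this] bound have "\<bar>u x - h 0\<bar> \<le> S / (1 - q)" by blast
    then show ?thesis by (simp add: h_def u_def S_def)
  qed
  obtain R where R: "\<And>x y. x \<in> K \<Longrightarrow> y \<in> K \<Longrightarrow> dist x y \<le> R"
    using compact_imp_bounded[OF compact_K] unfolding bounded_two_points by blast
  define t0 where "t0 = 1 / (2 * A)"
  have t0: "t0 > 0" using A by (simp add: t0_def)
  define M where "M = exp (c4 * (max 1 (R powr d_w / t0)) powr \<gamma>)"
  define L where "L = 2 * sqrt C / (1 - q) + sqrt (C * M)"
  have L: "L > 0" using C q by (simp add: L_def M_def add_pos_pos)
  have "(eig_sum n c x - eig_sum n c y)\<^sup>2 \<le> L\<^sup>2 * dist x y powr \<kappa> * energy n c"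
    if K: "x \<in> K" "y \<in> K" for n c x y
  proof (cases "x = y")
    case True
    then show ?thesis using kappa_pos by simp
  next
    case False
    define d where "d = dist x y"
    have d: "0 < d" "d \<le> R" using False R[OF K] by (auto simp: d_def)
    \<comment> \<open>far apart points are compared at the fixed time \<open>t0\<close>, as the kernel bounds need \<open>A t < 1\<close>\<close>
    define t where "t = min (d powr d_w) t0"
    have t: "0 < t" "t \<le> d powr d_w" using d t0 by (auto simp: t_def)
    have "A * t \<le> A * t0" using A by (intro mult_left_mono) (auto simp: t_def)
    also have "\<dots> < 1" using A by (simp add: t0_def)
    finally have At: "A * t < 1" .
    have ratio: "d powr d_w / t \<le> max 1 (R powr d_w / t0)"
    proof (cases "d powr d_w \<le> t0")
      case True
      then have "t = d powr d_w" by (simp add: t_def)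
      then show ?thesis using d by simp
    next
      case False
      then have "t = t0" by (simp add: t_def)
      moreover have "d powr d_w \<le> R powr d_w" using d d_w by (intro powr_mono2) auto
      ultimately show ?thesis using t0 by (auto simp: divide_right_mono le_max_iff_disj)
    qed
    define u where "u = eig_sum n c"
    define Q where "Q = sqrt (t powr (1 - \<theta>) * energy n c)"
    have "(heat t u x - heat t u y)\<^sup>2 \<le> C * exp (c4 * (d powr d_w / t) powr \<gamma>) * t powr (1 - \<theta>) * energy n c"
      unfolding u_def d_def using t by (intro AC At K) auto
    also have "\<dots> \<le> C * M * t powr (1 - \<theta>) * energy n c"
      unfolding M_def using C c_pos ratio gamma_pos t
      by (intro mult_right_mono mult_left_mono energy_nonneg) (auto intro!: powr_mono2)
    finally have "\<bar>heat t u x - heat t u y\<bar> \<le> sqrt (C * M * t powr (1 - \<theta>) * energy n c)"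
      by (metis real_sqrt_abs real_sqrt_le_iff)
    also have "\<dots> = sqrt (C * M) * Q"
      by (simp add: Q_def real_sqrt_mult[symmetric] mult.assoc)
    finally have mid: "\<bar>heat t u x - heat t u y\<bar> \<le> sqrt (C * M) * Q" .
    have S: "sqrt (C * t powr (1 - \<theta>) * energy n c) = sqrt C * Q"
      by (simp add: Q_def real_sqrt_mult[symmetric] mult.assoc)
    have "\<bar>u x - u y\<bar> \<le> \<bar>u x - heat t u x\<bar> + \<bar>heat t u x - heat t u y\<bar> + \<bar>u y - heat t u y\<bar>" by simp
    also have "\<dots> \<le> sqrt C * Q / (1 - q) + sqrt (C * M) * Q + sqrt C * Q / (1 - q)"
      using tele[OF t(1) At K(1), of n c] tele[OF t(1) At K(2), of n c] mid
      unfolding S u_def by linarith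
    also have "\<dots> = L * Q" by (simp add: L_def algebra_simps add_divide_distrib)
    finally have "\<bar>u x - u y\<bar> \<le> L * Q" .
    then have "\<bar>u x - u y\<bar>\<^sup>2 \<le> (L * Q)\<^sup>2" by (rule power_mono) simp
    also have "\<dots> = L\<^sup>2 * (t powr (1 - \<theta>) * energy n c)"
      using energy_nonneg by (simp add: power_mult_distrib Q_def)
    also have "\<dots> \<le> L\<^sup>2 * ((d powr d_w) powr (1 - \<theta>) * energy n c)"
      using t theta energy_nonneg by (intro mult_left_mono mult_right_mono powr_mono2) auto
    also have "(d powr d_w) powr (1 - \<theta>) = d powr \<kappa>" by (simp add: powr_powr \<kappa>_def)
    finally show ?thesis by (simp add: u_def d_def mult.assoc)
  qed
  then show ?thesis using that[of "L\<^sup>2"] L by auto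
qed

text \<open>
  The function with coefficients \<open>(\<psi>\<^sub>j(x) - \<psi>\<^sub>j(y)) / (lam + \<nu>\<^sub>j)\<close> represents evaluation at \<open>x\<close> minus
  evaluation at \<open>y\<close>: its increment and an upper bound of its energy are both equal to the sum, so the
  resistance estimate bounds the square of the sum by the sum.
\<close>

lemma resolvent_increment_partial:
  obtains C where "C > 0"
    "\<And>lam n x y. lam > 0 \<Longrightarrow> x \<in> K \<Longrightarrow> y \<in> K \<Longrightarrow>
      (\<Sum>j<n. (\<psi> j x - \<psi> j y)\<^sup>2 / (lam + \<nu> j)) \<le> C * dist x y powr \<kappa>"
proof -
  obtain C where C: "C > 0" "\<And>n c x y. x \<in> K \<Longrightarrow> y \<in> K \<Longrightarrow>
      (eig_sum n c x - eig_sum n c y)\<^sup>2 \<le> C * dist x y powr \<kappa> * energy n c"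
    using resistance_estimate by blast
  have "(\<Sum>j<n. (\<psi> j x - \<psi> j y)\<^sup>2 / (lam + \<nu> j)) \<le> C * dist x y powr \<kappa>"
    if lam: "lam > 0" and K: "x \<in> K" "y \<in> K" for lam n x y
  proof -
    define c where "c j = (\<psi> j x - \<psi> j y) / (lam + \<nu> j)" for j
    define Q where "Q = (\<Sum>j<n. (\<psi> j x - \<psi> j y)\<^sup>2 / (lam + \<nu> j))"
    have pos: "lam + \<nu> j > 0" for j using lam nu_nonneg[of j] by simp
    have Q0: "0 \<le> Q" unfolding Q_def using pos by (intro sum_nonneg divide_nonneg_pos) auto
    have diff: "eig_sum n c x - eig_sum n c y = Q"
      by (simp add: eig_sum_def Q_def c_def sum_subtractf[symmetric] diff_divide_distrib
          add_divide_distrib power2_eq_square algebra_simps)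
    have "energy n c \<le> Q"
      unfolding energy_def Q_def
    proof (rule sum_mono)
      fix j
      have "\<nu> j * (c j)\<^sup>2 \<le> (lam + \<nu> j) * (c j)\<^sup>2" using lam by (intro mult_right_mono) auto
      also have "\<dots> = (\<psi> j x - \<psi> j y)\<^sup>2 / (lam + \<nu> j)"
        using pos[of j] by (simp add: c_def power2_eq_square)
      finally show "\<nu> j * (c j)\<^sup>2 \<le> (\<psi> j x - \<psi> j y)\<^sup>2 / (lam + \<nu> j)" .
    qed
    then have "C * dist x y powr \<kappa> * energy n c \<le> C * dist x y powr \<kappa> * Q"
      using C(1) by (intro mult_left_mono) auto
    then have "Q * Q \<le> C * dist x y powr \<kappa> * Q"
      using C(2)[OF K, of n c] by (simp add: diff power2_eq_square)
    then have "Q \<le> C * dist x y powr \<kappa>"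
      using Q0 C(1) by (cases "Q = 0") auto
    then show ?thesis by (simp add: Q_def)
  qed
  then show ?thesis using that C(1) by blast
qed

end

section \<open>Resolvent kernel\<close>

text \<open>
  Expresses a power through exponentials at dyadic times, where the heat kernel bounds apply; the
  right \<open>k\<close> has \<open>2\<^sup>k \<le> 1 + u < 2\<^bsup>k + 1\<^esup>\<close>.  The choice of \<open>k\<close> for each \<open>u\<close> is forgotten
  later, by summing over all \<open>k\<close>.
\<close>

lemma dyadic_exp_bound:
  fixes u \<alpha> :: real
  assumes "0 \<le> u" "0 < \<alpha>"
  shows "\<exists>k. (1 + u) powr (- \<alpha>) \<le> exp 2 * ((1/2) powr \<alpha>) ^ k * exp (- (u / 2 ^ k))"
proof -
  have ex: "\<exists>n. 1 + u < 2 ^ n" by (rule real_arch_pow) simp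
  define n where "n = (LEAST n. 1 + u < 2 ^ n)"
  have n: "1 + u < 2 ^ n" unfolding n_def by (rule LeastI_ex[OF ex])
  have "n \<noteq> 0" using n assms by (intro notI) simp
  then obtain k where k: "n = Suc k" using not0_implies_Suc by blast
  have low: "2 ^ k \<le> 1 + u"
    using not_less_Least[of k "\<lambda>n. 1 + u < 2 ^ n"] k unfolding n_def by (simp add: not_less)
  have "(1 + u) powr (- \<alpha>) \<le> (2 ^ k) powr (- \<alpha>)"
    using low assms by (intro powr_mono2') auto
  also have "\<dots> = ((1/2) powr \<alpha>) ^ k"
    by (simp add: power_powr powr_minus powr_divide power_divide inverse_eq_divide)
  finally have 1: "(1 + u) powr (- \<alpha>) \<le> ((1/2) powr \<alpha>) ^ k" .
  have "u / 2 ^ k \<le> 2" using n unfolding k by (simp add: field_simps)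
  then have "1 \<le> exp 2 * exp (- (u / 2 ^ k))" unfolding exp_add[symmetric] by simp
  then have "((1/2) powr \<alpha>) ^ k * 1 \<le> ((1/2) powr \<alpha>) ^ k * (exp 2 * exp (- (u / 2 ^ k)))"
    by (intro mult_left_mono) auto
  with 1 have "(1 + u) powr (- \<alpha>) \<le> ((1/2) powr \<alpha>) ^ k * (exp 2 * exp (- (u / 2 ^ k)))" by linarith
  then show ?thesis by (intro exI[of _ k]) (simp add: mult_ac)
qed

context subgaussian_kernel
begin

lemma p_diag_partial:
  assumes "0 < t" "t < 1" "x \<in> K"
  shows "(\<Sum>j<n. exp (- \<nu> j * t) * (\<psi> j x)\<^sup>2) \<le> c3 * t powr (- \<theta>)"
proof -
  have s: "(\<lambda>j. exp (- \<nu> j * t) * (\<psi> j x)\<^sup>2) sums p t x x"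
    using p_expansion[of t x x] assms by (simp add: power2_eq_square mult.assoc)
  then have "(\<Sum>j<n. exp (- \<nu> j * t) * (\<psi> j x)\<^sup>2) \<le> p t x x"
    using sum_le_suminf[OF sums_summable[OF s], of "{..<n}"] sums_unique[OF s] by simp
  also have "\<dots> \<le> c3 * t powr (- \<theta>)"
    using p_upper[of t x x] assms d_w by simp
  finally show ?thesis .
qed

text \<open>
  A discrete form of
  \<open>\<Gamma>(\<alpha>) (lam + \<nu>)\<^bsup>-\<alpha>\<^esup> = \<integral> t\<^bsup>\<alpha> - 1\<^esup> e\<^bsup>-(lam + \<nu>) t\<^esup> dt\<close> combined with \<open>p\<^sub>t(x,x) \<le> c3 t\<^bsup>-\<theta>\<^esup>\<close>; the
  exponent \<open>\<alpha> > \<theta>\<close> makes it converge at \<open>t = 0\<close>.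
\<close>

lemma diagonal_power_sum:
  assumes "\<alpha> > \<theta>"
  obtains C where "C > 0" "\<And>lam x n. lam > 1 \<Longrightarrow> x \<in> K \<Longrightarrow>
     (\<Sum>j<n. (lam + \<nu> j) powr (- \<alpha>) * (\<psi> j x)\<^sup>2) \<le> C * lam powr (\<theta> - \<alpha>)"
proof -
  define a where "a = (1/2 :: real) powr \<alpha>"
  define b where "b = (1/2 :: real) powr (\<alpha> - \<theta>)"
  have b: "0 < b" "b < 1" using assms by (auto simp: b_def half_powr_less_one)
  have alpha: "\<alpha> > 0" using assms theta by simp
  define C where "C = exp 2 * c3 / (1 - b)"
  have C: "C > 0" using b c_pos by (simp add: C_def)
  have "(\<Sum>j<n. (lam + \<nu> j) powr (- \<alpha>) * (\<psi> j x)\<^sup>2) \<le> C * lam powr (\<theta> - \<alpha>)"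
    if lam: "lam > 1" and x: "x \<in> K" for lam x n
  proof -
    have "\<exists>k. (1 + \<nu> j / lam) powr (- \<alpha>) \<le> exp 2 * a ^ k * exp (- (\<nu> j / lam / 2 ^ k))" for j
      unfolding a_def using nu_nonneg[of j] lam by (intro dyadic_exp_bound alpha) auto
    then obtain k where k: "\<And>j. (1 + \<nu> j / lam) powr (- \<alpha>) \<le> exp 2 * a ^ k j * exp (- (\<nu> j / lam / 2 ^ k j))"
      by metis
    define N where "N = Suc (\<Sum>j<n. k j)"
    have kN: "k j < N" if "j < n" for j
      unfolding N_def using member_le_sum[of j "{..<n}" k] that by simp
    have termwise: "(lam + \<nu> j) powr (- \<alpha>) * (\<psi> j x)\<^sup>2
       \<le> lam powr (- \<alpha>) * exp 2 * (\<Sum>i<N. a ^ i * (exp (- \<nu> j * (1 / (lam * 2 ^ i))) * (\<psi> j x)\<^sup>2))"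
      if "j < n" for j
    proof -
      have "(lam + \<nu> j) powr (- \<alpha>) = lam powr (- \<alpha>) * (1 + \<nu> j / lam) powr (- \<alpha>)"
      proof -
        have "lam + \<nu> j = lam * (1 + \<nu> j / lam)" using lam by (simp add: distrib_left)
        then show ?thesis using lam nu_nonneg[of j] by (simp only: powr_mult)
      qed
      also have "\<dots> \<le> lam powr (- \<alpha>) * (exp 2 * a ^ k j * exp (- (\<nu> j / lam / 2 ^ k j)))"
        by (intro mult_left_mono k) simp
      finally have "(lam + \<nu> j) powr (- \<alpha>) * (\<psi> j x)\<^sup>2
          \<le> lam powr (- \<alpha>) * (exp 2 * a ^ k j * exp (- (\<nu> j / lam / 2 ^ k j))) * (\<psi> j x)\<^sup>2"
        by (rule mult_right_mono) simp
      also have "\<dots> = lam powr (- \<alpha>) * exp 2 *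
          (a ^ k j * (exp (- \<nu> j * (1 / (lam * 2 ^ k j))) * (\<psi> j x)\<^sup>2))"
        by (simp add: mult_ac)
      also have "\<dots> \<le> lam powr (- \<alpha>) * exp 2 *
          (\<Sum>i<N. a ^ i * (exp (- \<nu> j * (1 / (lam * 2 ^ i))) * (\<psi> j x)\<^sup>2))"
        by (intro mult_left_mono member_le_sum) (auto simp: kN that a_def)
      finally show ?thesis .
    qed
    have "(\<Sum>j<n. (lam + \<nu> j) powr (- \<alpha>) * (\<psi> j x)\<^sup>2)
       \<le> (\<Sum>j<n. lam powr (- \<alpha>) * exp 2 * (\<Sum>i<N. a ^ i * (exp (- \<nu> j * (1 / (lam * 2 ^ i))) * (\<psi> j x)\<^sup>2)))"
      by (intro sum_mono termwise) simp
    also have "\<dots> = lam powr (- \<alpha>) * exp 2 *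
        (\<Sum>i<N. a ^ i * (\<Sum>j<n. exp (- \<nu> j * (1 / (lam * 2 ^ i))) * (\<psi> j x)\<^sup>2))"
      unfolding sum_distrib_left by (rule sum.swap)
    also have "\<dots> \<le> lam powr (- \<alpha>) * exp 2 * (\<Sum>i<N. c3 * lam powr \<theta> * b ^ i)"
    proof (intro mult_left_mono sum_mono)
      fix i
      have "1 \<le> (2::real) ^ i" by simp
      then have l: "1 < lam * 2 ^ i" using lam by (metis less_le_trans mult.right_neutral mult_left_mono order.strict_implies_order less_trans zero_less_one)
      have "a ^ i * (\<Sum>j<n. exp (- \<nu> j * (1 / (lam * 2 ^ i))) * (\<psi> j x)\<^sup>2)
         \<le> a ^ i * (c3 * (1 / (lam * 2 ^ i)) powr (- \<theta>))"
        using l x by (intro mult_left_mono p_diag_partial) (auto simp: a_def)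
      also have "(1 / (lam * 2 ^ i)) powr (- \<theta>) = lam powr \<theta> * (2 powr \<theta>) ^ i"
        using lam by (simp add: powr_divide powr_mult power_powr powr_minus field_simps)
      also have "a ^ i * (c3 * (lam powr \<theta> * (2 powr \<theta>) ^ i)) = c3 * lam powr \<theta> * (a * 2 powr \<theta>) ^ i"
        by (simp add: power_mult_distrib mult_ac)
      also have "a * 2 powr \<theta> = b"
        by (simp add: a_def b_def powr_divide powr_diff)
      finally show "a ^ i * (\<Sum>j<n. exp (- \<nu> j * (1 / (lam * 2 ^ i))) * (\<psi> j x)\<^sup>2) \<le> c3 * lam powr \<theta> * b ^ i" .
    qed simp
    also have "(\<Sum>i<N. c3 * lam powr \<theta> * b ^ i) = c3 * lam powr \<theta> * ((1 - b ^ N) / (1 - b))"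
      using b by (simp add: sum_distrib_left[symmetric] sum_gp_strict)
    also have "lam powr (- \<alpha>) * exp 2 * (c3 * lam powr \<theta> * ((1 - b ^ N) / (1 - b)))
       \<le> lam powr (- \<alpha>) * exp 2 * (c3 * lam powr \<theta> * (1 / (1 - b)))"
      using b c_pos by (intro mult_left_mono divide_right_mono) auto
    also have "\<dots> = C * (lam powr \<theta> * lam powr (- \<alpha>))" by (simp add: C_def mult_ac)
    also have "lam powr \<theta> * lam powr (- \<alpha>) = lam powr (\<theta> - \<alpha>)"
      by (simp add: powr_add[symmetric])
    finally show ?thesis .
  qed
  then show ?thesis using that C by blast
qed

text \<open>
  The kernel of \<open>(lam - \<Delta>)\<^bsup>-1\<^esup>\<close>, defined by its spectral expansion instead of the Laplace transform of
  the heat kernel.  All statements take \<open>lam > 1\<close>, because the kernel bounds hold for times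
  \<open>1 / lam < 1\<close>.
\<close>

definition resolvent :: "real \<Rightarrow> 'a \<Rightarrow> 'a \<Rightarrow> real" where
  "resolvent lam x y = (\<Sum>j. \<psi> j x * \<psi> j y / (lam + \<nu> j))"

lemma resolvent_sym: "resolvent lam x y = resolvent lam y x"
  by (simp add: resolvent_def mult.commute)

lemma diag_partial_le:
  obtains C where "C > 0" "\<And>lam x n. lam > 1 \<Longrightarrow> x \<in> K \<Longrightarrow>
     (\<Sum>j<n. (\<psi> j x)\<^sup>2 / (lam + \<nu> j)) \<le> C * lam powr (\<theta> - 1)"
proof -
  obtain C where C: "C > 0" "\<And>lam x n. lam > 1 \<Longrightarrow> x \<in> K \<Longrightarrow>
     (\<Sum>j<n. (lam + \<nu> j) powr (- 1) * (\<psi> j x)\<^sup>2) \<le> C * lam powr (\<theta> - 1)"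
    using diagonal_power_sum[of 1] theta by blast
  have "(\<Sum>j<n. (lam + \<nu> j) powr (- 1) * (\<psi> j x)\<^sup>2) = (\<Sum>j<n. (\<psi> j x)\<^sup>2 / (lam + \<nu> j))"
    if "lam > 1" for lam x n
  proof (rule sum.cong)
    fix j
    have "lam + \<nu> j > 0" using that nu_nonneg[of j] by simp
    then show "(lam + \<nu> j) powr (- 1) * (\<psi> j x)\<^sup>2 = (\<psi> j x)\<^sup>2 / (lam + \<nu> j)"
      by (simp add: powr_minus field_simps)
  qed simp
  then show ?thesis using that[OF C(1)] C(2) by auto
qed

lemma diag_summable:
  assumes "lam > 1" "x \<in> K"
  shows "summable (\<lambda>j. (\<psi> j x)\<^sup>2 / (lam + \<nu> j))"
proof -
  obtain C where "\<And>n. (\<Sum>j<n. (\<psi> j x)\<^sup>2 / (lam + \<nu> j)) \<le> C * lam powr (\<theta> - 1)"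
    using diag_partial_le assms by metis
  then show ?thesis
    using assms nu_nonneg by (intro summableI_nonneg_bounded) (auto intro!: divide_nonneg_nonneg add_nonneg_nonneg)
qed

lemma abs_resolvent_term_le:
  assumes "lam > 1"
  shows "\<bar>\<psi> j x * \<psi> j y / (lam + \<nu> j)\<bar> \<le> (\<psi> j x)\<^sup>2 / (lam + \<nu> j) + (\<psi> j y)\<^sup>2 / (lam + \<nu> j)"
proof -
  have pos: "lam + \<nu> j > 0" using assms nu_nonneg[of j] by simp
  have "\<bar>\<psi> j x * \<psi> j y\<bar> \<le> (\<psi> j x)\<^sup>2 + (\<psi> j y)\<^sup>2" by (rule abs_mult_le_sum_squares)
  then have "\<bar>\<psi> j x * \<psi> j y\<bar> / (lam + \<nu> j) \<le> ((\<psi> j x)\<^sup>2 + (\<psi> j y)\<^sup>2) / (lam + \<nu> j)"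
    using pos by (intro divide_right_mono) auto
  then show ?thesis using pos by (simp add: add_divide_distrib)
qed

lemma resolvent_summable:
  assumes "lam > 1" "x \<in> K" "y \<in> K"
  shows "summable (\<lambda>j. \<bar>\<psi> j x * \<psi> j y / (lam + \<nu> j)\<bar>)"
  by (rule summable_comparison_test'[OF summable_add[OF diag_summable[OF assms(1,2)] diag_summable[OF assms(1,3)]], of 0])
    (use abs_resolvent_term_le[OF assms(1)] in simp)

lemma resolvent_sums:
  assumes "lam > 1" "x \<in> K" "y \<in> K"
  shows "(\<lambda>j. \<psi> j x * \<psi> j y / (lam + \<nu> j)) sums resolvent lam x y"
  unfolding resolvent_def
  by (rule summable_sums[OF summable_rabs_cancel[OF resolvent_summable[OF assms]]])

lemma resolvent_diag_upper:
  obtains C where "C > 0" "\<And>lam x. lam > 1 \<Longrightarrow> x \<in> K \<Longrightarrow> resolvent lam x x \<le> C * lam powr (\<theta> - 1)"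
proof -
  obtain C where C: "C > 0" "\<And>lam x n. lam > 1 \<Longrightarrow> x \<in> K \<Longrightarrow>
     (\<Sum>j<n. (\<psi> j x)\<^sup>2 / (lam + \<nu> j)) \<le> C * lam powr (\<theta> - 1)"
    using diag_partial_le by blast
  have "resolvent lam x x \<le> C * lam powr (\<theta> - 1)" if "lam > 1" "x \<in> K" for lam x
    using suminf_le_const[OF diag_summable[OF that] C(2)[OF that]]
    by (simp add: resolvent_def power2_eq_square)
  then show ?thesis using that C(1) by blast
qed

text \<open>
  Compares \<open>1 / (lam + \<nu>)\<close> with \<open>e\<^bsup>-\<nu> / lam\<^esup> / lam\<close>, the spectral function of the heat kernel at time
  \<open>1 / lam\<close>.
\<close>

lemma resolvent_diag_lower:
  assumes "lam > 1" "x \<in> K"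
  shows "c1 * lam powr (\<theta> - 1) \<le> resolvent lam x x"
proof -
  have l: "0 < 1 / lam" "1 / lam < 1" using assms by auto
  have "c1 * lam powr \<theta> \<le> p (1 / lam) x x"
    using p_lower[OF l assms(2) assms(2)] d_w assms(1) by (simp add: powr_divide powr_minus)
  have s: "(\<lambda>j. exp (- \<nu> j * (1 / lam)) * \<psi> j x * \<psi> j x * (1 / lam)) sums (p (1 / lam) x x * (1 / lam))"
    by (intro sums_mult2 p_expansion l assms)
  have "p (1 / lam) x x * (1 / lam) \<le> resolvent lam x x"
  proof (rule sums_le[OF _ s resolvent_sums[OF assms assms(2)]])
    fix j
    have "1 + \<nu> j / lam \<le> exp (\<nu> j / lam)" by (rule exp_ge_add_one_self)
    then have "lam + \<nu> j \<le> exp (\<nu> j / lam) * lam"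
      using assms(1) by (simp add: field_simps)
    then have "exp (- (\<nu> j / lam)) * (1 / lam) \<le> 1 / (lam + \<nu> j)"
      using assms(1) nu_nonneg[of j] by (simp add: exp_minus field_simps)
    then have "(\<psi> j x * \<psi> j x) * (exp (- (\<nu> j / lam)) * (1 / lam)) \<le> (\<psi> j x * \<psi> j x) * (1 / (lam + \<nu> j))"
      by (rule mult_left_mono) simp
    then show "exp (- \<nu> j * (1 / lam)) * \<psi> j x * \<psi> j x * (1 / lam) \<le> \<psi> j x * \<psi> j x / (lam + \<nu> j)"
      by (simp add: mult_ac)
  qed
  moreover have "c1 * lam powr (\<theta> - 1) = c1 * lam powr \<theta> * (1 / lam)"
    using assms(1) by (simp add: powr_diff)
  moreover have "c1 * lam powr \<theta> * (1 / lam) \<le> p (1 / lam) x x * (1 / lam)"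
    using \<open>c1 * lam powr \<theta> \<le> p (1 / lam) x x\<close> assms(1) by (intro mult_right_mono) auto
  ultimately show ?thesis by simp
qed

lemma resolvent_diag_pos: "lam > 1 \<Longrightarrow> x \<in> K \<Longrightarrow> resolvent lam x x > 0"
  by (rule less_le_trans[OF _ resolvent_diag_lower]) (use c_pos in auto)

lemma resolvent_increment:
  obtains C where "C > 0"
    "\<And>lam x y z. lam > 1 \<Longrightarrow> x \<in> K \<Longrightarrow> y \<in> K \<Longrightarrow> z \<in> K \<Longrightarrow>
      (resolvent lam x y - resolvent lam x z)\<^sup>2 \<le> resolvent lam x x * (C * dist y z powr \<kappa>)"
    "\<And>lam y z. lam > 1 \<Longrightarrow> y \<in> K \<Longrightarrow> z \<in> K \<Longrightarrow>
      resolvent lam y y - 2 * resolvent lam y z + resolvent lam z z \<le> C * dist y z powr \<kappa>"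
proof -
  obtain C where C: "C > 0" "\<And>lam n x y. lam > 0 \<Longrightarrow> x \<in> K \<Longrightarrow> y \<in> K \<Longrightarrow>
      (\<Sum>j<n. (\<psi> j x - \<psi> j y)\<^sup>2 / (lam + \<nu> j)) \<le> C * dist x y powr \<kappa>"
    using resolvent_increment_partial by blast
  have "(resolvent lam x y - resolvent lam x z)\<^sup>2 \<le> resolvent lam x x * (C * dist y z powr \<kappa>)"
    if lam: "lam > 1" and K: "x \<in> K" "y \<in> K" "z \<in> K" for lam x y z
  proof -
    have pos: "lam + \<nu> j > 0" for j using lam nu_nonneg[of j] by simp
    define S where "S n = (\<Sum>j<n. \<psi> j x * \<psi> j y / (lam + \<nu> j) - \<psi> j x * \<psi> j z / (lam + \<nu> j))" for n
    have "S \<longlonglongrightarrow> resolvent lam x y - resolvent lam x z"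
      using sums_diff[OF resolvent_sums[OF lam K(1,2)] resolvent_sums[OF lam K(1,3)]]
      by (simp add: sums_def S_def[abs_def])
    then have lim: "(\<lambda>n. (S n)\<^sup>2) \<longlonglongrightarrow> (resolvent lam x y - resolvent lam x z)\<^sup>2" by (intro tendsto_intros)
    have "(S n)\<^sup>2 \<le> resolvent lam x x * (C * dist y z powr \<kappa>)" for n
    proof -
      have "S n = (\<Sum>j<n. (\<psi> j x / sqrt (lam + \<nu> j)) * ((\<psi> j y - \<psi> j z) / sqrt (lam + \<nu> j)))"
        unfolding S_def
      proof (rule sum.cong)
        fix j
        have "sqrt (lam + \<nu> j) * sqrt (lam + \<nu> j) = lam + \<nu> j" using pos[of j] by simp
        then show "\<psi> j x * \<psi> j y / (lam + \<nu> j) - \<psi> j x * \<psi> j z / (lam + \<nu> j)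
            = (\<psi> j x / sqrt (lam + \<nu> j)) * ((\<psi> j y - \<psi> j z) / sqrt (lam + \<nu> j))"
          by (simp add: algebra_simps diff_divide_distrib)
      qed simp
      then have "(S n)\<^sup>2 \<le> (\<Sum>j<n. (\<psi> j x / sqrt (lam + \<nu> j))\<^sup>2) * (\<Sum>j<n. ((\<psi> j y - \<psi> j z) / sqrt (lam + \<nu> j))\<^sup>2)"
        using Cauchy_Schwarz_ineq_sum[of "\<lambda>j. \<psi> j x / sqrt (lam + \<nu> j)" "\<lambda>j. (\<psi> j y - \<psi> j z) / sqrt (lam + \<nu> j)" "{..<n}"]
        by simp
      also have "(\<Sum>j<n. (\<psi> j x / sqrt (lam + \<nu> j))\<^sup>2) = (\<Sum>j<n. (\<psi> j x)\<^sup>2 / (lam + \<nu> j))"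
        using pos by (simp add: power_divide less_imp_le)
      also have "(\<Sum>j<n. ((\<psi> j y - \<psi> j z) / sqrt (lam + \<nu> j))\<^sup>2) = (\<Sum>j<n. (\<psi> j y - \<psi> j z)\<^sup>2 / (lam + \<nu> j))"
        using pos by (simp add: power_divide less_imp_le)
      also have "(\<Sum>j<n. (\<psi> j x)\<^sup>2 / (lam + \<nu> j)) * (\<Sum>j<n. (\<psi> j y - \<psi> j z)\<^sup>2 / (lam + \<nu> j))
          \<le> resolvent lam x x * (C * dist y z powr \<kappa>)"
      proof (intro mult_mono C(2) K)
        show "(\<Sum>j<n. (\<psi> j x)\<^sup>2 / (lam + \<nu> j)) \<le> resolvent lam x x"
          unfolding resolvent_def power2_eq_square[symmetric]
          by (rule sum_le_suminf[OF diag_summable[OF lam K(1)]]) (auto intro!: divide_nonneg_pos pos)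
        show "0 \<le> resolvent lam x x" using resolvent_diag_pos[OF lam K(1)] by simp
        show "0 \<le> (\<Sum>j<n. (\<psi> j y - \<psi> j z)\<^sup>2 / (lam + \<nu> j))" by (intro sum_nonneg divide_nonneg_pos pos) auto
      qed (use lam in auto)
      finally show ?thesis .
    qed
    with LIMSEQ_le_const2[OF lim] show ?thesis by blast
  qed
  moreover have "resolvent lam y y - 2 * resolvent lam y z + resolvent lam z z \<le> C * dist y z powr \<kappa>"
    if lam: "lam > 1" and K: "y \<in> K" "z \<in> K" for lam y z
  proof -
    have pos: "lam + \<nu> j > 0" for j using lam nu_nonneg[of j] by simp
    have "(\<lambda>j. \<psi> j y * \<psi> j y / (lam + \<nu> j) - 2 * (\<psi> j y * \<psi> j z / (lam + \<nu> j)) + \<psi> j z * \<psi> j z / (lam + \<nu> j))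
       sums (resolvent lam y y - 2 * resolvent lam y z + resolvent lam z z)"
      by (intro sums_add sums_diff sums_mult resolvent_sums lam K)
    moreover have "\<psi> j y * \<psi> j y / (lam + \<nu> j) - 2 * (\<psi> j y * \<psi> j z / (lam + \<nu> j)) + \<psi> j z * \<psi> j z / (lam + \<nu> j)
       = (\<psi> j y - \<psi> j z)\<^sup>2 / (lam + \<nu> j)" for j
      by (simp add: power2_eq_square algebra_simps add_divide_distrib diff_divide_distrib)
    ultimately have "(\<lambda>j. (\<psi> j y - \<psi> j z)\<^sup>2 / (lam + \<nu> j)) sums (resolvent lam y y - 2 * resolvent lam y z + resolvent lam z z)"
      by simp
    then have "(\<lambda>n. \<Sum>j<n. (\<psi> j y - \<psi> j z)\<^sup>2 / (lam + \<nu> j)) \<longlonglongrightarrow> (resolvent lam y y - 2 * resolvent lam y z + resolvent lam z z)"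
      by (simp add: sums_def)
    from LIMSEQ_le_const2[OF this] show ?thesis using C(2)[of lam y z] lam K by auto
  qed
  ultimately show ?thesis using that[OF C(1)] by blast
qed

lemma resolvent_continuous:
  assumes lam: "lam > 1" and x: "x \<in> K"
  shows "continuous_on K (resolvent lam x)"
proof -
  obtain C where C: "C > 0" "\<And>lam x y z. lam > 1 \<Longrightarrow> x \<in> K \<Longrightarrow> y \<in> K \<Longrightarrow> z \<in> K \<Longrightarrow>
      (resolvent lam x y - resolvent lam x z)\<^sup>2 \<le> resolvent lam x x * (C * dist y z powr \<kappa>)"
    by (rule resolvent_increment, rule that)
  show ?thesis
    unfolding continuous_on_def
  proof
    fix y assume y: "y \<in> K"
    have "((\<lambda>z. resolvent lam x z - resolvent lam x y) \<longlongrightarrow> 0) (at y within K)"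
    proof (rule Lim_null_comparison)
      show "\<forall>\<^sub>F z in at y within K. norm (resolvent lam x z - resolvent lam x y)
          \<le> sqrt (resolvent lam x x * (C * dist z y powr \<kappa>))"
      proof (unfold eventually_at_filter, intro always_eventually allI impI)
        fix z assume "z \<in> K"
        then have "(resolvent lam x z - resolvent lam x y)\<^sup>2 \<le> resolvent lam x x * (C * dist z y powr \<kappa>)"
          by (intro C(2) lam x y)
        then show "norm (resolvent lam x z - resolvent lam x y) \<le> sqrt (resolvent lam x x * (C * dist z y powr \<kappa>))"
          by (metis real_norm_def real_sqrt_abs real_sqrt_le_iff)
      qed
      have "((\<lambda>z. dist z y) \<longlongrightarrow> dist y y) (at y within K)" by (intro tendsto_intros)
      then have "((\<lambda>z. dist z y powr \<kappa>) \<longlongrightarrow> 0 powr \<kappa>) (at y within K)"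
        using kappa_pos by (intro tendsto_powr') auto
      then have "((\<lambda>z. sqrt (resolvent lam x x * (C * dist z y powr \<kappa>))) \<longlongrightarrow> sqrt (resolvent lam x x * (C * 0 powr \<kappa>))) (at y within K)"
        by (intro tendsto_real_sqrt tendsto_mult tendsto_const)
      then show "((\<lambda>z. sqrt (resolvent lam x x * (C * dist z y powr \<kappa>))) \<longlongrightarrow> 0) (at y within K)" by simp
    qed
    then show "(resolvent lam x \<longlongrightarrow> resolvent lam x y) (at y within K)" by (rule LIM_zero_cancel)
  qed
qed

text \<open>
  The expansion converges pointwise, dominated by a constant that does not depend on the second
  variable.
\<close>

lemma resolvent_coeff:
  assumes lam: "lam > 1" and x: "x \<in> K"
  shows "L2_inner \<mu> (resolvent lam x) (\<psi> j) = \<psi> j x / (lam + \<nu> j)"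
proof -
  obtain C where C: "C > 0" "\<And>lam x n. lam > 1 \<Longrightarrow> x \<in> K \<Longrightarrow>
     (\<Sum>j<n. (\<psi> j x)\<^sup>2 / (lam + \<nu> j)) \<le> C * lam powr (\<theta> - 1)"
    using diag_partial_le by blast
  define B where "B = 2 * (C * lam powr (\<theta> - 1))"
  define S where "S n = eig_sum n (\<lambda>i. \<psi> i x / (lam + \<nu> i))" for n
  have Sc: "continuous_on K (S n)" for n unfolding S_def by (rule eig_sum_continuous)
  have "(\<lambda>n. \<integral>y. S n y * \<psi> j y \<partial>\<mu>) \<longlonglongrightarrow> (\<integral>y. resolvent lam x y * \<psi> j y \<partial>\<mu>)"
  proof (rule integral_dominated_convergence[where w = "\<lambda>y. B * \<bar>\<psi> j y\<bar>"])
    show "integrable \<mu> (\<lambda>y. B * \<bar>\<psi> j y\<bar>)"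
      by (intro continuous_integrable continuous_intros psi_continuous)
    show "(\<lambda>y. resolvent lam x y * \<psi> j y) \<in> borel_measurable \<mu>"
      by (intro continuous_measurable continuous_intros psi_continuous resolvent_continuous assms)
    show "(\<lambda>y. S n y * \<psi> j y) \<in> borel_measurable \<mu>" for n
      by (intro continuous_measurable continuous_intros psi_continuous Sc)
    show "AE y in \<mu>. (\<lambda>n. S n y * \<psi> j y) \<longlonglongrightarrow> resolvent lam x y * \<psi> j y"
    proof (rule AE_I2)
      fix y assume "y \<in> space \<mu>"
      then have y: "y \<in> K" by (simp add: space_mu)
      have "(\<lambda>n. S n y) \<longlonglongrightarrow> resolvent lam x y"
        using resolvent_sums[OF lam x y] by (simp add: sums_def S_def eig_sum_def mult.commute)
      then show "(\<lambda>n. S n y * \<psi> j y) \<longlonglongrightarrow> resolvent lam x y * \<psi> j y" by (intro tendsto_intros)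
    qed
    show "AE y in \<mu>. norm (S n y * \<psi> j y) \<le> B * \<bar>\<psi> j y\<bar>" for n
    proof (rule AE_I2)
      fix y assume "y \<in> space \<mu>"
      then have y: "y \<in> K" by (simp add: space_mu)
      have "\<bar>S n y\<bar> \<le> (\<Sum>i<n. \<bar>\<psi> i x * \<psi> i y / (lam + \<nu> i)\<bar>)"
        using sum_abs[of "\<lambda>i. \<psi> i x * \<psi> i y / (lam + \<nu> i)" "{..<n}"]
        unfolding S_def eig_sum_def by simp
      also have "\<dots> \<le> (\<Sum>i<n. (\<psi> i x)\<^sup>2 / (lam + \<nu> i) + (\<psi> i y)\<^sup>2 / (lam + \<nu> i))"
        by (intro sum_mono abs_resolvent_term_le lam)
      also have "\<dots> \<le> B"
        using C(2)[OF lam x, of n] C(2)[OF lam y, of n] by (simp add: sum.distrib B_def)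
      finally show "norm (S n y * \<psi> j y) \<le> B * \<bar>\<psi> j y\<bar>"
        by (simp add: abs_mult mult_right_mono)
    qed
  qed
  then have "(\<lambda>n. L2_inner \<mu> (S n) (\<psi> j)) \<longlonglongrightarrow> L2_inner \<mu> (resolvent lam x) (\<psi> j)"
    by (simp add: L2_inner_def)
  moreover have "(\<lambda>n. L2_inner \<mu> (S n) (\<psi> j)) \<longlonglongrightarrow> \<psi> j x / (lam + \<nu> j)"
  proof (rule tendsto_eventually)
    show "\<forall>\<^sub>F n in sequentially. L2_inner \<mu> (S n) (\<psi> j) = \<psi> j x / (lam + \<nu> j)"
      using eventually_gt_at_top[of j] by eventually_elim (simp add: S_def eig_sum_coeff)
  qed
  ultimately show ?thesis using LIMSEQ_unique by blast
qed

lemma resolvent_L2: "lam > 1 \<Longrightarrow> x \<in> K \<Longrightarrow> resolvent lam x \<in> L2 \<mu>"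
  by (intro continuous_L2 resolvent_continuous)

end

section \<open>Maximum principle for the resolvent kernel\<close>

lemma (in L2_basis) summable_abs_coeff_mult:
  assumes "f \<in> L2 \<mu>" "g \<in> L2 \<mu>"
  shows "summable (\<lambda>j. \<bar>L2_inner \<mu> f (e j) * L2_inner \<mu> g (e j)\<bar>)"
proof (rule summable_comparison_test')
  show "summable (\<lambda>j. (L2_inner \<mu> f (e j))\<^sup>2 + (L2_inner \<mu> g (e j))\<^sup>2)"
    using Parseval_norm[OF assms(1)] Parseval_norm[OF assms(2)] by (intro summable_add) (auto dest: sums_summable)
  fix j
  show "norm \<bar>L2_inner \<mu> f (e j) * L2_inner \<mu> g (e j)\<bar> \<le> (L2_inner \<mu> f (e j))\<^sup>2 + (L2_inner \<mu> g (e j))\<^sup>2"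
    using abs_mult_le_sum_squares[of "L2_inner \<mu> f (e j)" "L2_inner \<mu> g (e j)"] by simp
qed

context subgaussian_kernel
begin

text \<open>
  The measures \<open>p\<^sub>t(x,y) d\<mu>(y)\<close> have mass \<open>1\<close>, and by the upper bound they concentrate at \<open>x\<close>.
\<close>

lemma heat_tendsto_initial:
  assumes g: "continuous_on K g" and x: "x \<in> K"
  shows "((\<lambda>t. heat t g x) \<longlongrightarrow> g x) (at_right 0)"
proof (rule tendstoI)
  fix \<epsilon> :: real assume "\<epsilon> > 0"
  define \<eta> where "\<eta> = \<epsilon> / 2"
  have eta: "\<eta> > 0" using \<open>\<epsilon> > 0\<close> by (simp add: \<eta>_def)
  obtain B where B: "B > 0" "\<And>y. y \<in> K \<Longrightarrow> \<bar>g y\<bar> \<le> B" using continuous_bounded[OF g] by blast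
  obtain \<delta> where d: "\<delta> > 0" "\<And>y. y \<in> K \<Longrightarrow> dist y x < \<delta> \<Longrightarrow> dist (g y) (g x) < \<eta>"
    using g x eta unfolding continuous_on_iff by metis
  define m where "m = measure \<mu> (space \<mu>)"
  define \<tau> where "\<tau> t = t powr (- \<theta>) * exp (- (c4 * ((\<delta> powr d_w) / t) powr \<gamma>))" for t
  have tau: "(\<tau> \<longlongrightarrow> 0) (at_right 0)"
  proof -
    have "\<delta> powr d_w > 0" using d by simp
    then show ?thesis
      unfolding \<tau>_def using theta gamma_pos c_pos by real_asymp
  qed
  have bound: "\<bar>heat t g x - g x\<bar> \<le> \<eta> + 2 * B * c3 * m * \<tau> t" if t: "0 < t" "t < 1" for t
  proof -
    have i: "integrable \<mu> (p t x)" "integrable \<mu> (\<lambda>y. p t x y * g y)" "integrable \<mu> (\<lambda>y. p t x y * (g y - g x))"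
      by (intro continuous_integrable continuous_intros p_section t x g)+
    have "heat t g x - g x = (\<integral>y. p t x y * g y - g x * p t x y \<partial>\<mu>)"
      using i by (simp add: heat_def p_total t x)
    also have "\<dots> = (\<integral>y. p t x y * (g y - g x) \<partial>\<mu>)" by (simp add: algebra_simps)
    finally have "\<bar>heat t g x - g x\<bar> \<le> (\<integral>y. \<bar>p t x y * (g y - g x)\<bar> \<partial>\<mu>)" by simp
    also have "\<dots> \<le> (\<integral>y. \<eta> * p t x y + 2 * B * c3 * \<tau> t \<partial>\<mu>)"
    proof (rule integral_mono)
      show "integrable \<mu> (\<lambda>y. \<bar>p t x y * (g y - g x)\<bar>)" using i by simp
      show "integrable \<mu> (\<lambda>y. \<eta> * p t x y + 2 * B * c3 * \<tau> t)" using i by simp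
      fix y assume "y \<in> space \<mu>"
      then have y: "y \<in> K" by (simp add: space_mu)
      have p0: "0 \<le> p t x y" by (rule p_nonneg[OF t x y])
      have tau0: "0 \<le> 2 * B * c3 * \<tau> t" using B c_pos by (simp add: \<tau>_def)
      show "\<bar>p t x y * (g y - g x)\<bar> \<le> \<eta> * p t x y + 2 * B * c3 * \<tau> t"
      proof (cases "dist y x < \<delta>")
        case True
        then have "\<bar>g y - g x\<bar> \<le> \<eta>" using d(2)[OF y] by (simp add: dist_real_def)
        then have "p t x y * \<bar>g y - g x\<bar> \<le> p t x y * \<eta>" using p0 by (rule mult_left_mono)
        moreover have "\<bar>p t x y * (g y - g x)\<bar> = p t x y * \<bar>g y - g x\<bar>"
          using p0 by (simp add: abs_mult)
        ultimately show ?thesis using tau0 mult.commute[of "p t x y" \<eta>] by linarith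
      next
        case False
        have "\<bar>g y - g x\<bar> \<le> 2 * B" using B(2)[OF x] B(2)[OF y] by linarith
        moreover have "p t x y \<le> c3 * \<tau> t"
        proof -
          have "(\<delta> powr d_w / t) powr \<gamma> \<le> (dist x y powr d_w / t) powr \<gamma>"
            using False d(1) t d_w gamma_pos
            by (intro powr_mono2 divide_right_mono) (auto simp: dist_commute)
          then have "exp (- c4 * (dist x y powr d_w / t) powr \<gamma>) \<le> exp (- (c4 * ((\<delta> powr d_w) / t) powr \<gamma>))"
            using c_pos by simp
          then have "c3 * t powr (- \<theta>) * exp (- c4 * (dist x y powr d_w / t) powr \<gamma>) \<le> c3 * \<tau> t"
            unfolding \<tau>_def using c_pos by (simp add: mult.assoc mult_left_mono)
          then show ?thesis using p_upper[OF t x y] by (simp add: \<gamma>_def)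
        qed
        ultimately have "p t x y * \<bar>g y - g x\<bar> \<le> (c3 * \<tau> t) * (2 * B)"
          using p0 by (intro mult_mono) auto
        moreover have "0 \<le> \<eta> * p t x y" using p0 eta by simp
        ultimately show ?thesis using p0 by (simp add: abs_mult mult_ac)
      qed
    qed
    also have "\<dots> = \<eta> + 2 * B * c3 * m * \<tau> t"
      using i by (simp add: p_total t x m_def mult_ac)
    finally show ?thesis .
  qed
  have "((\<lambda>t. \<eta> + 2 * B * c3 * m * \<tau> t) \<longlongrightarrow> \<eta> + 2 * B * c3 * m * 0) (at_right 0)"
    by (intro tendsto_add tendsto_mult tendsto_const tau)
  then have "\<forall>\<^sub>F t in at_right 0. \<eta> + 2 * B * c3 * m * \<tau> t < \<epsilon>"
    by (rule order_tendstoD(2)) (use \<open>\<epsilon> > 0\<close> in \<open>simp add: \<eta>_def\<close>)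
  moreover have "\<forall>\<^sub>F t in at_right (0::real). t < 1"
    by (rule eventually_at_right_real[THEN eventually_mono, of 0 1]) auto
  moreover have "\<forall>\<^sub>F t in at_right (0::real). 0 < t" by (rule eventually_at_right_less)
  ultimately show "\<forall>\<^sub>F t in at_right 0. dist (heat t g x) (g x) < \<epsilon>"
    by eventually_elim (use bound in \<open>force simp: dist_real_def\<close>)
qed

text \<open>
  This says \<open>\<langle>(lam - \<Delta>) R\<^sub>x, g\<rangle> = g(x)\<close> for every continuous \<open>g\<close>, with the generator replaced by difference
  quotients of \<open>e\<^bsup>-lam t\<^esup> P\<^sub>t\<close>, so that \<open>g\<close> need not lie in the form domain.  The numerator is
  \<open>\<integral>\<^sub>0\<^sup>t e\<^bsup>-lam r\<^esup> P\<^sub>r g(x) dr\<close>, obtained by integrating the spectral expansion term by term.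
\<close>

lemma resolvent_defect_tendsto:
  assumes lam: "lam > 1" and x: "x \<in> K" and g: "continuous_on K g"
  shows "((\<lambda>t. (L2_inner \<mu> (resolvent lam x) g - exp (- lam * t) * L2_inner \<mu> (heat t (resolvent lam x)) g) / t)
     \<longlongrightarrow> g x) (at_right 0)"
proof -
  define G where "G t = L2_inner \<mu> (resolvent lam x) g - exp (- lam * t) * L2_inner \<mu> (heat t (resolvent lam x)) g" for t
  define b where "b j = \<psi> j x * L2_inner \<mu> g (\<psi> j)" for j
  define m where "m j = lam + \<nu> j" for j
  have m: "m j > 1" for j using lam nu_nonneg[of j] by (simp add: m_def)
  have gL: "g \<in> L2 \<mu>" by (rule continuous_L2[OF g])
  have rL: "resolvent lam x \<in> L2 \<mu>" by (rule resolvent_L2[OF lam x])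
  define H where "H t = exp (- lam * t) * heat t g x" for t
  have exp_m: "exp (- (m j * t)) = exp (- lam * t) * exp (- \<nu> j * t)" for j t
    unfolding exp_add[symmetric] m_def by (simp add: algebra_simps)
  have H_sums: "(\<lambda>j. exp (- (m j * t)) * b j) sums H t" if "t > 0" for t
  proof -
    have "(\<lambda>j. exp (- lam * t) * (exp (- \<nu> j * t) * \<psi> j x * L2_inner \<mu> g (\<psi> j))) sums H t"
      unfolding H_def by (intro sums_mult heat_sums that x gL)
    moreover have "exp (- lam * t) * (exp (- \<nu> j * t) * \<psi> j x * L2_inner \<mu> g (\<psi> j)) = exp (- (m j * t)) * b j" for j
      by (simp add: exp_m b_def)
    ultimately show ?thesis by simp
  qed
  have H_abs: "summable (\<lambda>j. \<bar>exp (- (m j * t)) * b j\<bar>)" if "t > 0" for t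
  proof -
    have "summable (\<lambda>j. exp (- lam * t) * \<bar>L2_inner \<mu> (p t x) (\<psi> j) * L2_inner \<mu> g (\<psi> j)\<bar>)"
      by (intro summable_mult summable_abs_coeff_mult continuous_L2 p_section that x g)
    moreover have "exp (- lam * t) * \<bar>L2_inner \<mu> (p t x) (\<psi> j) * L2_inner \<mu> g (\<psi> j)\<bar> = \<bar>exp (- (m j * t)) * b j\<bar>" for j
      using that x by (simp add: p_coeff exp_m b_def abs_mult)
    ultimately show ?thesis by (simp only:)
  qed
  have b_abs: "summable (\<lambda>j. \<bar>b j\<bar> / m j)"
  proof -
    have "summable (\<lambda>j. \<bar>L2_inner \<mu> (resolvent lam x) (\<psi> j) * L2_inner \<mu> g (\<psi> j)\<bar>)"
      by (intro summable_abs_coeff_mult rL gL)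
    moreover have "\<bar>L2_inner \<mu> (resolvent lam x) (\<psi> j) * L2_inner \<mu> g (\<psi> j)\<bar> = \<bar>b j\<bar> / m j" for j
      using m[of j] by (simp add: resolvent_coeff lam x b_def m_def abs_mult)
    ultimately show ?thesis by simp
  qed
  have G_sums: "(\<lambda>j. (1 - exp (- (m j * t))) / m j * b j) sums G t" if "t > 0" for t
  proof -
    have hL: "heat t (resolvent lam x) \<in> L2 \<mu>" by (intro continuous_L2 heat_continuous that rL)
    have "(\<lambda>j. L2_inner \<mu> (resolvent lam x) (\<psi> j) * L2_inner \<mu> g (\<psi> j)
       - exp (- lam * t) * (L2_inner \<mu> (heat t (resolvent lam x)) (\<psi> j) * L2_inner \<mu> g (\<psi> j))) sums G t"
      unfolding G_def by (intro sums_diff sums_mult Parseval rL gL hL)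
    moreover have "L2_inner \<mu> (resolvent lam x) (\<psi> j) * L2_inner \<mu> g (\<psi> j)
       - exp (- lam * t) * (L2_inner \<mu> (heat t (resolvent lam x)) (\<psi> j) * L2_inner \<mu> g (\<psi> j))
       = (1 - exp (- (m j * t))) / m j * b j" for j
    proof -
      have "L2_inner \<mu> (heat t (resolvent lam x)) (\<psi> j) = exp (- \<nu> j * t) * (\<psi> j x / m j)"
        using heat_coeff[OF that rL, of j] by (simp add: heat_def[abs_def] resolvent_coeff lam x m_def)
      moreover note exp_m[of j t]
      ultimately show ?thesis
        using m[of j] by (simp add: resolvent_coeff lam x b_def m_def[symmetric] field_simps)
    qed
    ultimately show ?thesis by simp
  qed
  have key: "\<bar>G t - t * g x\<bar> \<le> \<epsilon> * t" if t: "t > 0" and eps: "\<And>r. 0 < r \<Longrightarrow> r \<le> t \<Longrightarrow> \<bar>H r - g x\<bar> \<le> \<epsilon>" for t \<epsilon>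
  proof -
    define f where "f j r = exp (- (m j * r)) * b j * indicator {0..t} r" for j and r :: real
    have bint: "has_bochner_integral lborel (\<lambda>r. exp (- (m j * r)) * indicator {0..t} r) ((1 - exp (- (m j * t))) / m j)" for j
    proof -
      have "has_bochner_integral lborel (\<lambda>r. exp (- (m j * r)) * indicator {0..t} r)
         ((- exp (- (m j * t)) / m j) - (- exp (- (m j * 0)) / m j))"
        by (rule has_bochner_integral_FTC_Icc_real)
          (use t m[of j] in \<open>auto intro!: derivative_eq_intros continuous_intros\<close>)
      then show ?thesis using m[of j] by (simp add: diff_divide_distrib)
    qed
    have fi: "has_bochner_integral lborel (f j) ((1 - exp (- (m j * t))) / m j * b j)" for j
      using has_bochner_integral_mult_right[OF bint[of j], of "b j"]
      unfolding f_def by (simp add: mult_ac)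
    have fni: "(\<integral>r. norm (f j r) \<partial>lborel) = (1 - exp (- (m j * t))) / m j * \<bar>b j\<bar>" for j
    proof -
      have "has_bochner_integral lborel (\<lambda>r. \<bar>b j\<bar> * (exp (- (m j * r)) * indicator {0..t} r))
          (\<bar>b j\<bar> * ((1 - exp (- (m j * t))) / m j))"
        by (intro has_bochner_integral_mult_right bint)
      moreover have "\<bar>b j\<bar> * (exp (- (m j * r)) * indicator {0..t} r) = norm (f j r)" for r
        by (simp add: f_def abs_mult split: split_indicator)
      ultimately show ?thesis by (simp add: has_bochner_integral_integral_eq mult.commute)
    qed
    have ae_pos: "AE r in lborel. (r :: real) \<noteq> 0" by (rule AE_lborel_singleton)
    have f_ae: "AE r in lborel. summable (\<lambda>j. norm (f j r))"
      using ae_pos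
    proof eventually_elim
      case (elim r)
      show ?case
      proof (cases "0 < r \<and> r \<le> t")
        case True
        then show ?thesis using H_abs[of r] by (simp add: f_def)
      next
        case False
        then have "f j r = 0" for j using elim by (auto simp: f_def split: split_indicator)
        then show ?thesis by simp
      qed
    qed
    have f_summable: "summable (\<lambda>j. \<integral>r. norm (f j r) \<partial>lborel)"
    proof (rule summable_comparison_test'[OF b_abs])
      fix j :: nat
      have "(1 - exp (- (m j * t))) / m j * \<bar>b j\<bar> \<le> 1 / m j * \<bar>b j\<bar>"
        using m[of j] by (intro mult_right_mono divide_right_mono) auto
      moreover have "0 \<le> (1 - exp (- (m j * t))) / m j * \<bar>b j\<bar>"
        using m[of j] t by simp
      ultimately show "norm (\<integral>r. norm (f j r) \<partial>lborel) \<le> \<bar>b j\<bar> / m j" unfolding fni by simp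
    qed
    have fint: "integrable lborel (f j)" for j using fi[of j] by (simp add: has_bochner_integral_iff)
    have "(\<lambda>j. integral\<^sup>L lborel (f j)) sums (\<integral>r. (\<Sum>j. f j r) \<partial>lborel)"
      by (rule sums_integral[OF fint f_ae f_summable])
    then have G_int: "G t = (\<integral>r. (\<Sum>j. f j r) \<partial>lborel)"
      using sums_unique2[OF G_sums[OF t]] by (simp add: has_bochner_integral_integral_eq[OF fi])
    have Fint: "integrable lborel (\<lambda>r. \<Sum>j. f j r)"
      by (rule integrable_suminf[OF fint f_ae f_summable])
    have cint: "has_bochner_integral lborel (\<lambda>r. a * indicator {0..t} r) (a * t)" for a :: real
      using has_bochner_integral_mult_right[OF has_bochner_integral_real_indicator[of "{0..t}" lborel], of a] t
      by simp
    have "G t - t * g x = (\<integral>r. (\<Sum>j. f j r) - g x * indicator {0..t} r \<partial>lborel)"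
      using Fint cint[of "g x"] unfolding G_int
      by (subst Bochner_Integration.integral_diff)
        (auto simp: has_bochner_integral_iff mult.commute)
    then have "\<bar>G t - t * g x\<bar> \<le> (\<integral>r. norm ((\<Sum>j. f j r) - g x * indicator {0..t} r) \<partial>lborel)"
      using integral_norm_bound[of lborel "\<lambda>r. (\<Sum>j. f j r) - g x * indicator {0..t} r"] by simp
    also have "\<dots> \<le> (\<integral>r. \<epsilon> * indicator {0..t} r \<partial>lborel)"
    proof (rule integral_mono_AE)
      show "integrable lborel (\<lambda>r. norm ((\<Sum>j. f j r) - g x * indicator {0..t} r))"
        using Fint cint[of "g x"] by (intro integrable_norm Bochner_Integration.integrable_diff) (auto simp: has_bochner_integral_iff)
      show "integrable lborel (\<lambda>r. \<epsilon> * indicator {0..t} r)"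
        using cint[of \<epsilon>] by (simp add: has_bochner_integral_iff)
      show "AE r in lborel. norm ((\<Sum>j. f j r) - g x * indicator {0..t} r) \<le> \<epsilon> * indicator {0..t} r"
        using ae_pos
      proof eventually_elim
        case (elim r)
        show ?case
        proof (cases "0 < r \<and> r \<le> t")
          case True
          then have "(\<Sum>j. f j r) = H r" using sums_unique[OF H_sums[of r]] by (simp add: f_def)
          then show ?thesis using True eps[of r] by simp
        next
          case False
          then show ?thesis using elim by (auto simp: f_def split: split_indicator)
        qed
      qed
    qed
    also have "\<dots> = \<epsilon> * t" using cint[of \<epsilon>] by (simp add: has_bochner_integral_iff)
    finally show ?thesis .
  qed
  have "((\<lambda>t. exp (- lam * t) * heat t g x) \<longlongrightarrow> exp (- lam * 0) * g x) (at_right 0)"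
    by (intro tendsto_mult heat_tendsto_initial g x tendsto_exp tendsto_ident_at tendsto_const)
  then have H_lim: "(H \<longlongrightarrow> g x) (at_right 0)" by (simp add: H_def[abs_def])
  have "((\<lambda>t. G t / t) \<longlongrightarrow> g x) (at_right 0)"
  proof (rule tendstoI)
    fix \<epsilon> :: real assume e: "\<epsilon> > 0"
    then have "\<forall>\<^sub>F t in at_right 0. dist (H t) (g x) < \<epsilon> / 2" by (intro tendstoD H_lim) simp
    then obtain d where d: "d > 0" "\<And>r. 0 < r \<Longrightarrow> r < d \<Longrightarrow> dist (H r) (g x) < \<epsilon> / 2"
      unfolding eventually_at_right_field by blast
    have "dist (G t / t) (g x) < \<epsilon>" if t: "0 < t" "t < d" for t
    proof -
      have "\<bar>G t - t * g x\<bar> \<le> \<epsilon> / 2 * t"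
      proof (rule key[OF t(1)])
        fix r assume "0 < r" "r \<le> t"
        then show "\<bar>H r - g x\<bar> \<le> \<epsilon> / 2" using d(2)[of r] t by (simp add: dist_real_def)
      qed
      moreover have "G t / t - g x = (G t - t * g x) / t" using t by (simp add: field_simps)
      ultimately have "\<bar>G t / t - g x\<bar> \<le> \<epsilon> / 2" using t by (simp add: divide_le_eq)
      then show ?thesis using e by (simp add: dist_real_def)
    qed
    then show "\<forall>\<^sub>F t in at_right 0. dist (G t / t) (g x) < \<epsilon>"
      unfolding eventually_at_right_field using d(1) by blast
  qed
  then show ?thesis by (simp add: G_def)
qed

text \<open>
  Let \<open>v\<close> be the function in the conclusion and \<open>g\<close> its negative part, which vanishes at \<open>x\<close>.  Formally
  \<open>\<langle>(lam - \<Delta>) v, g\<rangle> = lam c \<integral> g + b g(w) - a g(x) \<ge> 0\<close>, while positivity preservation makes the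
  left-hand side at most \<open>- lam \<parallel>g\<parallel>\<^sup>2\<close>; thus \<open>g = 0\<close>.  With \<open>lam - \<Delta>\<close> replaced by the quotients
  \<open>(1 - e\<^bsup>-lam t\<^esup> P\<^sub>t) / t\<close> the argument is rigorous for merely continuous \<open>g\<close>.
\<close>

theorem maximum_principle:
  assumes lam: "lam > 1" and K: "w \<in> K" "x \<in> K" and bc: "0 \<le> b" "0 \<le> c"
    and vx: "c + b * resolvent lam w x - a * resolvent lam x x = 0" and y: "y \<in> K"
  shows "0 \<le> c + b * resolvent lam w y - a * resolvent lam x y"
proof -
  define v where "v y = c + b * resolvent lam w y - a * resolvent lam x y" for y
  define g where "g y = max (- v y) 0" for y
  have vc: "continuous_on K v"
    unfolding v_def by (intro continuous_intros resolvent_continuous lam K)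
  have gc: "continuous_on K g" unfolding g_def by (intro continuous_intros vc)
  have vL: "v \<in> L2 \<mu>" and gL: "g \<in> L2 \<mu>" using vc gc by (auto intro: continuous_L2)
  have rL: "resolvent lam w \<in> L2 \<mu>" "resolvent lam x \<in> L2 \<mu>" by (auto intro: resolvent_L2 lam K)
  have gx: "g x = 0" using vx by (simp add: g_def v_def)
  define Gw where "Gw t = L2_inner \<mu> (resolvent lam w) g - exp (- lam * t) * L2_inner \<mu> (heat t (resolvent lam w)) g" for t
  define Gx where "Gx t = L2_inner \<mu> (resolvent lam x) g - exp (- lam * t) * L2_inner \<mu> (heat t (resolvent lam x)) g" for t
  define I where "I = (\<integral>y. g y \<partial>\<mu>)"
  have I0: "0 \<le> I" unfolding I_def by (intro integral_nonneg_AE AE_I2) (simp add: g_def)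
  define E where "E t = 1 - exp (- lam * t)" for t
  have ineq: "c * I * (E t / t) + b * (Gw t / t) - a * (Gx t / t) \<le> - L2_inner \<mu> g g * (E t / t)"
    if t: "0 < t" "t < 1" for t
  proof -
    have hc: "continuous_on K (heat t f)" if "f \<in> L2 \<mu>" for f by (rule heat_continuous[OF t(1) that])
    have hL: "heat t f \<in> L2 \<mu>" if "f \<in> L2 \<mu>" for f by (rule continuous_L2[OF hc[OF that]])
    have inner_v: "L2_inner \<mu> v g = c * I + b * L2_inner \<mu> (resolvent lam w) g - a * L2_inner \<mu> (resolvent lam x) g"
    proof -
      have "L2_inner \<mu> v g = (\<integral>y. c * g y + b * (resolvent lam w y * g y) - a * (resolvent lam x y * g y) \<partial>\<mu>)"
        unfolding L2_inner_def v_def by (simp add: algebra_simps)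
      then show ?thesis
        using L2_mult_integrable[OF rL(1) gL] L2_mult_integrable[OF rL(2) gL] continuous_integrable[OF gc]
        by (simp add: L2_inner_def I_def)
    qed
    have heat_v: "heat t v y = c + b * heat t (resolvent lam w) y - a * heat t (resolvent lam x) y" if "y \<in> K" for y
    proof -
      have i: "integrable \<mu> (p t y)" "integrable \<mu> (\<lambda>z. p t y z * resolvent lam w z)" "integrable \<mu> (\<lambda>z. p t y z * resolvent lam x z)"
        by (intro continuous_integrable continuous_intros p_section resolvent_continuous t that lam K)+
      have "heat t v y = (\<integral>z. c * p t y z + b * (p t y z * resolvent lam w z) - a * (p t y z * resolvent lam x z) \<partial>\<mu>)"
        unfolding heat_def v_def by (simp add: algebra_simps)
      then show ?thesis using i by (simp add: heat_def p_total t that)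
    qed
    have inner_hv: "L2_inner \<mu> (heat t v) g = c * I + b * L2_inner \<mu> (heat t (resolvent lam w)) g - a * L2_inner \<mu> (heat t (resolvent lam x)) g"
    proof -
      have "L2_inner \<mu> (heat t v) g = (\<integral>y. c * g y + b * (heat t (resolvent lam w) y * g y) - a * (heat t (resolvent lam x) y * g y) \<partial>\<mu>)"
        unfolding L2_inner_def
        by (rule Bochner_Integration.integral_cong) (auto simp: space_mu heat_v algebra_simps)
      then show ?thesis
        using L2_mult_integrable[OF hL[OF rL(1)] gL] L2_mult_integrable[OF hL[OF rL(2)] gL] continuous_integrable[OF gc]
        by (simp add: L2_inner_def I_def)
    qed
    have vg: "L2_inner \<mu> v g = - L2_inner \<mu> g g"
    proof -
      have "v y * g y = - (g y * g y)" for y by (auto simp: g_def max_def)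
      then show ?thesis by (simp add: L2_inner_def)
    qed
    have hg: "L2_inner \<mu> (heat t g) g \<le> L2_inner \<mu> g g"
    proof (rule sums_le[OF _ Parseval[OF hL[OF gL] gL] Parseval[OF gL gL]])
      fix j
      have co: "L2_inner \<mu> (heat t g) (\<psi> j) = exp (- \<nu> j * t) * L2_inner \<mu> g (\<psi> j)"
        using heat_coeff[OF t(1) gL] by (simp add: heat_def[abs_def])
      have "exp (- \<nu> j * t) * (L2_inner \<mu> g (\<psi> j) * L2_inner \<mu> g (\<psi> j)) \<le> 1 * (L2_inner \<mu> g (\<psi> j) * L2_inner \<mu> g (\<psi> j))"
        using nu_nonneg[of j] t by (intro mult_right_mono) auto
      then show "L2_inner \<mu> (heat t g) (\<psi> j) * L2_inner \<mu> g (\<psi> j) \<le> L2_inner \<mu> g (\<psi> j) * L2_inner \<mu> g (\<psi> j)"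
        by (simp add: co mult.assoc)
    qed
    \<comment> \<open>\<open>v \<ge> - g\<close> and the kernel is nonnegative\<close>
    have hv: "- L2_inner \<mu> (heat t g) g \<le> L2_inner \<mu> (heat t v) g"
    proof -
      have "(\<integral>y. - (heat t g y * g y) \<partial>\<mu>) \<le> (\<integral>y. heat t v y * g y \<partial>\<mu>)"
      proof (rule integral_mono)
        show "integrable \<mu> (\<lambda>y. - (heat t g y * g y))" "integrable \<mu> (\<lambda>y. heat t v y * g y)"
          using L2_mult_integrable[OF hL[OF gL] gL] L2_mult_integrable[OF hL[OF vL] gL] by auto
        fix y assume "y \<in> space \<mu>"
        then have y: "y \<in> K" by (simp add: space_mu)
        have "(\<integral>z. - (p t y z * g z) \<partial>\<mu>) \<le> (\<integral>z. p t y z * v z \<partial>\<mu>)"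
        proof (rule integral_mono)
          show "integrable \<mu> (\<lambda>z. - (p t y z * g z))" "integrable \<mu> (\<lambda>z. p t y z * v z)"
            by (intro continuous_integrable continuous_intros p_section t y gc vc)+
          fix z assume "z \<in> space \<mu>"
          then have "0 \<le> p t y z" using p_nonneg[OF t y] by (simp add: space_mu)
          then have "p t y z * (- g z) \<le> p t y z * v z" by (intro mult_left_mono) (auto simp: g_def)
          then show "- (p t y z * g z) \<le> p t y z * v z" by simp
        qed
        then have "- heat t g y \<le> heat t v y" by (simp add: heat_def)
        then have "- heat t g y * g y \<le> heat t v y * g y" by (rule mult_right_mono) (simp add: g_def)
        then show "- (heat t g y * g y) \<le> heat t v y * g y" by simp
      qed
      then show ?thesis by (simp add: L2_inner_def)
    qed
    have "exp (- lam * t) * (- L2_inner \<mu> g g) \<le> exp (- lam * t) * L2_inner \<mu> (heat t v) g"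
      using hg hv by (intro mult_left_mono) auto
    then have "L2_inner \<mu> v g - exp (- lam * t) * L2_inner \<mu> (heat t v) g \<le> - L2_inner \<mu> g g * E t"
      by (simp add: vg E_def algebra_simps)
    moreover have "L2_inner \<mu> v g - exp (- lam * t) * L2_inner \<mu> (heat t v) g = c * I * E t + b * Gw t - a * Gx t"
      unfolding inner_v inner_hv by (simp add: E_def Gw_def Gx_def algebra_simps)
    ultimately have "c * I * E t + b * Gw t - a * Gx t \<le> - L2_inner \<mu> g g * E t" by simp
    then have "(c * I * E t + b * Gw t - a * Gx t) / t \<le> (- L2_inner \<mu> g g * E t) / t"
      using t by (intro divide_right_mono) auto
    then show ?thesis by (simp add: add_divide_distrib diff_divide_distrib)
  qed
  have E_lim: "((\<lambda>t. E t / t) \<longlongrightarrow> lam) (at_right 0)"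
    unfolding E_def using lam by real_asymp
  have "((\<lambda>t. c * I * (E t / t) + b * (Gw t / t) - a * (Gx t / t)) \<longlongrightarrow> c * I * lam + b * g w - a * g x) (at_right 0)"
    unfolding Gw_def Gx_def
    by (intro tendsto_add tendsto_diff tendsto_mult tendsto_const E_lim resolvent_defect_tendsto lam K gc)
  moreover have "((\<lambda>t. - L2_inner \<mu> g g * (E t / t)) \<longlongrightarrow> - L2_inner \<mu> g g * lam) (at_right 0)"
    by (intro tendsto_mult tendsto_const E_lim)
  moreover have "\<forall>\<^sub>F t in at_right 0. c * I * (E t / t) + b * (Gw t / t) - a * (Gx t / t) \<le> - L2_inner \<mu> g g * (E t / t)"
    unfolding eventually_at_right_field using ineq zero_less_one by blast
  ultimately have "c * I * lam + b * g w - a * g x \<le> - L2_inner \<mu> g g * lam"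
    by (intro tendsto_le[OF trivial_limit_at_right_real])
  moreover have "0 \<le> c * I * lam + b * g w"
    using bc I0 lam by (intro add_nonneg_nonneg mult_nonneg_nonneg) (auto simp: g_def)
  ultimately have "L2_inner \<mu> g g * lam \<le> 0" by (simp add: gx)
  then have "L2_inner \<mu> g g = 0"
    using lam L2_inner_self_nonneg[of \<mu> g] by (auto simp: mult_le_0_iff)
  then have "g y = 0"
    by (intro continuous_eq_if_AE_eq[OF gc continuous_on_const _ y] L2_inner_self_zero gL)
  then show ?thesis by (auto simp: g_def v_def max_def split: if_splits)
qed

text \<open>
  Divided by \<open>R(x,x)\<close>: the process started at \<open>y\<close> reaches \<open>w\<close> at least by way of \<open>x\<close>.  The maximum
  principle is applied to \<open>R(x,x) R(w,\<cdot>) - R(x,w) R(x,\<cdot>)\<close>, which vanishes at \<open>x\<close>.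
\<close>

lemma resolvent_hitting:
  assumes "lam > 1" "x \<in> K" "y \<in> K" "w \<in> K"
  shows "resolvent lam x y * resolvent lam x w \<le> resolvent lam x x * resolvent lam y w"
  using maximum_principle[of lam w x "resolvent lam x x" 0 "resolvent lam x w" y] assms
    resolvent_diag_pos[of lam x]
  by (simp add: resolvent_sym[of lam w] mult.commute)

lemma resolvent_le_diag:
  assumes "lam > 1" "x \<in> K" "y \<in> K"
  shows "resolvent lam x y \<le> resolvent lam x x"
  using maximum_principle[of lam x x 0 "resolvent lam x x" 1 y] assms
    resolvent_diag_pos[of lam x]
  by simp

section \<open>Increments of the fractional kernel\<close>

lemma resolvent_norm:
  assumes lam: "lam > 1" and x: "x \<in> K"
  shows "(\<integral>w. (resolvent lam x w)\<^sup>2 \<partial>\<mu>) \<le> resolvent lam x x / lam"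
proof -
  have s: "(\<lambda>j. (L2_inner \<mu> (resolvent lam x) (\<psi> j))\<^sup>2) sums (\<integral>w. (resolvent lam x w)\<^sup>2 \<partial>\<mu>)"
    using Parseval_norm[OF resolvent_L2[OF assms]] unfolding L2_norm_sq by (simp add: L2_inner_def power2_eq_square)
  have s2: "(\<lambda>j. \<psi> j x * \<psi> j x / (lam + \<nu> j) / lam) sums (resolvent lam x x / lam)"
    by (intro sums_divide resolvent_sums assms)
  show ?thesis
  proof (rule sums_le[OF _ s s2])
    fix j
    have pos: "lam + \<nu> j > 0" "lam \<le> lam + \<nu> j" using lam nu_nonneg[of j] by auto
    have "(\<psi> j x)\<^sup>2 / (lam + \<nu> j) / (lam + \<nu> j) \<le> (\<psi> j x)\<^sup>2 / (lam + \<nu> j) / lam"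
      using pos lam by (intro divide_left_mono) auto
    then show "(L2_inner \<mu> (resolvent lam x) (\<psi> j))\<^sup>2 \<le> \<psi> j x * \<psi> j x / (lam + \<nu> j) / lam"
      by (simp add: resolvent_coeff assms power_divide power2_eq_square)
  qed
qed

lemma resolvent_difference_norm:
  assumes lam: "lam > 1" and K: "x \<in> K" "y \<in> K"
  shows "(\<lambda>j. (\<psi> j x - \<psi> j y)\<^sup>2 / (lam + \<nu> j)\<^sup>2) sums (\<integral>w. (resolvent lam x w - resolvent lam y w)\<^sup>2 \<partial>\<mu>)"
proof -
  let ?r = "\<lambda>w. resolvent lam x w - resolvent lam y w"
  have L: "resolvent lam x \<in> L2 \<mu>" "resolvent lam y \<in> L2 \<mu>" using lam K by (auto intro: resolvent_L2)
  have "L2_inner \<mu> ?r (\<psi> j) = (\<psi> j x - \<psi> j y) / (lam + \<nu> j)" for j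
    by (simp add: L2_inner_diff[OF L basis_L2] resolvent_coeff lam K diff_divide_distrib)
  then show ?thesis
    using Parseval_norm[OF L2_diff[OF L]] unfolding L2_norm_sq
    by (simp add: L2_inner_def power2_eq_square[of "?r _"] power_divide)
qed

text \<open>
  The second bound is the heart of the matter.  With \<open>q = (R(x,x) - R(x,y)) / R(x,x)\<close>, the hitting
  inequality reads \<open>R(x,w) - R(y,w) \<le> q R(x,w)\<close>, so the difference is pointwise a small multiple of
  the resolvent kernel itself.  The resistance estimate bounds \<open>q\<close> by \<open>C d(x,y)\<^sup>\<kappa> / R(x,x)\<close>, and
  \<open>\<parallel>R(x,\<cdot>)\<parallel>\<^sup>2 \<le> R(x,x) / lam\<close> together with the lower bound of \<open>R(x,x)\<close> gives the stated power of
  \<open>lam\<close>.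
\<close>

lemma resolvent_difference_bounds:
  obtains C where "C > 0"
    "\<And>lam x y n. lam > 1 \<Longrightarrow> x \<in> K \<Longrightarrow> y \<in> K \<Longrightarrow>
      (\<Sum>j<n. (\<psi> j x - \<psi> j y)\<^sup>2 / (lam + \<nu> j)\<^sup>2) \<le> C * lam powr (\<theta> - 2)"
    "\<And>lam x y n. lam > 1 \<Longrightarrow> x \<in> K \<Longrightarrow> y \<in> K \<Longrightarrow>
      (\<Sum>j<n. (\<psi> j x - \<psi> j y)\<^sup>2 / (lam + \<nu> j)\<^sup>2) \<le> C * (dist x y powr (2 * \<kappa>) * lam powr (- \<theta>))"
proof -
  obtain D where D: "D > 0" "\<And>lam x. lam > 1 \<Longrightarrow> x \<in> K \<Longrightarrow> resolvent lam x x \<le> D * lam powr (\<theta> - 1)"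
    using resolvent_diag_upper by blast
  obtain R where R: "R > 0" "\<And>lam y z. lam > 1 \<Longrightarrow> y \<in> K \<Longrightarrow> z \<in> K \<Longrightarrow>
      resolvent lam y y - 2 * resolvent lam y z + resolvent lam z z \<le> R * dist y z powr \<kappa>"
    by (rule resolvent_increment, rule that)
  define C where "C = max (4 * D) (2 * R\<^sup>2 / c1)"
  have C: "C > 0" using D(1) by (simp add: C_def less_max_iff_disj)
  have partial: "(\<Sum>j<n. (\<psi> j x - \<psi> j y)\<^sup>2 / (lam + \<nu> j)\<^sup>2) \<le> (\<integral>w. (resolvent lam x w - resolvent lam y w)\<^sup>2 \<partial>\<mu>)"
    if "lam > 1" "x \<in> K" "y \<in> K" for lam x y n
    using sum_le_suminf[OF sums_summable[OF resolvent_difference_norm[OF that]], of "{..<n}"]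
      sums_unique[OF resolvent_difference_norm[OF that]] by simp
  have int2: "integrable \<mu> (\<lambda>w. (resolvent lam x w)\<^sup>2)" if "lam > 1" "x \<in> K" for lam x
    using resolvent_L2[OF that] by (simp add: L2_def)
  have intd: "integrable \<mu> (\<lambda>w. (resolvent lam x w - resolvent lam y w)\<^sup>2)" if "lam > 1" "x \<in> K" "y \<in> K" for lam x y
    using L2_diff[OF resolvent_L2[OF that(1,2)] resolvent_L2[OF that(1,3)]] by (simp add: L2_def)
  have first: "(\<integral>w. (resolvent lam x w - resolvent lam y w)\<^sup>2 \<partial>\<mu>) \<le> C * lam powr (\<theta> - 2)"
    if lam: "lam > 1" and K: "x \<in> K" "y \<in> K" for lam x y
  proof -
    have nb: "(\<integral>w. (resolvent lam z w)\<^sup>2 \<partial>\<mu>) \<le> D * lam powr (\<theta> - 2)" if "z \<in> K" for z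
    proof -
      have "resolvent lam z z / lam \<le> D * lam powr (\<theta> - 1) / lam"
        using D(2)[OF lam that] lam by (intro divide_right_mono) auto
      also have "\<dots> = D * lam powr (\<theta> - 2)"
        using lam by (simp add: powr_diff power2_eq_square)
      finally show ?thesis using resolvent_norm[OF lam that] by linarith
    qed
    have "(\<integral>w. (resolvent lam x w - resolvent lam y w)\<^sup>2 \<partial>\<mu>)
       \<le> (\<integral>w. 2 * (resolvent lam x w)\<^sup>2 + 2 * (resolvent lam y w)\<^sup>2 \<partial>\<mu>)"
    proof (rule integral_mono[OF intd[OF lam K]])
      show "integrable \<mu> (\<lambda>w. 2 * (resolvent lam x w)\<^sup>2 + 2 * (resolvent lam y w)\<^sup>2)"
        using int2[OF lam K(1)] int2[OF lam K(2)] by simp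
      fix w
      have "0 \<le> (resolvent lam x w + resolvent lam y w)\<^sup>2" by simp
      then show "(resolvent lam x w - resolvent lam y w)\<^sup>2 \<le> 2 * (resolvent lam x w)\<^sup>2 + 2 * (resolvent lam y w)\<^sup>2"
        by (simp add: power2_eq_square algebra_simps)
    qed
    also have "\<dots> \<le> 4 * D * lam powr (\<theta> - 2)"
      using nb[OF K(1)] nb[OF K(2)] int2[OF lam K(1)] int2[OF lam K(2)] by simp
    also have "\<dots> \<le> C * lam powr (\<theta> - 2)" by (intro mult_right_mono) (auto simp: C_def)
    finally show ?thesis .
  qed
  have second: "(\<integral>w. (resolvent lam x w - resolvent lam y w)\<^sup>2 \<partial>\<mu>) \<le> C * (dist x y powr (2 * \<kappa>) * lam powr (- \<theta>))"
    if lam: "lam > 1" and K: "x \<in> K" "y \<in> K" for lam x y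
  proof -
    define q where "q z z' = (resolvent lam z z - resolvent lam z z') / resolvent lam z z" for z z'
    define d where "d = dist x y powr \<kappa>"
    have d2: "dist x y powr (2 * \<kappa>) = d\<^sup>2"
      by (simp add: d_def power2_eq_square powr_add[symmetric])
    have q0: "0 \<le> q z z'" if "z \<in> K" "z' \<in> K" for z z'
      using resolvent_le_diag[OF lam that] resolvent_diag_pos[OF lam that(1)] by (simp add: q_def)
    have hit: "resolvent lam z w - resolvent lam z' w \<le> q z z' * resolvent lam z w"
      if z: "z \<in> K" "z' \<in> K" "w \<in> K" for z z' w
    proof -
      have "resolvent lam z z' * resolvent lam z w / resolvent lam z z \<le> resolvent lam z' w"
        using resolvent_hitting[OF lam z] resolvent_diag_pos[OF lam z(1)] by (simp add: divide_le_eq mult.commute)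
      moreover have "q z z' * resolvent lam z w = resolvent lam z w - resolvent lam z z' * resolvent lam z w / resolvent lam z z"
        using resolvent_diag_pos[OF lam z(1)] by (simp add: q_def field_simps)
      ultimately show ?thesis by linarith
    qed
    have point: "(resolvent lam x w - resolvent lam y w)\<^sup>2 \<le> (q x y)\<^sup>2 * (resolvent lam x w)\<^sup>2 + (q y x)\<^sup>2 * (resolvent lam y w)\<^sup>2"
      if w: "w \<in> K" for w
    proof (cases "resolvent lam x w \<ge> resolvent lam y w")
      case True
      then have "(resolvent lam x w - resolvent lam y w)\<^sup>2 \<le> (q x y * resolvent lam x w)\<^sup>2"
        using hit[OF K w] by (intro power_mono) auto
      then show ?thesis by (simp add: power_mult_distrib add_increasing2)
    next
      case False
      then have "(resolvent lam y w - resolvent lam x w)\<^sup>2 \<le> (q y x * resolvent lam y w)\<^sup>2"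
        using hit[OF K(2,1) w] by (intro power_mono) auto
      then show ?thesis by (simp add: power_mult_distrib add_increasing power2_commute)
    qed
    have contrib: "(q z z')\<^sup>2 * (\<integral>w. (resolvent lam z w)\<^sup>2 \<partial>\<mu>) \<le> R\<^sup>2 / c1 * (d\<^sup>2 * lam powr (- \<theta>))"
      if z: "z \<in> K" "z' \<in> K" and dd: "dist z z' powr \<kappa> = d" for z z'
    proof -
      define r where "r = resolvent lam z z"
      have r: "r > 0" using resolvent_diag_pos[OF lam z(1)] by (simp add: r_def)
      have sym: "resolvent lam z' z = resolvent lam z z'" by (rule resolvent_sym)
      have "r - resolvent lam z z' \<le> R * d"
        using R(2)[OF lam z] resolvent_le_diag[OF lam z(2,1)] unfolding r_def dd sym by linarith
      then have "q z z' \<le> R * d / r" unfolding q_def r_def[symmetric] using r by (intro divide_right_mono) auto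
      then have "(q z z')\<^sup>2 \<le> (R * d / r)\<^sup>2" using q0[OF z] by (intro power_mono)
      then have "(q z z')\<^sup>2 * (\<integral>w. (resolvent lam z w)\<^sup>2 \<partial>\<mu>) \<le> (R * d / r)\<^sup>2 * (r / lam)"
        unfolding r_def using resolvent_norm[OF lam z(1)] by (intro mult_mono) auto
      also have "\<dots> = (R * d)\<^sup>2 / (r * lam)" using r lam by (simp add: power2_eq_square field_simps)
      also have "\<dots> \<le> (R * d)\<^sup>2 / (c1 * lam powr (\<theta> - 1) * lam)"
        using resolvent_diag_lower[OF lam z(1)] r lam c_pos
        by (intro divide_left_mono mult_right_mono mult_pos_pos) (auto simp: r_def)
      also have "c1 * lam powr (\<theta> - 1) * lam = c1 * lam powr \<theta>" using lam by (simp add: powr_diff)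
      finally show ?thesis using lam by (simp add: powr_minus power_mult_distrib field_simps)
    qed
    have "(\<integral>w. (resolvent lam x w - resolvent lam y w)\<^sup>2 \<partial>\<mu>)
      \<le> (\<integral>w. (q x y)\<^sup>2 * (resolvent lam x w)\<^sup>2 + (q y x)\<^sup>2 * (resolvent lam y w)\<^sup>2 \<partial>\<mu>)"
      using int2[OF lam K(1)] int2[OF lam K(2)]
      by (intro integral_mono intd lam K) (auto simp: space_mu intro: point)
    also have "\<dots> = (q x y)\<^sup>2 * (\<integral>w. (resolvent lam x w)\<^sup>2 \<partial>\<mu>) + (q y x)\<^sup>2 * (\<integral>w. (resolvent lam y w)\<^sup>2 \<partial>\<mu>)"
      using int2[OF lam K(1)] int2[OF lam K(2)] by simp
    also have "\<dots> \<le> 2 * R\<^sup>2 / c1 * (d\<^sup>2 * lam powr (- \<theta>))"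
      using contrib[OF K] contrib[OF K(2,1)] by (simp add: d_def dist_commute)
    also have "\<dots> \<le> C * (d\<^sup>2 * lam powr (- \<theta>))" by (intro mult_right_mono) (auto simp: C_def)
    finally show ?thesis by (simp add: d2)
  qed
  show ?thesis
    by (rule that[OF C]) (use order_trans[OF partial first] order_trans[OF partial second] in blast)+
qed

end

lemma powr_interpolate:
  fixes F A B \<eta> :: real
  assumes "0 \<le> F" "F \<le> A" "F \<le> B" "0 \<le> \<eta>" "\<eta> \<le> 1"
  shows "F \<le> A powr (1 - \<eta>) * B powr \<eta>"
proof -
  have "F = F powr (1 - \<eta>) * F powr \<eta>"
    using assms(1) by (cases "F = 0") (auto simp: powr_add[symmetric])
  also have "\<dots> \<le> A powr (1 - \<eta>) * B powr \<eta>"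
    using assms by (intro mult_mono powr_mono2) auto
  finally show ?thesis .
qed

text \<open>
  A discrete form of \<open>\<nu>\<^bsup>-2s\<^esup> = c \<integral> \<lambda>\<^bsup>1 - 2s\<^esup> (\<nu> + \<lambda>)\<^bsup>-2\<^esup> d\<lambda>\<close>: a single scale \<open>2\<^bsup>k + 1\<^esup>\<close> of the
  size of \<open>\<nu>\<close> suffices.  Only scales above \<open>1\<close> are allowed, so eigenvalues below \<open>2\<close> are treated like \<open>2\<close>; the
  spectral gap \<open>\<nu>\<^sub>0\<close> pays for this.
\<close>

lemma dyadic_resolvent_bound:
  fixes s \<nu>\<^sub>0 :: real
  assumes s: "0 < s" "s < 1" and "0 < \<nu>\<^sub>0"
  obtains B where "B > 0" "\<And>\<nu>. \<nu>\<^sub>0 \<le> \<nu> \<Longrightarrow>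
    \<exists>k. \<nu> powr (- (2 * s)) \<le> B * ((2 ^ Suc k) powr (2 - 2 * s) / (\<nu> + 2 ^ Suc k)\<^sup>2)"
proof -
  define L where "L = max 1 (2 / \<nu>\<^sub>0)"
  have L: "L > 0" "1 \<le> L" by (auto simp: L_def)
  define B where "B = L powr (2 * s) * 4 * 2 powr (2 - 2 * s)"
  have "\<exists>k. \<nu> powr (- (2 * s)) \<le> B * ((2 ^ Suc k) powr (2 - 2 * s) / (\<nu> + 2 ^ Suc k)\<^sup>2)"
    if nu: "\<nu>\<^sub>0 \<le> \<nu>" for \<nu>
  proof -
    define M where "M = max 2 \<nu>"
    have nu0: "\<nu> > 0" using nu assms by simp
    have M: "M \<ge> 2" "M \<ge> \<nu>" by (auto simp: M_def)
    have M_le: "M \<le> L * \<nu>"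
    proof -
      have "2 \<le> (2 / \<nu>\<^sub>0) * \<nu>" using nu assms by (simp add: field_simps)
      also have "\<dots> \<le> L * \<nu>" using nu0 by (intro mult_right_mono) (auto simp: L_def)
      finally have "2 \<le> L * \<nu>" .
      moreover have "1 * \<nu> \<le> L * \<nu>" using nu0 L by (intro mult_right_mono) auto
      ultimately show ?thesis by (simp add: M_def)
    qed
    have ex: "\<exists>n. M < 2 ^ n" by (rule real_arch_pow) simp
    define n where "n = (LEAST n. M < 2 ^ n)"
    have n: "M < 2 ^ n" unfolding n_def by (rule LeastI_ex[OF ex])
    have "n \<noteq> 0" using n M by (cases "n = 0") auto
    moreover have "n \<noteq> 1" using n M by (cases "n = 1") auto
    ultimately
    obtain k where k: "n = Suc (Suc k)" by (metis One_nat_def not0_implies_Suc)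
    define X :: real where "X = 2 ^ Suc k"
    have X: "X \<le> M"
      using not_less_Least[of "Suc k" "\<lambda>n. M < 2 ^ n"] k unfolding n_def X_def by (simp add: not_less)
    have X2: "M / 2 \<le> X" using n unfolding k X_def by simp
    have X0: "X > 0" by (simp add: X_def)
    have "\<nu> powr (- (2 * s)) = L powr (2 * s) * (L * \<nu>) powr (- (2 * s))"
      using L nu0 by (simp add: powr_mult powr_minus)
    also have "\<dots> \<le> L powr (2 * s) * M powr (- (2 * s))"
      using M_le M s by (intro mult_left_mono powr_mono2') auto
    also have "\<dots> = B * ((M / 2) powr (2 - 2 * s) / (M + M)\<^sup>2)"
    proof -
      have "M powr (- (2 * s)) = M powr (2 - 2 * s) / M\<^sup>2"
        using M by (simp add: powr_diff powr_minus divide_inverse)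
      then show ?thesis
        using M by (simp add: B_def powr_divide power2_eq_square field_simps)
    qed
    also have "\<dots> \<le> B * (X powr (2 - 2 * s) / (\<nu> + X)\<^sup>2)"
      using X X2 M nu0 X0 s L unfolding B_def
      by (intro mult_left_mono frac_le powr_mono2 power_mono) auto
    finally show ?thesis unfolding X_def by blast
  qed
  then show ?thesis using that[of B] L by (simp add: B_def)
qed

context subgaussian_kernel
begin

text \<open>
  Interpolating the two bounds of \<open>resolvent_difference_bounds\<close> with weight \<open>\<eta> = H / \<kappa>\<close> on the second
  one produces \<open>d(x,y)\<^bsup>2H\<^esup>\<close> and leaves a factor \<open>\<lambda>\<^bsup>-\<tau>\<^esup>\<close> with
  \<open>\<tau> = 2 (s - \<theta>/2 - H / d\<^sub>w) > 0\<close>, which makes the sum over \<open>\<lambda> = 2\<^bsup>k + 1\<^esup>\<close> geometric.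
\<close>

theorem fractional_increments:
  assumes s: "\<theta> < 2 * s" "2 * s < 2 - \<theta>" and H: "0 < H" "H < d_w * (s - \<theta> / 2)" and nu0: "0 < \<nu>\<^sub>0"
  obtains C where "C > 0" "\<And>I x y. finite I \<Longrightarrow> (\<And>j. j \<in> I \<Longrightarrow> \<nu>\<^sub>0 \<le> \<nu> j) \<Longrightarrow> x \<in> K \<Longrightarrow> y \<in> K \<Longrightarrow>
     (\<Sum>j\<in>I. \<nu> j powr (- (2 * s)) * (\<psi> j x - \<psi> j y)\<^sup>2) \<le> C * dist x y powr (2 * H)"
proof -
  have s01: "0 < s" "s < 1" using s theta by auto
  obtain B where B: "B > 0" "\<And>\<nu>. \<nu>\<^sub>0 \<le> \<nu> \<Longrightarrow>
      \<exists>k. \<nu> powr (- (2 * s)) \<le> B * ((2 ^ Suc k) powr (2 - 2 * s) / (\<nu> + 2 ^ Suc k)\<^sup>2)"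
    using dyadic_resolvent_bound[OF s01 nu0] by blast
  obtain D where D: "D > 0"
    "\<And>lam x y n. lam > 1 \<Longrightarrow> x \<in> K \<Longrightarrow> y \<in> K \<Longrightarrow>
      (\<Sum>j<n. (\<psi> j x - \<psi> j y)\<^sup>2 / (lam + \<nu> j)\<^sup>2) \<le> D * lam powr (\<theta> - 2)"
    "\<And>lam x y n. lam > 1 \<Longrightarrow> x \<in> K \<Longrightarrow> y \<in> K \<Longrightarrow>
      (\<Sum>j<n. (\<psi> j x - \<psi> j y)\<^sup>2 / (lam + \<nu> j)\<^sup>2) \<le> D * (dist x y powr (2 * \<kappa>) * lam powr (- \<theta>))"
    by (rule resolvent_difference_bounds, rule that)
  define \<eta> where "\<eta> = H / \<kappa>"
  have "H < \<kappa>"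
  proof -
    have "d_w * (s - \<theta> / 2) < \<kappa>" unfolding \<kappa>_def using d_w s by (intro mult_strict_left_mono) auto
    then show ?thesis using H by linarith
  qed
  then have eta: "0 < \<eta>" "\<eta> < 1" using H kappa_pos by (auto simp: \<eta>_def)
  define \<tau> where "\<tau> = 2 * (s - \<theta> / 2) - 2 * H / d_w"
  have tau: "\<tau> > 0"
  proof -
    have "H / d_w < s - \<theta> / 2" using H(2) d_w by (simp add: divide_less_eq mult.commute)
    then show ?thesis by (simp add: \<tau>_def)
  qed
  define b where "b = (1/2 :: real) powr \<tau>"
  have b: "0 < b" "b < 1" using tau by (auto simp: b_def half_powr_less_one)
  define C where "C = B * D * (1 / (1 - b))"
  have C: "C > 0" using B(1) D(1) b by (simp add: C_def)
  have "(\<Sum>j\<in>I. \<nu> j powr (- (2 * s)) * (\<psi> j x - \<psi> j y)\<^sup>2) \<le> C * dist x y powr (2 * H)"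
    if I: "finite I" "\<And>j. j \<in> I \<Longrightarrow> \<nu>\<^sub>0 \<le> \<nu> j" and K: "x \<in> K" "y \<in> K" for I x y
  proof -
    define a where "a j = (\<psi> j x - \<psi> j y)\<^sup>2" for j
    have a0: "0 \<le> a j" for j by (simp add: a_def)
    have "\<exists>k. j \<in> I \<longrightarrow> \<nu> j powr (- (2 * s)) \<le> B * ((2 ^ Suc k) powr (2 - 2 * s) / (\<nu> j + 2 ^ Suc k)\<^sup>2)" for j
      using B(2) I(2) by blast
    then obtain k where k: "\<And>j. j \<in> I \<Longrightarrow> \<nu> j powr (- (2 * s)) \<le> B * ((2 ^ Suc (k j)) powr (2 - 2 * s) / (\<nu> j + 2 ^ Suc (k j))\<^sup>2)"
      by metis
    define N where "N = Suc (\<Sum>j\<in>I. k j)"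
    have kN: "k j < N" if "j \<in> I" for j
      unfolding N_def using member_le_sum[of j I k] that I(1) by simp
    obtain n where n: "I \<subseteq> {..<n}" using finite_nat_iff_bounded I(1) by blast
    have dyadic_sum: "(\<Sum>j\<in>I. (2 ^ Suc i) powr (2 - 2 * s) / (\<nu> j + 2 ^ Suc i)\<^sup>2 * a j)
       \<le> D * dist x y powr (2 * H) * b ^ i" for i
    proof -
      define X :: real where "X = 2 ^ Suc i"
      have "(1::real) \<le> 2 ^ i" for i :: nat by (rule one_le_power) simp
      from this[of i] have X: "X > 1" unfolding X_def power_Suc by linarith
      define F where "F = (\<Sum>j<n. a j / (X + \<nu> j)\<^sup>2)"
      have F0: "0 \<le> F" unfolding F_def using a0 by (intro sum_nonneg) auto
      have "F \<le> (D * X powr (\<theta> - 2)) powr (1 - \<eta>) * (D * (dist x y powr (2 * \<kappa>) * X powr (- \<theta>))) powr \<eta>"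
        using D(2)[OF X K, of n] D(3)[OF X K, of n] eta F0
        by (intro powr_interpolate) (auto simp: F_def a_def)
      also have "\<dots> = (D powr (1 - \<eta>) * D powr \<eta>) * dist x y powr (2 * \<kappa> * \<eta>)
          * (X powr ((\<theta> - 2) * (1 - \<eta>)) * X powr (- \<theta> * \<eta>))"
        using D(1) X by (simp add: powr_mult powr_powr mult_ac)
      also have "D powr (1 - \<eta>) * D powr \<eta> = D" using D(1) by (simp add: powr_add[symmetric])
      also have "2 * \<kappa> * \<eta> = 2 * H" using kappa_pos by (simp add: \<eta>_def)
      finally have F: "F \<le> D * dist x y powr (2 * H) * (X powr ((\<theta> - 2) * (1 - \<eta>)) * X powr (- \<theta> * \<eta>))" .
      have "(\<Sum>j\<in>I. X powr (2 - 2 * s) / (\<nu> j + X)\<^sup>2 * a j) = X powr (2 - 2 * s) * (\<Sum>j\<in>I. a j / (X + \<nu> j)\<^sup>2)"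
        by (simp add: sum_distrib_left add.commute mult.commute)
      also have "\<dots> \<le> X powr (2 - 2 * s) * F"
        unfolding F_def using n a0 by (intro mult_left_mono sum_mono2) auto
      also have "\<dots> \<le> X powr (2 - 2 * s) * (D * dist x y powr (2 * H) * (X powr ((\<theta> - 2) * (1 - \<eta>)) * X powr (- \<theta> * \<eta>)))"
        by (intro mult_left_mono F) simp
      also have "\<dots> = D * dist x y powr (2 * H) * X powr ((2 - 2 * s) + ((\<theta> - 2) * (1 - \<eta>) + - \<theta> * \<eta>))"
        unfolding powr_add by (simp add: mult_ac)
      also have "(2 - 2 * s) + ((\<theta> - 2) * (1 - \<eta>) + - \<theta> * \<eta>) = - \<tau>"
      proof -
        have "\<eta> * (1 - \<theta>) = H / d_w" using d_w theta by (simp add: \<eta>_def \<kappa>_def)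
        then have "H / d_w = \<eta> - \<eta> * \<theta>" by (simp add: algebra_simps)
        then have "2 * H / d_w = 2 * (\<eta> - \<eta> * \<theta>)" unfolding times_divide_eq_right[symmetric] by (simp only:)
        then show ?thesis unfolding \<tau>_def by (simp only:) (simp add: algebra_simps)
      qed
      also have "X powr (- \<tau>) = b ^ Suc i"
        unfolding X_def b_def by (simp add: power_powr powr_mult powr_minus powr_divide power_divide inverse_eq_divide)
      also have "b ^ Suc i \<le> b ^ i" using b by (intro power_decreasing) auto
      finally show ?thesis using D(1) by (simp add: X_def mult_left_mono)
    qed
    have "(\<Sum>j\<in>I. \<nu> j powr (- (2 * s)) * a j)
      \<le> (\<Sum>j\<in>I. B * (\<Sum>i<N. (2 ^ Suc i) powr (2 - 2 * s) / (\<nu> j + 2 ^ Suc i)\<^sup>2 * a j))"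
    proof (rule sum_mono)
      fix j assume j: "j \<in> I"
      have "\<nu> j powr (- (2 * s)) * a j \<le> B * ((2 ^ Suc (k j)) powr (2 - 2 * s) / (\<nu> j + 2 ^ Suc (k j))\<^sup>2) * a j"
        by (intro mult_right_mono k j a0)
      also have "\<dots> = B * ((2 ^ Suc (k j)) powr (2 - 2 * s) / (\<nu> j + 2 ^ Suc (k j))\<^sup>2 * a j)"
        by (simp add: mult.assoc)
      also have "\<dots> \<le> B * (\<Sum>i<N. (2 ^ Suc i) powr (2 - 2 * s) / (\<nu> j + 2 ^ Suc i)\<^sup>2 * a j)"
        using B(1) a0[of j] kN[OF j]
        by (intro mult_left_mono member_le_sum[where f = "\<lambda>i. (2 ^ Suc i) powr (2 - 2 * s) / (\<nu> j + 2 ^ Suc i)\<^sup>2 * a j"]) auto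
      finally show "\<nu> j powr (- (2 * s)) * a j \<le> B * (\<Sum>i<N. (2 ^ Suc i) powr (2 - 2 * s) / (\<nu> j + 2 ^ Suc i)\<^sup>2 * a j)" .
    qed
    also have "\<dots> = B * (\<Sum>i<N. \<Sum>j\<in>I. (2 ^ Suc i) powr (2 - 2 * s) / (\<nu> j + 2 ^ Suc i)\<^sup>2 * a j)"
      unfolding sum_distrib_left[symmetric] by (subst sum.swap) simp
    also have "\<dots> \<le> B * (\<Sum>i<N. D * dist x y powr (2 * H) * b ^ i)"
      using B(1) by (intro mult_left_mono sum_mono dyadic_sum) auto
    also have "(\<Sum>i<N. D * dist x y powr (2 * H) * b ^ i) = D * dist x y powr (2 * H) * ((1 - b ^ N) / (1 - b))"
      using b by (simp add: sum_distrib_left[symmetric] sum_gp_strict)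
    also have "B * (D * dist x y powr (2 * H) * ((1 - b ^ N) / (1 - b)))
        \<le> B * (D * dist x y powr (2 * H) * (1 / (1 - b)))"
      using b B(1) D(1) by (intro mult_left_mono divide_right_mono) auto
    also have "\<dots> = C * dist x y powr (2 * H)" by (simp add: C_def mult_ac)
    finally show ?thesis by (simp add: a_def)
  qed
  then show ?thesis using that C by blast
qed

theorem fractional_diagonal:
  assumes s: "\<theta> < 2 * s" and nu0: "0 < \<nu>\<^sub>0"
  obtains C where "C > 0" "\<And>I x. finite I \<Longrightarrow> (\<And>j. j \<in> I \<Longrightarrow> \<nu>\<^sub>0 \<le> \<nu> j) \<Longrightarrow> x \<in> K \<Longrightarrow>
     (\<Sum>j\<in>I. \<nu> j powr (- (2 * s)) * (\<psi> j x)\<^sup>2) \<le> C"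
proof -
  obtain D where D: "D > 0" "\<And>lam x n. lam > 1 \<Longrightarrow> x \<in> K \<Longrightarrow>
     (\<Sum>j<n. (lam + \<nu> j) powr (- (2 * s)) * (\<psi> j x)\<^sup>2) \<le> D * lam powr (\<theta> - 2 * s)"
    using diagonal_power_sum[OF s] by blast
  define L where "L = 1 + 2 / \<nu>\<^sub>0"
  have L: "L > 0" using nu0 by (simp add: L_def add_pos_pos)
  define C where "C = L powr (2 * s) * (D * 2 powr (\<theta> - 2 * s))"
  have "(\<Sum>j\<in>I. \<nu> j powr (- (2 * s)) * (\<psi> j x)\<^sup>2) \<le> C"
    if I: "finite I" "\<And>j. j \<in> I \<Longrightarrow> \<nu>\<^sub>0 \<le> \<nu> j" and x: "x \<in> K" for I x
  proof -
    obtain n where n: "I \<subseteq> {..<n}" using finite_nat_iff_bounded I(1) by blast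
    have "(\<Sum>j\<in>I. \<nu> j powr (- (2 * s)) * (\<psi> j x)\<^sup>2)
        \<le> (\<Sum>j\<in>I. L powr (2 * s) * ((2 + \<nu> j) powr (- (2 * s)) * (\<psi> j x)\<^sup>2))"
    proof (rule sum_mono)
      fix j assume "j \<in> I"
      then have j: "\<nu>\<^sub>0 \<le> \<nu> j" by (rule I(2))
      have "2 \<le> 2 / \<nu>\<^sub>0 * \<nu> j" using j nu0 by (simp add: field_simps)
      then have le: "2 + \<nu> j \<le> L * \<nu> j" by (simp add: L_def distrib_right)
      have "\<nu> j powr (- (2 * s)) = L powr (2 * s) * (L * \<nu> j) powr (- (2 * s))"
        using L nu0 j by (simp add: powr_mult powr_minus)
      also have "\<dots> \<le> L powr (2 * s) * (2 + \<nu> j) powr (- (2 * s))"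
        using le nu0 j s theta by (intro mult_left_mono powr_mono2') auto
      finally have "\<nu> j powr (- (2 * s)) * (\<psi> j x)\<^sup>2 \<le> L powr (2 * s) * (2 + \<nu> j) powr (- (2 * s)) * (\<psi> j x)\<^sup>2"
        by (rule mult_right_mono) simp
      then show "\<nu> j powr (- (2 * s)) * (\<psi> j x)\<^sup>2 \<le> L powr (2 * s) * ((2 + \<nu> j) powr (- (2 * s)) * (\<psi> j x)\<^sup>2)"
        by (simp add: mult.assoc)
    qed
    also have "\<dots> = L powr (2 * s) * (\<Sum>j\<in>I. (2 + \<nu> j) powr (- (2 * s)) * (\<psi> j x)\<^sup>2)"
      by (simp add: sum_distrib_left)
    also have "\<dots> \<le> L powr (2 * s) * (\<Sum>j<n. (2 + \<nu> j) powr (- (2 * s)) * (\<psi> j x)\<^sup>2)"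
      using n by (intro mult_left_mono sum_mono2) auto
    also have "\<dots> \<le> C"
      unfolding C_def using x by (intro mult_left_mono D(2)) auto
    finally show ?thesis .
  qed
  moreover have "C > 0" using L D(1) by (simp add: C_def)
  ultimately show ?thesis using that by blast
qed

end

section \<open>Gaussian tails\<close>

lemma gaussian_rv_integral:
  assumes "gaussian_rv M Y" "\<sigma> \<noteq> 0"
    "distr M borel Y = density lborel (\<lambda>x. ennreal (normal_density m \<sigma> x))"
    "f \<in> borel_measurable borel"
  shows "(\<integral>\<omega>. f (Y \<omega>) \<partial>M) = (\<integral>x. normal_density m \<sigma> x * f x \<partial>lborel)"
    and "integrable lborel (\<lambda>x. normal_density m \<sigma> x * f x) \<Longrightarrow> integrable M (\<lambda>\<omega>. f (Y \<omega>))"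
proof -
  have Y: "Y \<in> borel_measurable M" using assms(1) by (simp add: gaussian_rv_def)
  have "(\<integral>\<omega>. f (Y \<omega>) \<partial>M) = integral\<^sup>L (distr M borel Y) f"
    by (rule integral_distr[symmetric, OF Y assms(4)])
  also have "\<dots> = (\<integral>x. normal_density m \<sigma> x * f x \<partial>lborel)"
    unfolding assms(3) by (subst integral_density) (use assms(4) in \<open>auto simp: normal_density_nonneg\<close>)
  finally show "(\<integral>\<omega>. f (Y \<omega>) \<partial>M) = (\<integral>x. normal_density m \<sigma> x * f x \<partial>lborel)" .
  assume "integrable lborel (\<lambda>x. normal_density m \<sigma> x * f x)"
  then have "integrable (distr M borel Y) f"
    unfolding assms(3) by (subst integrable_density) (use assms(4) in \<open>auto simp: normal_density_nonneg\<close>)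
  then show "integrable M (\<lambda>\<omega>. f (Y \<omega>))"
    using integrable_distr_eq[OF Y assms(4)] by simp
qed

text \<open>
  Markov's inequality for the moment of order \<open>2 k\<close>.  The tail decays faster than any power of
  \<open>v / a\<^sup>2\<close>, which is what chaining needs in high dimension.
\<close>

lemma gaussian_tail:
  assumes M: "prob_space M" and Y: "gaussian_rv M Y" and mean: "(\<integral>\<omega>. Y \<omega> \<partial>M) = 0"
    and var: "(\<integral>\<omega>. (Y \<omega>)\<^sup>2 \<partial>M) \<le> v" and a: "0 < a"
  shows "measure M {\<omega> \<in> space M. a \<le> \<bar>Y \<omega>\<bar>} \<le> fact (2 * k) / (2 ^ k * fact k) * (v / a\<^sup>2) ^ k"
proof -
  interpret prob_space M by fact
  have Ym [measurable]: "Y \<in> borel_measurable M" using Y by (simp add: gaussian_rv_def)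
  have v0: "0 \<le> v" using var by (rule order_trans[rotated]) simp
  obtain m \<sigma> where sig: "0 \<le> \<sigma>" and D: "distr M borel Y =
      (if \<sigma> = 0 then return borel m else density lborel (\<lambda>x. ennreal (normal_density m \<sigma> x)))"
    using Y unfolding gaussian_rv_def by blast
  show ?thesis
  proof (cases "\<sigma> = 0")
    case True
    then have D: "distr M borel Y = return borel m" using D by simp
    have "(\<integral>\<omega>. Y \<omega> \<partial>M) = integral\<^sup>L (distr M borel Y) (\<lambda>x. x)"
      by (rule integral_distr[symmetric]) auto
    also have "\<dots> = m" unfolding D by (subst integral_return) auto
    finally have m: "m = 0" using mean by simp
    have "measure M {\<omega> \<in> space M. a \<le> \<bar>Y \<omega>\<bar>} = measure (distr M borel Y) {x. a \<le> \<bar>x\<bar>}"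
      by (subst measure_distr) (auto intro!: arg_cong[where f = "measure M"])
    also have "\<dots> = 0" unfolding D m using a by (subst measure_return) auto
    finally show ?thesis using v0 by simp
  next
    case False
    then have sp: "\<sigma> > 0" using sig by simp
    have D: "distr M borel Y = density lborel (\<lambda>x. ennreal (normal_density m \<sigma> x))" using D False by simp
    have m: "m = 0"
      using gaussian_rv_integral(1)[OF Y False D, of "\<lambda>x. x"] mean integral_normal_moment_nz_1[OF sp, of m] by simp
    have mom: "has_bochner_integral lborel (\<lambda>x. normal_density m \<sigma> x * x ^ (2 * k)) (fact (2 * k) / ((2 / \<sigma>\<^sup>2) ^ k * fact k))" for k
      using normal_moment_even[OF sp, of 0 k] by (simp add: m)
    have "(\<integral>\<omega>. (Y \<omega>) ^ (2 * 1) \<partial>M) = fact (2 * 1) / ((2 / \<sigma>\<^sup>2) ^ 1 * fact 1)"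
      using gaussian_rv_integral(1)[OF Y False D, of "\<lambda>x. x ^ (2 * 1)"] mom[of 1]
      by (simp add: has_bochner_integral_integral_eq)
    then have s2: "\<sigma>\<^sup>2 \<le> v" using var by simp
    have int: "integrable M (\<lambda>\<omega>. (Y \<omega>) ^ (2 * k))"
      by (rule gaussian_rv_integral(2)[OF Y False D]) (use mom[of k] in \<open>auto simp: has_bochner_integral_iff\<close>)
    have "measure M {\<omega> \<in> space M. a \<le> \<bar>Y \<omega>\<bar>} \<le> measure M {\<omega> \<in> space M. a ^ (2 * k) \<le> (Y \<omega>) ^ (2 * k)}"
    proof (rule finite_measure_mono)
      have "a ^ (2 * k) \<le> (Y \<omega>) ^ (2 * k)" if "a \<le> \<bar>Y \<omega>\<bar>" for \<omega>
        using power_mono[OF that, of "2 * k"] a by (simp add: power_even_abs)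
      then show "{\<omega> \<in> space M. a \<le> \<bar>Y \<omega>\<bar>} \<subseteq> {\<omega> \<in> space M. a ^ (2 * k) \<le> (Y \<omega>) ^ (2 * k)}" by auto
    qed measurable
    also have "\<dots> \<le> (\<integral>\<omega>. (Y \<omega>) ^ (2 * k) \<partial>M) / a ^ (2 * k)"
      by (rule integral_Markov_inequality_measure[OF int, of "{}"]) (use a in auto)
    also have "(\<integral>\<omega>. (Y \<omega>) ^ (2 * k) \<partial>M) = fact (2 * k) / ((2 / \<sigma>\<^sup>2) ^ k * fact k)"
      using gaussian_rv_integral(1)[OF Y False D, of "\<lambda>x. x ^ (2 * k)"] mom[of k]
      by (simp add: has_bochner_integral_integral_eq)
    also have "\<dots> / a ^ (2 * k) = fact (2 * k) / (2 ^ k * fact k) * (\<sigma>\<^sup>2 / a\<^sup>2) ^ k"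
      using sp a by (simp add: power_divide power_mult)
    also have "\<dots> \<le> fact (2 * k) / (2 ^ k * fact k) * (v / a\<^sup>2) ^ k"
      using s2 by (intro mult_left_mono power_mono divide_right_mono) auto
    finally show ?thesis .
  qed
qed

section \<open>Dyadic grids\<close>

text \<open>
  The corner, scaled by \<open>2\<^sup>n\<close>, of the dyadic cell containing \<open>x\<close>; it serves as a label of the cell that
  is Borel measurable in \<open>x\<close>.
\<close>

definition grid_cell :: "nat \<Rightarrow> 'a::euclidean_space \<Rightarrow> 'a" where
  "grid_cell n x = (\<Sum>b\<in>Basis. of_int \<lfloor>2 ^ n * (x \<bullet> b)\<rfloor> *\<^sub>R b)"

text \<open>
  A point of \<open>K\<close> chosen once for each cell; taking it in \<open>K\<close> keeps the approximating variables among
  those indexed by \<open>K\<close>.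
\<close>

definition grid_proj :: "'a::euclidean_space set \<Rightarrow> nat \<Rightarrow> 'a \<Rightarrow> 'a" where
  "grid_proj K n x = (SOME y. y \<in> K \<and> grid_cell n y = grid_cell n x)"

lemma grid_cell_eq_iff:
  "grid_cell n x = grid_cell n y \<longleftrightarrow> (\<forall>b\<in>Basis. \<lfloor>2 ^ n * (x \<bullet> b)\<rfloor> = \<lfloor>2 ^ n * (y \<bullet> b)\<rfloor>)"
proof -
  have inner: "grid_cell n z \<bullet> b = of_int \<lfloor>2 ^ n * (z \<bullet> b)\<rfloor>" if "b \<in> Basis" for z b :: 'a
    unfolding grid_cell_def using that by (rule inner_sum_left_Basis)
  show ?thesis
    unfolding euclidean_eq_iff[of "grid_cell n x"] by (simp add: inner)
qed

lemma grid_proj: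
  assumes "x \<in> K"
  shows "grid_proj K n x \<in> K" "grid_cell n (grid_proj K n x) = grid_cell n x"
proof -
  have "grid_proj K n x \<in> K \<and> grid_cell n (grid_proj K n x) = grid_cell n x"
    unfolding grid_proj_def by (rule someI[of _ x]) (simp add: assms)
  then show "grid_proj K n x \<in> K" "grid_cell n (grid_proj K n x) = grid_cell n x" by auto
qed

lemma dist_grid_proj:
  fixes x :: "'a::euclidean_space"
  assumes "x \<in> K"
  shows "dist x (grid_proj K n x) \<le> real DIM('a) * (1/2) ^ n"
proof -
  define y where "y = grid_proj K n x"
  have coord: "\<bar>(x - y) \<bullet> b\<bar> \<le> (1/2) ^ n" if "b \<in> Basis" for b
  proof -
    have "\<lfloor>2 ^ n * (x \<bullet> b)\<rfloor> = \<lfloor>2 ^ n * (y \<bullet> b)\<rfloor>"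
      using grid_proj(2)[OF assms, of n] that unfolding y_def[symmetric] grid_cell_eq_iff by simp
    then have "\<bar>2 ^ n * (x \<bullet> b) - 2 ^ n * (y \<bullet> b)\<bar> \<le> 1" by linarith
    then have "2 ^ n * \<bar>(x - y) \<bullet> b\<bar> \<le> 1"
      by (simp add: inner_diff_left right_diff_distrib[symmetric] abs_mult)
    then show ?thesis by (simp add: power_divide field_simps)
  qed
  have "dist x y \<le> (\<Sum>b\<in>Basis. \<bar>(x - y) \<bullet> b\<bar>)" unfolding dist_norm by (rule norm_le_l1)
  also have "\<dots> \<le> (\<Sum>b\<in>(Basis::'a set). (1/2) ^ n)" by (intro sum_mono coord)
  finally show ?thesis by (simp add: y_def)
qed

lemma finite_card_grid_proj:
  fixes K :: "'a::euclidean_space set"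
  assumes "bounded K"
  obtains B where "B > 0" "\<And>n. finite (grid_proj K n ` K)"
    "\<And>n. real (card (grid_proj K n ` K)) \<le> B * (2 ^ DIM('a)) ^ n"
proof -
  obtain R where R: "R > 0" "\<And>x. x \<in> K \<Longrightarrow> norm x \<le> R" using assms unfolding bounded_pos by blast
  define B where "B = (2 * R + 5) ^ DIM('a)"
  have main: "finite (grid_proj K n ` K) \<and> real (card (grid_proj K n ` K)) \<le> B * (2 ^ DIM('a)) ^ n" for n
  proof -
    define a where "a = \<lceil>R * 2 ^ n\<rceil> + 1"
    have a0: "a > 0"
    proof -
      have "0 \<le> \<lceil>R * 2 ^ n\<rceil>" using R(1) by (simp add: le_ceiling_iff less_le_trans[of "-1" 0])
      then show ?thesis by (simp add: a_def)
    qed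
    define P where "P = (PiE (Basis :: 'a set) (\<lambda>_. {- a..a}))"
    define F where "F f = (SOME y. y \<in> K \<and> grid_cell n y = (\<Sum>b\<in>Basis. of_int (f b) *\<^sub>R b))" for f :: "'a \<Rightarrow> int"
    have sub: "grid_proj K n ` K \<subseteq> F ` P"
    proof
      fix z assume "z \<in> grid_proj K n ` K"
      then obtain x where x: "x \<in> K" "z = grid_proj K n x" by blast
      define f where "f = restrict (\<lambda>b. \<lfloor>2 ^ n * (x \<bullet> b)\<rfloor>) (Basis :: 'a set)"
      have "f \<in> P"
        unfolding P_def f_def
      proof (rule restrict_PiE_iff[THEN iffD2], intro ballI)
        fix b :: 'a assume b: "b \<in> Basis"
        have "\<bar>x \<bullet> b\<bar> \<le> R" using Basis_le_norm[OF b, of x] R(2)[OF x(1)] by linarith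
        then have "\<bar>2 ^ n * (x \<bullet> b)\<bar> \<le> R * 2 ^ n"
          by (simp add: abs_mult mult.commute)
        moreover have "R * 2 ^ n \<le> of_int (a - 1)" unfolding a_def by simp
        ultimately have "\<bar>2 ^ n * (x \<bullet> b)\<bar> \<le> of_int (a - 1)" by linarith
        then show "\<lfloor>2 ^ n * (x \<bullet> b)\<rfloor> \<in> {- a..a}" by (auto simp: le_floor_iff floor_le_iff)
      qed
      moreover have "z = F f"
      proof -
        have "grid_cell n x = (\<Sum>b\<in>Basis. of_int (f b) *\<^sub>R b)"
          unfolding grid_cell_def f_def by (rule sum.cong) auto
        then show ?thesis unfolding x(2) grid_proj_def F_def by simp
      qed
      ultimately show "z \<in> F ` P" by blast
    qed
    have finP: "finite P" unfolding P_def by (intro finite_PiE) auto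
    have "card (grid_proj K n ` K) \<le> card P"
      using card_mono[OF finite_imageI[OF finP] sub] card_image_le[OF finP, of F] by linarith
    also have "card P = nat (2 * a + 1) ^ DIM('a)"
      unfolding P_def by (subst card_PiE) auto
    finally have "real (card (grid_proj K n ` K)) \<le> real (nat (2 * a + 1)) ^ DIM('a)"
      by (metis of_nat_le_iff of_nat_power)
    also have "real (nat (2 * a + 1)) = 2 * of_int a + 1" using a0 by simp
    also have "(2 * of_int a + 1) ^ DIM('a) \<le> ((2 * R + 5) * 2 ^ n) ^ DIM('a)"
    proof (rule power_mono)
      have "of_int a \<le> R * 2 ^ n + 2" unfolding a_def by linarith
      moreover have "(1::real) \<le> 2 ^ n" by simp
      ultimately have "2 * of_int a + 1 \<le> 2 * (R * 2 ^ n) + 5 * (2::real) ^ n" by linarith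
      then show "2 * of_int a + 1 \<le> (2 * R + 5) * (2::real) ^ n" by (simp add: distrib_right mult.assoc)
    qed (use a0 in simp)
    also have "\<dots> = B * (2 ^ DIM('a)) ^ n"
      unfolding B_def power_mult_distrib by (simp add: power_mult[symmetric] mult.commute)
    finally show ?thesis using finite_subset[OF sub finite_imageI[OF finP]] by simp
  qed
  moreover have "B > 0" using R(1) by (simp add: B_def)
  ultimately show ?thesis using that by blast
qed

lemma grid_cell_measurable: "grid_cell n \<in> borel_measurable borel"
  unfolding grid_cell_def by measurable

lemma grid_proj_vimage:
  assumes "q \<in> grid_proj K n ` K"
  shows "{x \<in> K. grid_proj K n x = q} = {x \<in> K. grid_cell n x = grid_cell n q}"
proof -
  obtain x' where x': "x' \<in> K" "q = grid_proj K n x'" using assms by blast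
  have "grid_proj K n x = q" if "x \<in> K" "grid_cell n x = grid_cell n q" for x
    using that grid_proj(2)[OF x'(1), of n] unfolding x'(2) by (simp add: grid_proj_def[of K n])
  moreover have "grid_cell n x = grid_cell n q" if "x \<in> K" "grid_proj K n x = q" for x
    using grid_proj(2)[OF that(1), of n] that(2) by simp
  ultimately show ?thesis by blast
qed

section \<open>Chaining\<close>

lemma hoelder_continuous_on_mono:
  assumes "hoelder_continuous_on S \<alpha> u" "bounded S" "0 < \<beta>" "\<beta> \<le> \<alpha>"
  shows "hoelder_continuous_on S \<beta> u"
proof -
  obtain C where C: "\<And>x y. x \<in> S \<Longrightarrow> y \<in> S \<Longrightarrow> \<bar>u x - u y\<bar> \<le> C * dist x y powr \<alpha>"
    using assms(1) unfolding hoelder_continuous_on_def by blast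
  obtain R where R: "\<And>x y. x \<in> S \<Longrightarrow> y \<in> S \<Longrightarrow> dist x y \<le> R"
    using assms(2) unfolding bounded_two_points by blast
  define D where "D = \<bar>C\<bar> * \<bar>R\<bar> powr (\<alpha> - \<beta>)"
  have "\<bar>u x - u y\<bar> \<le> D * dist x y powr \<beta>" if "x \<in> S" "y \<in> S" for x y
  proof (cases "x = y")
    case False
    have "\<bar>u x - u y\<bar> \<le> C * dist x y powr \<alpha>" by (rule C[OF that])
    also have "\<dots> \<le> \<bar>C\<bar> * dist x y powr \<alpha>" by (intro mult_right_mono) auto
    also have "dist x y powr \<alpha> = dist x y powr (\<alpha> - \<beta>) * dist x y powr \<beta>"
      using False by (simp add: powr_add[symmetric])
    also have "\<bar>C\<bar> * (dist x y powr (\<alpha> - \<beta>) * dist x y powr \<beta>) \<le> \<bar>C\<bar> * (\<bar>R\<bar> powr (\<alpha> - \<beta>) * dist x y powr \<beta>)"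
      using R[OF that] assms by (intro mult_left_mono mult_right_mono powr_mono2) auto
    finally show ?thesis by (simp add: D_def mult.assoc)
  qed simp
  then show ?thesis unfolding hoelder_continuous_on_def by blast
qed

lemma dyadic_scale:
  fixes d :: real
  assumes "0 < d" "d \<le> (1/2) ^ N"
  shows "\<exists>n\<ge>N. (1/2) ^ Suc n < d \<and> d \<le> (1/2) ^ n"
proof -
  have ex: "\<exists>m. (1/2) ^ m < d" using assms by (intro real_arch_pow_inv) auto
  define m where "m = (LEAST m. (1/2 :: real) ^ m < d)"
  have m: "(1/2) ^ m < d" unfolding m_def by (rule LeastI_ex[OF ex])
  have "m > N"
  proof (rule ccontr)
    assume "\<not> m > N"
    then have "(1/2 :: real) ^ N \<le> (1/2) ^ m" by (intro power_decreasing) auto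
    then show False using m assms by linarith
  qed
  then obtain n where n: "m = Suc n" "n \<ge> N" by (cases m) auto
  have "d \<le> (1/2) ^ n"
    using not_less_Least[of n "\<lambda>m. (1/2 :: real) ^ m < d"] n unfolding m_def by (simp add: not_less)
  then show ?thesis using m n by auto
qed

text \<open>
  The projections of a point at consecutive levels are \<open>O(2\<^bsup>-n\<^esup>)\<close> apart, and so are those of two points
  at distance about \<open>2\<^bsup>-n\<^esup>\<close>.  Passing from \<open>x\<close> to \<open>y\<close> through their projections at level \<open>n\<close>
  gives a geometric series of increments.  Points further apart than \<open>2\<^bsup>-N\<^esup>\<close> are covered by
  boundedness.
\<close>

lemma chaining:
  fixes y :: "'a::metric_space \<Rightarrow> real" and \<pi> :: "nat \<Rightarrow> 'a \<Rightarrow> 'a"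
  assumes D: "0 \<le> D" "\<And>n x. x \<in> K \<Longrightarrow> dist x (\<pi> n x) \<le> D * (1/2) ^ n"
    and fin: "\<And>n. finite (\<pi> n ` K)" and beta: "0 < \<beta>"
    and small: "\<And>n p q. n \<ge> N \<Longrightarrow> p \<in> \<pi> n ` K \<Longrightarrow> q \<in> \<pi> n ` K \<union> \<pi> (Suc n) ` K \<Longrightarrow>
      dist p q \<le> (2 * D + 1) * (1/2) ^ n \<Longrightarrow> \<bar>y p - y q\<bar> \<le> ((1/2) powr \<beta>) ^ n"
  shows "uniform_limit K (\<lambda>n x. y (\<pi> n x)) (\<lambda>x. lim (\<lambda>n. y (\<pi> n x))) sequentially"
    and "hoelder_continuous_on K \<beta> (\<lambda>x. lim (\<lambda>n. y (\<pi> n x)))"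
proof -
  define q where "q = (1/2 :: real) powr \<beta>"
  have q: "0 < q" "q < 1" using powr_less_mono2[of \<beta> "1/2" 1] beta by (auto simp: q_def)
  define X where "X x = lim (\<lambda>n. y (\<pi> n x))" for x
  have step: "\<bar>y (\<pi> (Suc n) x) - y (\<pi> n x)\<bar> \<le> q ^ n" if "x \<in> K" "n \<ge> N" for x n
  proof -
    have "dist (\<pi> n x) (\<pi> (Suc n) x) \<le> dist x (\<pi> n x) + dist x (\<pi> (Suc n) x)"
      by (rule dist_triangle3)
    also have "\<dots> \<le> D * (1/2) ^ n + D * (1/2) ^ Suc n" by (intro add_mono D that)
    also have "\<dots> \<le> (2 * D + 1) * (1/2) ^ n" using D(1) by (simp add: algebra_simps)
    finally have "\<bar>y (\<pi> n x) - y (\<pi> (Suc n) x)\<bar> \<le> ((1/2) powr \<beta>) ^ n"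
      using that by (intro small) auto
    then show ?thesis unfolding q_def by (simp add: abs_minus_commute)
  qed
  have chain: "\<bar>y (\<pi> (n + m) x) - y (\<pi> n x)\<bar> \<le> q ^ n / (1 - q)" if x: "x \<in> K" and n: "n \<ge> N" for x n m
  proof -
    have "\<bar>y (\<pi> (n + m) x) - y (\<pi> n x)\<bar> = \<bar>\<Sum>k<m. y (\<pi> (n + Suc k) x) - y (\<pi> (n + k) x)\<bar>"
      using sum_lessThan_telescope[of "\<lambda>k. y (\<pi> (n + k) x)" m] by simp
    also have "\<dots> \<le> (\<Sum>k<m. q ^ (n + k))"
      using step[OF x] n by (intro order_trans[OF sum_abs] sum_mono) auto
    also have "\<dots> = q ^ n * ((1 - q ^ m) / (1 - q))"
      using q by (simp add: power_add sum_distrib_left[symmetric] sum_gp_strict)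
    also have "\<dots> \<le> q ^ n * (1 / (1 - q))" using q by (intro mult_left_mono divide_right_mono) auto
    finally show ?thesis by simp
  qed
  have q_lim: "(\<lambda>n. q ^ n / (1 - q)) \<longlonglongrightarrow> 0"
    using LIMSEQ_power_zero[of q] q by (intro tendsto_divide_zero) auto
  have conv: "(\<lambda>n. y (\<pi> n x)) \<longlonglongrightarrow> X x" if x: "x \<in> K" for x
  proof -
    have "Cauchy (\<lambda>n. y (\<pi> n x))"
    proof (rule metric_CauchyI)
      fix e :: real assume "e > 0"
      then have "\<forall>\<^sub>F n in sequentially. q ^ n / (1 - q) < e / 2"
        using q_lim by (intro order_tendstoD(2)) auto
      then obtain n0 where n0: "\<And>n. n \<ge> n0 \<Longrightarrow> q ^ n / (1 - q) < e / 2"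
        unfolding eventually_sequentially by blast
      define n where "n = max n0 N"
      have n: "n \<ge> N" "q ^ n / (1 - q) < e / 2" using n0 by (auto simp: n_def)
      have near: "\<bar>y (\<pi> k x) - y (\<pi> n x)\<bar> < e / 2" if "k \<ge> n" for k
      proof -
        have "\<bar>y (\<pi> (n + (k - n)) x) - y (\<pi> n x)\<bar> \<le> q ^ n / (1 - q)" by (rule chain[OF x n(1)])
        moreover have "n + (k - n) = k" using that by simp
        ultimately show ?thesis using n(2) by (simp only:) 
      qed
      show "\<exists>M. \<forall>m\<ge>M. \<forall>k\<ge>M. dist (y (\<pi> m x)) (y (\<pi> k x)) < e"
      proof (intro exI[of _ n] allI impI)
        fix m k assume "n \<le> m" "n \<le> k"
        then show "dist (y (\<pi> m x)) (y (\<pi> k x)) < e"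
          using near[of m] near[of k] unfolding dist_real_def by linarith
      qed
    qed
    then show ?thesis unfolding X_def by (simp add: Cauchy_convergent_iff convergent_LIMSEQ_iff)
  qed
  have rate: "\<bar>X x - y (\<pi> n x)\<bar> \<le> q ^ n / (1 - q)" if x: "x \<in> K" and n: "n \<ge> N" for x n
  proof -
    have "(\<lambda>m. y (\<pi> (m + n) x)) \<longlonglongrightarrow> X x" by (rule LIMSEQ_ignore_initial_segment[OF conv[OF x]])
    then have "(\<lambda>m. \<bar>y (\<pi> (n + m) x) - y (\<pi> n x)\<bar>) \<longlonglongrightarrow> \<bar>X x - y (\<pi> n x)\<bar>"
      unfolding add.commute[of _ n] by (intro tendsto_intros)
    from LIMSEQ_le_const2[OF this] chain[OF x n] show ?thesis by blast
  qed
  show "uniform_limit K (\<lambda>n x. y (\<pi> n x)) (\<lambda>x. lim (\<lambda>n. y (\<pi> n x))) sequentially"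
    unfolding X_def[symmetric]
  proof (rule uniform_limitI)
    fix e :: real assume "e > 0"
    then have "\<forall>\<^sub>F n in sequentially. q ^ n / (1 - q) < e"
      using q_lim by (intro order_tendstoD(2)) auto
    then show "\<forall>\<^sub>F n in sequentially. \<forall>x\<in>K. dist (y (\<pi> n x)) (X x) < e"
      using eventually_ge_at_top[of N]
    proof eventually_elim
      case (elim n)
      show ?case
      proof
        fix x assume "x \<in> K"
        then show "dist (y (\<pi> n x)) (X x) < e"
          using rate[of x n] elim by (simp add: dist_real_def abs_minus_commute)
      qed
    qed
  qed
  define B where "B = Max (insert 0 ((\<lambda>p. \<bar>y p\<bar>) ` \<pi> N ` K)) + q ^ N / (1 - q)"
  have B: "\<bar>X x\<bar> \<le> B" if x: "x \<in> K" for x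
  proof -
    have "\<bar>y (\<pi> N x)\<bar> \<le> Max (insert 0 ((\<lambda>p. \<bar>y p\<bar>) ` \<pi> N ` K))"
      using x fin by (intro Max_ge) auto
    then show ?thesis using rate[OF x order_refl] unfolding B_def by linarith
  qed
  define C1 where "C1 = (1 + 2 / (1 - q)) / q"
  define C2 where "C2 = 2 * B * (2 ^ N) powr \<beta>"
  have C1: "C1 > 0" using q by (simp add: C1_def add_pos_pos)
  have "\<bar>X x - X z\<bar> \<le> max C1 C2 * dist x z powr \<beta>" if K: "x \<in> K" "z \<in> K" for x z
  proof (cases "x = z")
    case False
    define d where "d = dist x z"
    have d: "d > 0" using False by (simp add: d_def)
    show ?thesis
    proof (cases "d \<le> (1/2) ^ N")
      case True
      then obtain n where n: "n \<ge> N" "(1/2) ^ Suc n < d" "d \<le> (1/2) ^ n"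
        using dyadic_scale[OF d] by blast
      have "dist (\<pi> n x) (\<pi> n z) \<le> dist (\<pi> n x) x + dist x z + dist z (\<pi> n z)"
        using dist_triangle[of "\<pi> n x" "\<pi> n z" x] dist_triangle[of x "\<pi> n z" z] by linarith
      also have "\<dots> \<le> D * (1/2) ^ n + (1/2) ^ n + D * (1/2) ^ n"
        using D(2)[OF K(1), of n] D(2)[OF K(2), of n] n(3) by (intro add_mono) (auto simp: d_def dist_commute)
      also have "\<dots> = (2 * D + 1) * (1/2) ^ n" by (simp add: algebra_simps)
      finally have "\<bar>y (\<pi> n x) - y (\<pi> n z)\<bar> \<le> q ^ n"
        unfolding q_def using n K by (intro small) auto
      then have "\<bar>X x - X z\<bar> \<le> q ^ n + 2 * (q ^ n / (1 - q))"
        using rate[OF K(1) n(1)] rate[OF K(2) n(1)] by linarith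
      also have "\<dots> = C1 * q ^ Suc n" using q by (simp add: C1_def field_simps)
      also have "q ^ Suc n \<le> d powr \<beta>"
      proof -
        have "q ^ Suc n = ((1/2) ^ Suc n) powr \<beta>"
          unfolding q_def by (rule power_powr[symmetric]) simp
        also have "\<dots> \<le> d powr \<beta>" using n beta by (intro powr_mono2) auto
        finally show ?thesis .
      qed
      finally have "\<bar>X x - X z\<bar> \<le> C1 * d powr \<beta>" using C1 by simp
      also have "\<dots> \<le> max C1 C2 * d powr \<beta>" by (intro mult_right_mono) auto
      finally show ?thesis by (simp add: d_def)
    next
      case False
      then have "1 \<le> 2 ^ N * d" by (simp add: power_divide field_simps)
      then have "1 \<le> (2 ^ N * d) powr \<beta>" using beta by (simp add: ge_one_powr_ge_zero)
      also have "\<dots> = (2 ^ N) powr \<beta> * d powr \<beta>" using d by (simp add: powr_mult)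
      finally have one: "1 \<le> (2 ^ N) powr \<beta> * d powr \<beta>" .
      have B0: "0 \<le> B" using B[OF K(1)] by linarith
      have "\<bar>X x - X z\<bar> \<le> 2 * B * 1" using B[OF K(1)] B[OF K(2)] by linarith
      also have "\<dots> \<le> 2 * B * ((2 ^ N) powr \<beta> * d powr \<beta>)" using one B0 by (intro mult_left_mono) auto
      also have "\<dots> = C2 * d powr \<beta>" by (simp add: C2_def)
      also have "\<dots> \<le> max C1 C2 * d powr \<beta>" by (intro mult_right_mono) auto
      finally show ?thesis by (simp add: d_def)
    qed
  qed simp
  then show "hoelder_continuous_on K \<beta> (\<lambda>x. lim (\<lambda>n. y (\<pi> n x)))"
    unfolding hoelder_continuous_on_def X_def[symmetric] by blast
qed

section \<open>The Kolmogorov-Chentsov theorem\<close>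

text \<open>
  The number of increments at level \<open>n\<close> grows at most like \<open>B\<^sup>n\<close>, while the moment of order \<open>2 k\<close>
  bounds the probability that one of them is large by a multiple of \<open>2\<^bsup>-2 k n (H - \<beta>)\<^esup>\<close>.  For \<open>k\<close> large
  the product is summable, and the Borel-Cantelli lemma applies.
\<close>

lemma gaussian_increments_eventually_small:
  fixes Z :: "'i \<Rightarrow> 'w \<Rightarrow> real"
  assumes M: "prob_space M" and H: "\<beta> < H"
    and I: "\<And>n. finite (I n)" "\<And>n. real (card (I n)) \<le> A * B ^ n" and AB: "0 \<le> A" "0 < B"
    and gauss: "\<And>n i. i \<in> I n \<Longrightarrow> gaussian_rv M (Z i)"
    and mean: "\<And>n i. i \<in> I n \<Longrightarrow> (\<integral>\<omega>. Z i \<omega> \<partial>M) = 0"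
    and var: "\<And>n i. i \<in> I n \<Longrightarrow> (\<integral>\<omega>. (Z i \<omega>)\<^sup>2 \<partial>M) \<le> V * ((1/2) powr H) ^ (2 * n)" and V: "0 \<le> V"
  shows "AE \<omega> in M. \<forall>\<^sub>F n in sequentially. \<forall>i\<in>I n. \<bar>Z i \<omega>\<bar> \<le> ((1/2) powr \<beta>) ^ n"
proof -
  interpret prob_space M by fact
  define q where "q = (1/2 :: real) powr \<beta>"
  define r where "r = ((1/2 :: real) powr (H - \<beta>))\<^sup>2"
  have q: "q > 0" by (simp add: q_def)
  have "(1/2 :: real) powr (H - \<beta>) < 1" using powr_less_mono2[of "H - \<beta>" "1/2" 1] H by simp
  then have r: "0 < r" "r < 1" by (auto simp: r_def power_less_one_iff)
  obtain k where k: "r ^ k < 1 / (2 * B)"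
    using real_arch_pow_inv[of "1 / (2 * B)" r] r AB by auto
  have [measurable]: "Z i \<in> borel_measurable M" if "i \<in> I n" for i n
    using gauss[OF that] by (simp add: gaussian_rv_def)
  define E where "E n = (\<Union>i\<in>I n. {\<omega> \<in> space M. q ^ n \<le> \<bar>Z i \<omega>\<bar>})" for n
  have E_sets: "E n \<in> sets M" for n
    unfolding E_def by (intro sets.finite_UN I) measurable
  define c where "c = fact (2 * k) / (2 ^ k * fact k) * V ^ k"
  have c0: "0 \<le> c" using V by (simp add: c_def)
  have E_le: "prob (E n) \<le> A * c * (1/2) ^ n" for n
  proof -
    have "prob {\<omega> \<in> space M. q ^ n \<le> \<bar>Z i \<omega>\<bar>} \<le> c * (r ^ k) ^ n" if i: "i \<in> I n" for i
    proof -
      have "prob {\<omega> \<in> space M. q ^ n \<le> \<bar>Z i \<omega>\<bar>}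
          \<le> fact (2 * k) / (2 ^ k * fact k) * (V * ((1/2) powr H) ^ (2 * n) / (q ^ n)\<^sup>2) ^ k"
        by (rule gaussian_tail[OF M gauss[OF i] mean[OF i] var[OF i]]) (simp add: q)
      also have "V * ((1/2) powr H) ^ (2 * n) / (q ^ n)\<^sup>2 = V * r ^ n"
      proof -
        have "(1/2 :: real) powr (H - \<beta>) = (1/2) powr H / q" by (simp add: q_def powr_diff)
        then have "r ^ n = ((1/2) powr H) ^ (2 * n) / q ^ (2 * n)"
          by (simp add: r_def power_divide power_mult)
        then show ?thesis by (simp add: power_mult[symmetric] mult.commute)
      qed
      also have "fact (2 * k) / (2 ^ k * fact k) * (V * r ^ n) ^ k = c * (r ^ k) ^ n"
        by (simp add: c_def power_mult_distrib power_mult[symmetric] mult.commute)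
      finally show ?thesis .
    qed
    then have "prob (E n) \<le> (\<Sum>i\<in>I n. c * (r ^ k) ^ n)"
      unfolding E_def by (intro order_trans[OF finite_measure_subadditive_finite] sum_mono I) auto
    also have "\<dots> = real (card (I n)) * (c * (r ^ k) ^ n)" by simp
    also have "\<dots> \<le> (A * B ^ n) * (c * (r ^ k) ^ n)"
      using c0 r by (intro mult_right_mono I) auto
    also have "\<dots> = A * c * (B * r ^ k) ^ n" by (simp add: power_mult_distrib mult_ac)
    also have "\<dots> \<le> A * c * (1/2) ^ n"
    proof (intro mult_left_mono power_mono)
      show "B * r ^ k \<le> 1/2" using k AB by (simp add: field_simps)
    qed (use AB c0 r in auto)
    finally show ?thesis .
  qed
  have "summable (\<lambda>n. prob (E n))"
    by (rule summable_comparison_test'[of "\<lambda>n. A * c * (1/2) ^ n" 0])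
      (use E_le in \<open>auto intro!: summable_mult\<close>)
  then have "AE \<omega> in M. \<forall>\<^sub>F n in sequentially. \<omega> \<in> space M - E n"
    by (intro borel_cantelli_AE1 E_sets) (auto simp: less_top[symmetric])
  then show ?thesis
  proof eventually_elim
    case (elim \<omega>)
    then show ?case
      by eventually_elim (auto simp: E_def q_def)
  qed
qed

text \<open>
  The version is the pathwise limit along the grid projections; a single construction serves all
  exponents, so that the exceptional set does not depend on \<open>\<epsilon>\<close>.  The uniform convergence is what
  allows integrals of \<open>X\<close> to be approximated by finite sums.
\<close>

theorem Gaussian_Kolmogorov_Chentsov:
  fixes K :: "'a::euclidean_space set" and Y :: "'a \<Rightarrow> 'w \<Rightarrow> real"
  assumes M: "prob_space M" and K: "bounded K" and H: "0 < H"
    and gauss: "\<And>x y. x \<in> K \<Longrightarrow> y \<in> K \<Longrightarrow> gaussian_rv M (\<lambda>\<omega>. Y x \<omega> - Y y \<omega>)"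
    and mean: "\<And>x y. x \<in> K \<Longrightarrow> y \<in> K \<Longrightarrow> (\<integral>\<omega>. Y x \<omega> - Y y \<omega> \<partial>M) = 0"
    and var: "\<And>h. 0 < h \<Longrightarrow> h < H \<Longrightarrow> \<exists>C\<ge>0. \<forall>x\<in>K. \<forall>y\<in>K.
      (\<integral>\<omega>. (Y x \<omega> - Y y \<omega>)\<^sup>2 \<partial>M) \<le> C * dist x y powr (2 * h)"
  defines "X \<equiv> \<lambda>x \<omega>. lim (\<lambda>n. Y (grid_proj K n x) \<omega>)"
  shows "\<And>x. x \<in> K \<Longrightarrow> AE \<omega> in M. X x \<omega> = Y x \<omega>"
    and "AE \<omega> in M. \<forall>\<epsilon>. 0 < \<epsilon> \<and> \<epsilon> < H \<longrightarrow> hoelder_continuous_on K (H - \<epsilon>) (\<lambda>x. X x \<omega>)"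
    and "AE \<omega> in M. uniform_limit K (\<lambda>n x. Y (grid_proj K n x) \<omega>) (\<lambda>x. X x \<omega>) sequentially"
proof -
  define \<pi> where "\<pi> = grid_proj K"
  define D where "D = real DIM('a)"
  have D: "D > 0" "\<And>x n. x \<in> K \<Longrightarrow> dist x (\<pi> n x) \<le> D * (1/2) ^ n"
    by (auto simp: D_def \<pi>_def dist_grid_proj)
  obtain B where B: "B > 0" "\<And>n. finite (\<pi> n ` K)" "\<And>n. real (card (\<pi> n ` K)) \<le> B * (2 ^ DIM('a)) ^ n"
    using finite_card_grid_proj[OF K] unfolding \<pi>_def by blast
  have pK: "\<pi> n x \<in> K" if "x \<in> K" for n x unfolding \<pi>_def by (rule grid_proj(1)[OF that])
  have scale: "\<exists>V\<ge>0. \<forall>n. \<forall>x\<in>K. \<forall>y\<in>K. dist x y \<le> L * (1/2) ^ n \<longrightarrow>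
      (\<integral>\<omega>. (Y x \<omega> - Y y \<omega>)\<^sup>2 \<partial>M) \<le> V * ((1/2) powr h) ^ (2 * n)" if h: "0 < h" "h < H" and L: "0 < L" for h L
  proof -
    obtain C where C: "C \<ge> 0" "\<forall>x\<in>K. \<forall>y\<in>K. (\<integral>\<omega>. (Y x \<omega> - Y y \<omega>)\<^sup>2 \<partial>M) \<le> C * dist x y powr (2 * h)"
      using var[OF h] by blast
    have "(\<integral>\<omega>. (Y x \<omega> - Y y \<omega>)\<^sup>2 \<partial>M) \<le> (C * L powr (2 * h)) * ((1/2) powr h) ^ (2 * n)"
      if xy: "x \<in> K" "y \<in> K" and d: "dist x y \<le> L * (1/2) ^ n" for n x y
    proof -
      have "(\<integral>\<omega>. (Y x \<omega> - Y y \<omega>)\<^sup>2 \<partial>M) \<le> C * dist x y powr (2 * h)" using C xy by blast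
      also have "\<dots> \<le> C * (L * (1/2) ^ n) powr (2 * h)"
        using d h C(1) by (intro mult_left_mono powr_mono2) auto
      also have "(L * (1/2) ^ n) powr (2 * h) = L powr (2 * h) * ((1/2) ^ n) powr (2 * h)"
        using L by (simp add: powr_mult)
      also have "((1/2 :: real) ^ n) powr (2 * h) = ((1/2) powr h) ^ (2 * n)"
      proof -
        have "((1/2 :: real) ^ n) powr (2 * h) = ((1/2) powr (2 * h)) ^ n"
          by (rule power_powr) simp
        also have "(1/2 :: real) powr (2 * h) = ((1/2) powr h)\<^sup>2"
          by (simp add: power2_eq_square powr_add[symmetric])
        finally show ?thesis by (simp add: power_mult)
      qed
      finally show ?thesis by (simp add: mult.assoc)
    qed
    then show ?thesis using C(1) by (intro exI[of _ "C * L powr (2 * h)"]) auto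
  qed
  have chain_AE: "AE \<omega> in M. uniform_limit K (\<lambda>n x. Y (\<pi> n x) \<omega>) (\<lambda>x. X x \<omega>) sequentially
      \<and> hoelder_continuous_on K \<beta> (\<lambda>x. X x \<omega>)" if beta: "0 < \<beta>" "\<beta> < H" for \<beta>
  proof -
    define h where "h = (\<beta> + H) / 2"
    have h: "0 < h" "h < H" "\<beta> < h" using beta by (auto simp: h_def)
    obtain V where V: "V \<ge> 0" "\<And>n x y. x \<in> K \<Longrightarrow> y \<in> K \<Longrightarrow> dist x y \<le> (2 * D + 1) * (1/2) ^ n \<Longrightarrow>
      (\<integral>\<omega>. (Y x \<omega> - Y y \<omega>)\<^sup>2 \<partial>M) \<le> V * ((1/2) powr h) ^ (2 * n)"
      using scale[OF h(1,2), of "2 * D + 1"] D(1) by auto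
    define I where "I n = {(p, q) \<in> \<pi> n ` K \<times> (\<pi> n ` K \<union> \<pi> (Suc n) ` K). dist p q \<le> (2 * D + 1) * (1/2) ^ n}" for n
    define S where "S n = \<pi> n ` K \<times> (\<pi> n ` K \<union> \<pi> (Suc n) ` K)" for n
    have S: "finite (S n)" "I n \<subseteq> S n" for n using B(2) by (auto simp: S_def I_def)
    define G :: real where "G = 2 ^ DIM('a)"
    have G: "G \<ge> 1" by (simp add: G_def)
    have card_I: "real (card (I n)) \<le> (B * (B + B * G)) * (G * G) ^ n" for n
    proof -
      have "card (I n) \<le> card (S n)" by (rule card_mono[OF S])
      also have "\<dots> \<le> card (\<pi> n ` K) * (card (\<pi> n ` K) + card (\<pi> (Suc n) ` K))"
        unfolding S_def card_cartesian_product by (intro mult_left_mono card_Un_le) auto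
      finally have "real (card (I n)) \<le> real (card (\<pi> n ` K)) * (real (card (\<pi> n ` K)) + real (card (\<pi> (Suc n) ` K)))"
        by (metis of_nat_add of_nat_le_iff of_nat_mult)
      also have "\<dots> \<le> (B * G ^ n) * (B * G ^ n + B * G ^ Suc n)"
        using B(1) G unfolding G_def by (intro mult_mono add_mono B(3)) auto
      also have "\<dots> = (B * (B + B * G)) * (G * G) ^ n" by (simp add: power_mult_distrib algebra_simps)
      finally show ?thesis .
    qed
    have IK: "fst i \<in> K" "snd i \<in> K" "dist (fst i) (snd i) \<le> (2 * D + 1) * (1/2) ^ n" if "i \<in> I n" for i n
      using that pK by (auto simp: I_def)
    have "AE \<omega> in M. \<forall>\<^sub>F n in sequentially. \<forall>i\<in>I n. \<bar>Y (fst i) \<omega> - Y (snd i) \<omega>\<bar> \<le> ((1/2) powr \<beta>) ^ n"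
    proof (rule gaussian_increments_eventually_small[OF M h(3) _ card_I])
      show "finite (I n)" for n using S finite_subset by blast
      show "0 \<le> B * (B + B * G)" "0 < G * G" using B(1) G by auto
      show "gaussian_rv M (\<lambda>\<omega>. Y (fst i) \<omega> - Y (snd i) \<omega>)" "(\<integral>\<omega>. Y (fst i) \<omega> - Y (snd i) \<omega> \<partial>M) = 0"
        "(\<integral>\<omega>. (Y (fst i) \<omega> - Y (snd i) \<omega>)\<^sup>2 \<partial>M) \<le> V * ((1/2) powr h) ^ (2 * n)" if "i \<in> I n" for i n
        using IK[OF that] by (auto intro: gauss mean V)
    qed (rule V(1))
    then show ?thesis
    proof eventually_elim
      case (elim \<omega>)
      then obtain N where N: "\<And>n i. n \<ge> N \<Longrightarrow> i \<in> I n \<Longrightarrow> \<bar>Y (fst i) \<omega> - Y (snd i) \<omega>\<bar> \<le> ((1/2) powr \<beta>) ^ n"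
        unfolding eventually_sequentially by blast
      have "\<bar>Y p \<omega> - Y q \<omega>\<bar> \<le> ((1/2) powr \<beta>) ^ n"
        if "n \<ge> N" "p \<in> \<pi> n ` K" "q \<in> \<pi> n ` K \<union> \<pi> (Suc n) ` K" "dist p q \<le> (2 * D + 1) * (1/2) ^ n" for n p q
        using N[OF that(1), of "(p, q)"] that by (simp add: I_def)
      from chaining[of D K \<pi> \<beta> N "\<lambda>x. Y x \<omega>", OF _ D(2) B(2) beta(1) this]
      show ?case using D(1) by (simp add: X_def \<pi>_def)
    qed
  qed
  show uniform: "AE \<omega> in M. uniform_limit K (\<lambda>n x. Y (grid_proj K n x) \<omega>) (\<lambda>x. X x \<omega>) sequentially"
    using chain_AE[of "H / 2"] H by (auto simp: \<pi>_def elim: eventually_mono)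
  have "AE \<omega> in M. \<forall>m::nat. hoelder_continuous_on K (H * (1 - 1 / real (m + 2))) (\<lambda>x. X x \<omega>)"
    unfolding AE_all_countable
  proof
    fix m :: nat
    have "0 < H * (1 - 1 / real (m + 2))" "H * (1 - 1 / real (m + 2)) < H" using H by (auto simp: field_simps add_pos_nonneg)
    from chain_AE[OF this] show "AE \<omega> in M. hoelder_continuous_on K (H * (1 - 1 / real (m + 2))) (\<lambda>x. X x \<omega>)"
      by eventually_elim simp
  qed
  then show "AE \<omega> in M. \<forall>\<epsilon>. 0 < \<epsilon> \<and> \<epsilon> < H \<longrightarrow> hoelder_continuous_on K (H - \<epsilon>) (\<lambda>x. X x \<omega>)"
  proof eventually_elim
    case (elim \<omega>)
    show ?case
    proof (intro allI impI)
      fix \<epsilon> assume e: "0 < \<epsilon> \<and> \<epsilon> < H"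
      obtain m where m: "H / \<epsilon> < real m" using reals_Archimedean2 by blast
      have "H / real (m + 2) \<le> \<epsilon>"
      proof -
        have "H < real m * \<epsilon>" using m e by (simp add: divide_less_eq)
        also have "\<dots> \<le> real (m + 2) * \<epsilon>" using e by (intro mult_right_mono) auto
        finally show ?thesis by (simp add: divide_le_eq mult.commute)
      qed
      then have "H - \<epsilon> \<le> H * (1 - 1 / real (m + 2))" by (simp add: right_diff_distrib)
      then show "hoelder_continuous_on K (H - \<epsilon>) (\<lambda>x. X x \<omega>)"
        using e by (intro hoelder_continuous_on_mono[OF elim[rule_format] K]) auto
    qed
  qed
  fix x assume x: "x \<in> K"
  have h: "0 < H / 2" "H / 2 < H" "H / 4 < H / 2" using H by auto
  obtain V where V: "V \<ge> 0" "\<And>n x y. x \<in> K \<Longrightarrow> y \<in> K \<Longrightarrow> dist x y \<le> D * (1/2) ^ n \<Longrightarrow>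
      (\<integral>\<omega>. (Y x \<omega> - Y y \<omega>)\<^sup>2 \<partial>M) \<le> V * ((1/2) powr (H / 2)) ^ (2 * n)"
    using scale[OF h(1,2) D(1)] by auto
  have "AE \<omega> in M. \<forall>\<^sub>F n in sequentially. \<forall>i\<in>{\<pi> n x}. \<bar>Y x \<omega> - Y i \<omega>\<bar> \<le> ((1/2) powr (H / 4)) ^ n"
    by (rule gaussian_increments_eventually_small[OF M h(3), of _ 1 1 _ V])
      (auto intro: gauss mean V x pK D)
  with uniform show "AE \<omega> in M. X x \<omega> = Y x \<omega>"
  proof eventually_elim
    case (elim \<omega>)
    define q where "q = (1/2 :: real) powr (H / 4)"
    have q: "0 < q" "q < 1" using powr_less_mono2[of "H / 4" "1/2" 1] H by (auto simp: q_def)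
    have "(\<lambda>n. Y x \<omega> - Y (\<pi> n x) \<omega>) \<longlonglongrightarrow> 0"
    proof (rule Lim_null_comparison)
      show "\<forall>\<^sub>F n in sequentially. norm (Y x \<omega> - Y (\<pi> n x) \<omega>) \<le> q ^ n"
        using elim(2) by (simp add: q_def)
      show "(\<lambda>n. q ^ n) \<longlonglongrightarrow> 0" using q by (intro LIMSEQ_power_zero) auto
    qed
    then have "(\<lambda>n. Y x \<omega> - (Y x \<omega> - Y (\<pi> n x) \<omega>)) \<longlonglongrightarrow> Y x \<omega> - 0" by (intro tendsto_intros)
    moreover have "(\<lambda>n. Y (\<pi> n x) \<omega>) \<longlonglongrightarrow> X x \<omega>"
      using tendsto_uniform_limitI[OF elim(1) x] by (simp add: \<pi>_def)
    ultimately show ?case using LIMSEQ_unique by fastforce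
  qed
qed

section \<open>Fields represented by a white noise\<close>

lemma L2_0_L2: "f \<in> L2_0 \<mu> \<Longrightarrow> f \<in> L2 \<mu>"
  by (simp add: L2_0_def)

lemma L2_0_zero: "(\<lambda>_. 0) \<in> L2_0 \<mu>"
  by (simp add: L2_0_def L2_zero)

lemma L2_0_lincomb:
  assumes "finite_measure \<mu>" "f \<in> L2_0 \<mu>" "g \<in> L2_0 \<mu>"
  shows "(\<lambda>x. a * f x + b * g x) \<in> L2_0 \<mu>"
  using assms L2_lincomb[of f \<mu> g a b] L2_integrable[OF assms(1)] by (auto simp: L2_0_def)

lemma L2_0_sum:
  assumes "finite_measure \<mu>" "\<And>i. i \<in> I \<Longrightarrow> f i \<in> L2_0 \<mu>"
  shows "(\<lambda>x. \<Sum>i\<in>I. c i * f i x) \<in> L2_0 \<mu>"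
  using assms(2)
proof (induction I rule: infinite_finite_induct)
  case (insert i I)
  then show ?case
    using L2_0_lincomb[OF assms(1), of "f i" "\<lambda>x. \<Sum>i\<in>I. c i * f i x" "c i" 1] by simp
qed (simp_all add: L2_0_zero)

lemma gaussian_rv_cong_AE:
  assumes "gaussian_rv M Y" "AE \<omega> in M. Y \<omega> = Y' \<omega>" "Y' \<in> borel_measurable M"
  shows "gaussian_rv M Y'"
proof -
  have "distr M borel Y = distr M borel Y'"
    by (rule distr_cong_AE[OF refl refl assms(2) _ assms(3)])
      (use assms(1) in \<open>simp only: gaussian_rv_def\<close>)
  then show ?thesis using assms(1,3) unfolding gaussian_rv_def by simp
qed

context
  fixes M :: "'w measure" and \<mu> :: "'a measure" and W
  assumes W: "white_noise M \<mu> W" and fin: "finite_measure \<mu>"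
begin

lemma white_noise_gaussian:
  assumes "f \<in> L2_0 \<mu>"
  shows "gaussian_rv M (W f)"
proof -
  have "gaussian_field M (L2_0 \<mu>) W" using W by (simp add: white_noise_def)
  from this[unfolded gaussian_field_def, rule_format, of "{f}" "\<lambda>_. 1"]
  show ?thesis using assms by simp
qed

lemma white_noise_measurable: "f \<in> L2_0 \<mu> \<Longrightarrow> W f \<in> borel_measurable M"
  using white_noise_gaussian by (simp add: gaussian_rv_def)

lemma white_noise_mean: "f \<in> L2_0 \<mu> \<Longrightarrow> (\<integral>\<omega>. W f \<omega> \<partial>M) = 0"
  using W by (simp add: white_noise_def)

lemma white_noise_variance: "f \<in> L2_0 \<mu> \<Longrightarrow> (\<integral>\<omega>. (W f \<omega>)\<^sup>2 \<partial>M) = L2_inner \<mu> f f"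
  using W by (simp add: white_noise_def power2_eq_square L2_inner_def)

lemma white_noise_lincomb:
  "f \<in> L2_0 \<mu> \<Longrightarrow> g \<in> L2_0 \<mu> \<Longrightarrow>
    AE \<omega> in M. W (\<lambda>x. a * f x + b * g x) \<omega> = a * W f \<omega> + b * W g \<omega>"
  using W by (simp add: white_noise_def)

lemma white_noise_diff:
  assumes "f \<in> L2_0 \<mu>" "g \<in> L2_0 \<mu>"
  shows "AE \<omega> in M. W (\<lambda>x. f x - g x) \<omega> = W f \<omega> - W g \<omega>"
  using white_noise_lincomb[OF assms, of 1 "-1"] by simp

lemma white_noise_sum:
  assumes "finite I" "\<And>i. i \<in> I \<Longrightarrow> f i \<in> L2_0 \<mu>"
  shows "AE \<omega> in M. W (\<lambda>x. \<Sum>i\<in>I. c i * f i x) \<omega> = (\<Sum>i\<in>I. c i * W (f i) \<omega>)"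
  using assms
proof induction
  case empty
  show ?case using white_noise_lincomb[OF L2_0_zero L2_0_zero, of 0 0] by simp
next
  case (insert i I)
  have "AE \<omega> in M. W (\<lambda>x. c i * f i x + 1 * (\<Sum>i\<in>I. c i * f i x)) \<omega>
      = c i * W (f i) \<omega> + 1 * W (\<lambda>x. \<Sum>i\<in>I. c i * f i x) \<omega>"
    using insert.prems by (intro white_noise_lincomb L2_0_sum fin) auto
  moreover have "AE \<omega> in M. W (\<lambda>x. \<Sum>i\<in>I. c i * f i x) \<omega> = (\<Sum>i\<in>I. c i * W (f i) \<omega>)"
    using insert by auto
  ultimately show ?case by eventually_elim (use insert.hyps in simp)
qed

lemma white_noise_difference:
  assumes f: "f \<in> L2_0 \<mu>" and g: "g \<in> L2_0 \<mu>"
  shows "gaussian_rv M (\<lambda>\<omega>. W f \<omega> - W g \<omega>)" "(\<integral>\<omega>. W f \<omega> - W g \<omega> \<partial>M) = 0"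
    "(\<integral>\<omega>. (W f \<omega> - W g \<omega>)\<^sup>2 \<partial>M) = L2_dist_sq \<mu> f g"
proof -
  let ?d = "\<lambda>x. f x - g x"
  have d: "?d \<in> L2_0 \<mu>" using L2_0_lincomb[OF fin f g, of 1 "-1"] by simp
  note [measurable] = white_noise_measurable[OF f] white_noise_measurable[OF g] white_noise_measurable[OF d]
  note ae = white_noise_diff[OF f g]
  show "gaussian_rv M (\<lambda>\<omega>. W f \<omega> - W g \<omega>)"
    by (rule gaussian_rv_cong_AE[OF white_noise_gaussian[OF d] ae]) simp
  have "(\<integral>\<omega>. W f \<omega> - W g \<omega> \<partial>M) = (\<integral>\<omega>. W ?d \<omega> \<partial>M)"
    by (rule integral_cong_AE) (use ae in \<open>auto elim: eventually_mono\<close>)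
  then show "(\<integral>\<omega>. W f \<omega> - W g \<omega> \<partial>M) = 0" using white_noise_mean[OF d] by simp
  have "(\<integral>\<omega>. (W f \<omega> - W g \<omega>)\<^sup>2 \<partial>M) = (\<integral>\<omega>. (W ?d \<omega>)\<^sup>2 \<partial>M)"
    by (rule integral_cong_AE) (use ae in \<open>auto elim: eventually_mono\<close>)
  then show "(\<integral>\<omega>. (W f \<omega> - W g \<omega>)\<^sup>2 \<partial>M) = L2_dist_sq \<mu> f g"
    unfolding white_noise_variance[OF d] by (simp add: L2_dist_sq_def L2_inner_def power2_eq_square)
qed

end

text \<open>
  Composing with \<open>grid_proj\<close> makes any function a simple function, constant on the cells, regardless
  of its measurability.
\<close>

lemma grid_step_function:
  fixes K :: "'a::euclidean_space set" and F :: "'a \<Rightarrow> real" and n :: nat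
  assumes K: "compact_space_measure K \<mu>" and f: "integrable \<mu> f"
  defines "a \<equiv> \<lambda>q. \<integral>x. f x * indicator {x \<in> K. grid_cell n x = grid_cell n q} x \<partial>\<mu>"
  shows "(\<lambda>x. F (grid_proj K n x)) \<in> borel_measurable \<mu>"
    and "\<exists>B. \<forall>x\<in>K. \<bar>F (grid_proj K n x)\<bar> \<le> B"
    and "(\<integral>x. f x * F (grid_proj K n x) \<partial>\<mu>) = (\<Sum>q\<in>grid_proj K n ` K. a q * F q)"
proof -
  interpret compact_space_measure K \<mu> by fact
  define T where "T = grid_proj K n ` K"
  define A where "A q = {x \<in> K. grid_cell n x = grid_cell n q}" for q
  have T: "finite T"
    using finite_card_grid_proj[OF compact_imp_bounded[OF compact_K]] unfolding T_def by blast
  have A: "A q \<in> sets \<mu>" for q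
  proof -
    have "grid_cell n -` {grid_cell n q} \<inter> space borel \<in> sets borel"
      by (rule measurable_sets[OF grid_cell_measurable]) simp
    moreover have "A q = K \<inter> (grid_cell n -` {grid_cell n q} \<inter> space borel)" by (auto simp: A_def)
    ultimately show ?thesis unfolding sets_mu sets_restrict_space by blast
  qed
  have rep: "F (grid_proj K n x) = (\<Sum>q\<in>T. F q * indicator (A q) x)" if "x \<in> K" for x
  proof -
    have "indicator (A q) x = (if q = grid_proj K n x then 1 else (0::real))" if q: "q \<in> T" for q
    proof -
      have "A q = {x \<in> K. grid_proj K n x = q}"
        using grid_proj_vimage[of q K n] q unfolding T_def A_def by simp
      then show ?thesis using \<open>x \<in> K\<close> by (simp add: indicator_def eq_commute)
    qed
    then have "(\<Sum>q\<in>T. F q * indicator (A q) x) = (\<Sum>q\<in>T. F q * (if q = grid_proj K n x then 1 else 0))"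
      by (intro sum.cong) auto
    also have "\<dots> = F (grid_proj K n x)"
      using T that by (simp add: mult_delta_right T_def)
    finally show ?thesis by simp
  qed
  have "(\<lambda>x. F (grid_proj K n x)) \<in> borel_measurable \<mu> \<longleftrightarrow> (\<lambda>x. \<Sum>q\<in>T. F q * indicator (A q) x) \<in> borel_measurable \<mu>"
    by (rule measurable_cong) (simp add: space_mu rep)
  moreover have "(\<lambda>x. \<Sum>q\<in>T. F q * indicator (A q) x) \<in> borel_measurable \<mu>" using A by measurable
  ultimately show "(\<lambda>x. F (grid_proj K n x)) \<in> borel_measurable \<mu>" by simp
  have "\<bar>F (grid_proj K n x)\<bar> \<le> Max (insert 0 ((\<lambda>q. \<bar>F q\<bar>) ` T))" if "x \<in> K" for x
    using T that unfolding T_def by (intro Max_ge) auto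
  then show "\<exists>B. \<forall>x\<in>K. \<bar>F (grid_proj K n x)\<bar> \<le> B" by blast
  have i: "integrable \<mu> (\<lambda>x. f x * indicator (A q) x)" for q
    by (rule integrable_real_mult_indicator[OF A f])
  have "(\<integral>x. f x * F (grid_proj K n x) \<partial>\<mu>) = (\<integral>x. (\<Sum>q\<in>T. F q * (f x * indicator (A q) x)) \<partial>\<mu>)"
    by (rule Bochner_Integration.integral_cong) (auto simp: space_mu rep sum_distrib_left mult_ac)
  also have "\<dots> = (\<Sum>q\<in>T. F q * (\<integral>x. f x * indicator (A q) x \<partial>\<mu>))"
    using i by simp
  finally show "(\<integral>x. f x * F (grid_proj K n x) \<partial>\<mu>) = (\<Sum>q\<in>grid_proj K n ` K. a q * F q)"
    by (simp add: a_def T_def A_def mult.commute)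
qed

text \<open>
  The pairing is checked on coefficients: the condition on \<open>f\<close> and \<open>h\<close> says that \<open>f = \<integral> h(x) g\<^sub>x d\<mu>(x)\<close>
  weakly.  Replacing \<open>x\<close> by its projections turns \<open>\<integral> h X d\<mu>\<close> into finite sums, which are white
  noise integrals of functions \<open>u\<^sub>n\<close>.  By the Cauchy-Schwarz inequality
  \<open>\<parallel>u\<^sub>n - f\<parallel>\<^sup>2 \<le> \<parallel>h\<parallel>\<^sup>2 \<integral> \<parallel>g(\<pi>\<^sub>n x) - g(x)\<parallel>\<^sup>2 d\<mu>(x)\<close>, which decays geometrically, so that
  \<open>W(u\<^sub>n)\<close> converges to \<open>W(f)\<close> almost surely.  This avoids joint measurability of \<open>X\<close> in both
  variables.
\<close>

theorem white_noise_field: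
  fixes K :: "'a::euclidean_space set" and W :: "('a \<Rightarrow> real) \<Rightarrow> 'w \<Rightarrow> real"
  assumes K: "compact_space_measure K \<mu>" and basis: "L2_basis \<mu> \<psi>"
    and M: "prob_space M" and W: "white_noise M \<mu> W" and H: "0 < H"
    and g: "\<And>x. x \<in> K \<Longrightarrow> g x \<in> L2_0 \<mu>"
    and cont: "\<And>j. continuous_on K (\<lambda>x. L2_inner \<mu> (g x) (\<psi> j))"
    and incr: "\<And>h. 0 < h \<Longrightarrow> h < H \<Longrightarrow> \<exists>C\<ge>0. \<forall>x\<in>K. \<forall>y\<in>K. L2_dist_sq \<mu> (g x) (g y) \<le> C * dist x y powr (2 * h)"
  shows "\<exists>X :: 'a \<Rightarrow> 'w \<Rightarrow> real. gaussian_field M K X \<and>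
     (AE \<omega> in M. \<forall>\<epsilon>. 0 < \<epsilon> \<and> \<epsilon> < H \<longrightarrow> hoelder_continuous_on K (H - \<epsilon>) (\<lambda>x. X x \<omega>)) \<and>
     (\<forall>f\<in>L2_0 \<mu>. \<forall>h\<in>L2_0 \<mu>.
        (\<forall>j. L2_inner \<mu> f (\<psi> j) = (\<integral>x. h x * L2_inner \<mu> (g x) (\<psi> j) \<partial>\<mu>)) \<longrightarrow>
        (AE \<omega> in M. (\<integral>x. h x * X x \<omega> \<partial>\<mu>) = W f \<omega>))"
proof -
  interpret compact_space_measure K \<mu> by fact
  interpret L2_basis \<mu> \<psi> by fact
  interpret P: prob_space M by fact
  define \<pi> where "\<pi> = grid_proj K"
  have bK: "bounded K" by (rule compact_imp_bounded[OF compact_K])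
  have pK: "\<pi> n x \<in> K" if "x \<in> K" for n x unfolding \<pi>_def by (rule grid_proj(1)[OF that])
  define Y where "Y x = W (g x)" for x
  define X where "X x \<omega> = lim (\<lambda>n. Y (\<pi> n x) \<omega>)" for x \<omega>
  note diff = white_noise_difference[OF W finite_mu]
  have Ygauss: "gaussian_rv M (\<lambda>\<omega>. Y x \<omega> - Y y \<omega>)" and Ymean: "(\<integral>\<omega>. Y x \<omega> - Y y \<omega> \<partial>M) = 0"
    if "x \<in> K" "y \<in> K" for x y
    using diff[OF g[OF that(1)] g[OF that(2)]] by (auto simp: Y_def)
  have Yvar: "\<exists>C\<ge>0. \<forall>x\<in>K. \<forall>y\<in>K. (\<integral>\<omega>. (Y x \<omega> - Y y \<omega>)\<^sup>2 \<partial>M) \<le> C * dist x y powr (2 * h)"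
    if h: "0 < h" "h < H" for h
    using incr[OF h] by (simp add: Y_def diff(3) g)
  note KC0 = Gaussian_Kolmogorov_Chentsov[OF M bK H, where Y = Y, folded \<pi>_def, folded X_def]
  have KC:
    "\<And>x. x \<in> K \<Longrightarrow> AE \<omega> in M. X x \<omega> = Y x \<omega>"
    "AE \<omega> in M. \<forall>\<epsilon>. 0 < \<epsilon> \<and> \<epsilon> < H \<longrightarrow> hoelder_continuous_on K (H - \<epsilon>) (\<lambda>x. X x \<omega>)"
    "AE \<omega> in M. uniform_limit K (\<lambda>n x. Y (\<pi> n x) \<omega>) (\<lambda>x. X x \<omega>) sequentially"
    by (rule KC0(1); (rule Ygauss Ymean Yvar)?; assumption)
      (rule KC0(2,3); rule Ygauss Ymean Yvar; assumption)+
  have Y_meas [measurable]: "Y x \<in> borel_measurable M" if "x \<in> K" for x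
    unfolding Y_def by (rule white_noise_measurable[OF W finite_mu g[OF that]])
  have X_meas: "X x \<in> borel_measurable M" if "x \<in> K" for x
    unfolding X_def by (rule borel_measurable_lim_metric) (rule Y_meas[OF pK[OF that]])

  have gauss: "gaussian_field M K X"
    unfolding gaussian_field_def
  proof (intro allI impI)
    fix J and c :: "'a \<Rightarrow> real" assume J: "finite J \<and> J \<subseteq> K"
    have gJ: "g i \<in> L2_0 \<mu>" if "i \<in> J" for i using J g that by blast
    have "AE \<omega> in M. \<forall>i\<in>J. X i \<omega> = Y i \<omega>"
      using J KC(1) by (intro AE_finite_allI) auto
    moreover have "AE \<omega> in M. W (\<lambda>x. \<Sum>i\<in>J. c i * g i x) \<omega> = (\<Sum>i\<in>J. c i * W (g i) \<omega>)"
      using J gJ by (intro white_noise_sum[OF W finite_mu]) auto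
    ultimately have ae: "AE \<omega> in M. W (\<lambda>x. \<Sum>i\<in>J. c i * g i x) \<omega> = (\<Sum>i\<in>J. c i * X i \<omega>)"
      by eventually_elim (simp add: Y_def)
    show "gaussian_rv M (\<lambda>\<omega>. \<Sum>i\<in>J. c i * X i \<omega>)"
    proof (rule gaussian_rv_cong_AE[OF _ ae])
      show "gaussian_rv M (W (\<lambda>x. \<Sum>i\<in>J. c i * g i x))"
        by (intro white_noise_gaussian[OF W finite_mu] L2_0_sum finite_mu gJ)
      show "(\<lambda>\<omega>. \<Sum>i\<in>J. c i * X i \<omega>) \<in> borel_measurable M"
        using J X_meas by (intro borel_measurable_sum borel_measurable_times) auto
    qed
  qed

  have identity: "AE \<omega> in M. (\<integral>x. h x * X x \<omega> \<partial>\<mu>) = W f \<omega>"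
    if f: "f \<in> L2_0 \<mu>" and h: "h \<in> L2_0 \<mu>"
      and fh: "\<And>j. L2_inner \<mu> f (\<psi> j) = (\<integral>x. h x * L2_inner \<mu> (g x) (\<psi> j) \<partial>\<mu>)" for f h
  proof -
    have hL: "h \<in> L2 \<mu>" using h by (rule L2_0_L2)
    have fL: "f \<in> L2 \<mu>" using f by (rule L2_0_L2)
    have hi: "integrable \<mu> h" by (rule L2_integrable[OF finite_mu hL])
    have h_meas [measurable]: "h \<in> borel_measurable \<mu>" using hL by (rule L2_measurable)
    define a where "a n q = (\<integral>x. h x * indicator {x \<in> K. grid_cell n x = grid_cell n q} x \<partial>\<mu>)" for n q
    define u where "u n z = (\<Sum>q\<in>\<pi> n ` K. a n q * g q z)" for n z
    have fin: "finite (\<pi> n ` K)" for n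
      using finite_card_grid_proj[OF bK] unfolding \<pi>_def by blast
    have gpi: "g q \<in> L2_0 \<mu>" if "q \<in> \<pi> n ` K" for n q using that pK g by blast
    have uL: "u n \<in> L2_0 \<mu>" for n unfolding u_def by (intro L2_0_sum finite_mu gpi)
    have step_meas: "(\<lambda>x. F (\<pi> n x)) \<in> borel_measurable \<mu>" for F :: "'a \<Rightarrow> real" and n
      unfolding \<pi>_def by (rule grid_step_function(1)[OF K hi])
    have step_bound: "\<exists>B. \<forall>x\<in>K. \<bar>F (\<pi> n x)\<bar> \<le> B" for F :: "'a \<Rightarrow> real" and n
      unfolding \<pi>_def by (rule grid_step_function(2)[OF K hi])
    have step_int: "(\<integral>x. h x * F (\<pi> n x) \<partial>\<mu>) = (\<Sum>q\<in>\<pi> n ` K. a n q * F q)" for F n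
      using grid_step_function(3)[OF K hi, where F = F and n = n] by (simp add: \<pi>_def a_def)

    have left: "AE \<omega> in M. (\<lambda>n. \<Sum>q\<in>\<pi> n ` K. a n q * Y q \<omega>) \<longlonglongrightarrow> (\<integral>x. h x * X x \<omega> \<partial>\<mu>)"
      using KC(3)
    proof eventually_elim
      case (elim \<omega>)
      have conv: "(\<lambda>n. Y (\<pi> n x) \<omega>) \<longlonglongrightarrow> X x \<omega>" if "x \<in> K" for x
        by (rule tendsto_uniform_limitI[OF elim that])
      have Xm: "(\<lambda>x. X x \<omega>) \<in> borel_measurable \<mu>"
        by (rule borel_measurable_LIMSEQ_metric[where f = "\<lambda>n x. Y (\<pi> n x) \<omega>"])
          (auto intro: step_meas conv simp: space_mu)
      have "\<forall>\<^sub>F n in sequentially. \<forall>x\<in>K. dist (Y (\<pi> n x) \<omega>) (X x \<omega>) < 1"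
        by (rule uniform_limitD[OF elim]) simp
      then obtain N where N: "\<And>n x. n \<ge> N \<Longrightarrow> x \<in> K \<Longrightarrow> \<bar>Y (\<pi> n x) \<omega> - X x \<omega>\<bar> < 1"
        unfolding eventually_sequentially dist_real_def by blast
      obtain B where B: "\<And>x. x \<in> K \<Longrightarrow> \<bar>Y (\<pi> N x) \<omega>\<bar> \<le> B"
        using step_bound[of "\<lambda>q. Y q \<omega>" N] by blast
      have bound: "\<bar>Y (\<pi> (n + N) x) \<omega>\<bar> \<le> B + 2" if "x \<in> K" for n x
        using N[of "n + N" x] N[of N x] B[OF that] that by force
      have "(\<lambda>n. \<integral>x. h x * Y (\<pi> (n + N) x) \<omega> \<partial>\<mu>) \<longlonglongrightarrow> (\<integral>x. h x * X x \<omega> \<partial>\<mu>)"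
      proof (rule integral_dominated_convergence[where w = "\<lambda>x. \<bar>h x\<bar> * (B + 2)"])
        show "(\<lambda>x. h x * X x \<omega>) \<in> borel_measurable \<mu>" using Xm by measurable
        show "(\<lambda>x. h x * Y (\<pi> (n + N) x) \<omega>) \<in> borel_measurable \<mu>" for n
          using step_meas[of "\<lambda>q. Y q \<omega>" "n + N"] by measurable
        show "integrable \<mu> (\<lambda>x. \<bar>h x\<bar> * (B + 2))" using hi by simp
        show "AE x in \<mu>. (\<lambda>n. h x * Y (\<pi> (n + N) x) \<omega>) \<longlonglongrightarrow> h x * X x \<omega>"
          by (intro AE_I2 tendsto_mult tendsto_const LIMSEQ_ignore_initial_segment conv) (simp add: space_mu)
        show "AE x in \<mu>. norm (h x * Y (\<pi> (n + N) x) \<omega>) \<le> \<bar>h x\<bar> * (B + 2)" for n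
          using bound by (intro AE_I2) (auto simp: space_mu abs_mult intro!: mult_left_mono)
      qed
      then have "(\<lambda>n. \<integral>x. h x * Y (\<pi> n x) \<omega> \<partial>\<mu>) \<longlonglongrightarrow> (\<integral>x. h x * X x \<omega> \<partial>\<mu>)"
        by (rule LIMSEQ_offset)
      then show ?case unfolding step_int[of "\<lambda>q. Y q \<omega>"] .
    qed

    have sums: "AE \<omega> in M. \<forall>n. W (u n) \<omega> = (\<Sum>q\<in>\<pi> n ` K. a n q * Y q \<omega>)"
      unfolding AE_all_countable u_def Y_def
      by (intro allI white_noise_sum[OF W finite_mu] fin gpi)
    define \<eta> where "\<eta> = H / 2"
    have eta: "0 < \<eta>" "\<eta> < H" using H by (auto simp: \<eta>_def)
    obtain C where C: "C \<ge> 0" "\<And>x y. x \<in> K \<Longrightarrow> y \<in> K \<Longrightarrow> L2_dist_sq \<mu> (g x) (g y) \<le> C * dist x y powr (2 * \<eta>)"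
      using incr[OF eta] by blast
    define D where "D = real DIM('a)"
    define m where "m = measure \<mu> (space \<mu>)"
    define V where "V = L2_inner \<mu> h h * (m * (C * D powr (2 * \<eta>)))"
    have V: "0 \<le> V" using C L2_inner_self_nonneg[of \<mu> h] by (simp add: V_def m_def)
    have rate: "L2_dist_sq \<mu> (u n) f \<le> V * ((1/2) powr \<eta>) ^ (2 * n)" for n
    proof -
      define b where "b j x = L2_inner \<mu> (g (\<pi> n x)) (\<psi> j) - L2_inner \<mu> (g x) (\<psi> j)" for j x
      define R where "R = C * D powr (2 * \<eta>) * ((1/2) powr \<eta>) ^ (2 * n)"
      have uf: "u n \<in> L2 \<mu>" by (rule L2_0_L2[OF uL])
      have bL: "(\<lambda>x. b j x) \<in> L2 \<mu>" for j
      proof -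
        have m: "(\<lambda>x. L2_inner \<mu> (g (\<pi> n x)) (\<psi> j)) \<in> borel_measurable \<mu>"
          by (rule step_meas[of "\<lambda>q. L2_inner \<mu> (g q) (\<psi> j)"])
        obtain B where B: "\<And>x. x \<in> K \<Longrightarrow> \<bar>L2_inner \<mu> (g (\<pi> n x)) (\<psi> j)\<bar> \<le> B"
          using step_bound[of "\<lambda>q. L2_inner \<mu> (g q) (\<psi> j)" n] by blast
        have "integrable \<mu> (\<lambda>x. (L2_inner \<mu> (g (\<pi> n x)) (\<psi> j))\<^sup>2)"
        proof (rule integrable_const_bound[of _ "B\<^sup>2"])
          show "AE x in \<mu>. norm ((L2_inner \<mu> (g (\<pi> n x)) (\<psi> j))\<^sup>2) \<le> B\<^sup>2"
          proof (rule AE_I2)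
            fix x assume "x \<in> space \<mu>"
            then have "\<bar>L2_inner \<mu> (g (\<pi> n x)) (\<psi> j)\<bar>\<^sup>2 \<le> B\<^sup>2" by (intro power_mono B) (auto simp: space_mu)
            then show "norm ((L2_inner \<mu> (g (\<pi> n x)) (\<psi> j))\<^sup>2) \<le> B\<^sup>2" by simp
          qed
        qed (use m in measurable)
        then have "(\<lambda>x. L2_inner \<mu> (g (\<pi> n x)) (\<psi> j)) \<in> L2 \<mu>" using m by (simp add: L2_def)
        then show ?thesis unfolding b_def by (rule L2_diff[OF _ continuous_L2[OF cont]])
      qed
      have coeff: "L2_inner \<mu> (\<lambda>x. u n x - f x) (\<psi> j) = L2_inner \<mu> h (b j)" for j
      proof -
        have "L2_inner \<mu> (u n) (\<psi> j) = (\<Sum>q\<in>\<pi> n ` K. a n q * L2_inner \<mu> (g q) (\<psi> j))"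
          unfolding u_def by (rule L2_inner_sum) (auto intro: L2_0_L2 gpi basis_L2)
        also have "\<dots> = (\<integral>x. h x * L2_inner \<mu> (g (\<pi> n x)) (\<psi> j) \<partial>\<mu>)"
          by (rule step_int[symmetric, where F = "\<lambda>q. L2_inner \<mu> (g q) (\<psi> j)"])
        finally have 1: "L2_inner \<mu> (u n) (\<psi> j) = \<dots>" .
        have c: "(\<lambda>x. L2_inner \<mu> (g x) (\<psi> j)) \<in> L2 \<mu>" by (rule continuous_L2[OF cont])
        have i2: "integrable \<mu> (\<lambda>x. h x * L2_inner \<mu> (g x) (\<psi> j))" by (rule L2_mult_integrable[OF hL c])
        have i1: "integrable \<mu> (\<lambda>x. h x * L2_inner \<mu> (g (\<pi> n x)) (\<psi> j))"
          using L2_mult_integrable[OF hL L2_add[OF bL[of j] c]] by (simp add: b_def)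
        show ?thesis
          unfolding L2_inner_diff[OF uf fL basis_L2] 1 fh
          using i1 i2 by (simp add: L2_inner_def b_def right_diff_distrib)
      qed
      have "(\<Sum>j<N. (L2_inner \<mu> (\<lambda>x. u n x - f x) (\<psi> j))\<^sup>2) \<le> L2_inner \<mu> h h * (m * R)" for N
      proof -
        have bi: "integrable \<mu> (\<lambda>x. (b j x)\<^sup>2)" for j using bL[of j] by (simp add: L2_def)
        have "(L2_inner \<mu> h (b j))\<^sup>2 \<le> L2_inner \<mu> h h * (\<integral>x. (b j x)\<^sup>2 \<partial>\<mu>)" for j
        proof -
          have "\<bar>L2_inner \<mu> h (b j)\<bar>\<^sup>2 \<le> (L2_norm \<mu> h * L2_norm \<mu> (b j))\<^sup>2"
            by (intro power_mono L2_Cauchy_Schwarz hL bL) simp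
          then show ?thesis
            by (simp add: power_mult_distrib L2_norm_sq) (simp add: L2_inner_def power2_eq_square)
        qed
        then have "(\<Sum>j<N. (L2_inner \<mu> (\<lambda>x. u n x - f x) (\<psi> j))\<^sup>2) \<le> (\<Sum>j<N. L2_inner \<mu> h h * (\<integral>x. (b j x)\<^sup>2 \<partial>\<mu>))"
          unfolding coeff by (rule sum_mono)
        also have "\<dots> = L2_inner \<mu> h h * (\<integral>x. (\<Sum>j<N. (b j x)\<^sup>2) \<partial>\<mu>)"
          using bi by (simp add: sum_distrib_left)
        also have "\<dots> \<le> L2_inner \<mu> h h * (\<integral>x. R \<partial>\<mu>)"
        proof (intro mult_left_mono integral_mono L2_inner_self_nonneg)
          show "integrable \<mu> (\<lambda>x. \<Sum>j<N. (b j x)\<^sup>2)" using bi by simp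
          show "integrable \<mu> (\<lambda>x. R)" by simp
          fix x assume "x \<in> space \<mu>"
          then have x: "x \<in> K" by (simp add: space_mu)
          have gx: "g x \<in> L2 \<mu>" "g (\<pi> n x) \<in> L2 \<mu>" using g x pK by (auto intro: L2_0_L2)
          have s: "(\<lambda>j. (b j x)\<^sup>2) sums L2_dist_sq \<mu> (g (\<pi> n x)) (g x)"
            using Parseval_norm[OF L2_diff[OF gx(2,1)]]
            by (simp add: L2_dist_sq_norm L2_inner_diff[OF gx(2,1) basis_L2] b_def)
          have "(\<Sum>j<N. (b j x)\<^sup>2) \<le> L2_dist_sq \<mu> (g (\<pi> n x)) (g x)"
            using sum_le_suminf[OF sums_summable[OF s], of "{..<N}"] sums_unique[OF s] by simp
          also have "\<dots> \<le> C * dist (\<pi> n x) x powr (2 * \<eta>)" by (intro C pK x)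
          also have "\<dots> \<le> C * (D * (1/2) ^ n) powr (2 * \<eta>)"
            using dist_grid_proj[OF x, of n] C(1) eta
            by (intro mult_left_mono powr_mono2) (auto simp: \<pi>_def D_def dist_commute)
          also have "\<dots> = R"
          proof -
            have "((1/2 :: real) ^ n) powr (2 * \<eta>) = ((1/2) powr (2 * \<eta>)) ^ n" by (rule power_powr) simp
            also have "(1/2 :: real) powr (2 * \<eta>) = ((1/2) powr \<eta>)\<^sup>2"
              by (simp add: power2_eq_square powr_add[symmetric])
            finally have "((1/2 :: real) ^ n) powr (2 * \<eta>) = ((1/2) powr \<eta>) ^ (2 * n)" by (simp add: power_mult)
            then show ?thesis unfolding R_def by (subst powr_mult) (auto simp: D_def mult.assoc)
          qed
          finally show "(\<Sum>j<N. (b j x)\<^sup>2) \<le> R" .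
        qed
        finally show ?thesis by (simp add: m_def)
      qed
      then have "(L2_norm \<mu> (\<lambda>x. u n x - f x))\<^sup>2 \<le> L2_inner \<mu> h h * (m * R)"
        using Parseval_norm[OF L2_diff[OF uf fL]] unfolding sums_def by (intro LIMSEQ_le_const2) auto
      then show ?thesis by (simp add: L2_dist_sq_norm V_def R_def mult_ac)
    qed
    have half: "H / 4 < \<eta>" using H by (simp add: \<eta>_def)
    have "AE \<omega> in M. \<forall>\<^sub>F n in sequentially. \<forall>i\<in>{n}. \<bar>W (u i) \<omega> - W f \<omega>\<bar> \<le> ((1/2) powr (H / 4)) ^ n"
      by (rule gaussian_increments_eventually_small[OF M half, of _ 1 1 _ V])
        (auto simp: diff uL f V rate)
    with left sums show ?thesis
    proof eventually_elim
      case (elim \<omega>)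
      define q where "q = (1/2 :: real) powr (H / 4)"
      have q: "0 < q" "q < 1" using half_powr_less_one[of "H / 4"] H by (auto simp: q_def)
      have "(\<lambda>n. W (u n) \<omega> - W f \<omega>) \<longlonglongrightarrow> 0"
      proof (rule Lim_null_comparison)
        show "\<forall>\<^sub>F n in sequentially. norm (W (u n) \<omega> - W f \<omega>) \<le> q ^ n"
          using elim(3) by (simp add: q_def)
        show "(\<lambda>n. q ^ n) \<longlonglongrightarrow> 0" using q by (intro LIMSEQ_power_zero) auto
      qed
      then have "(\<lambda>n. W (u n) \<omega>) \<longlonglongrightarrow> W f \<omega>" by (rule LIM_zero_cancel)
      moreover have "(\<lambda>n. W (u n) \<omega>) \<longlonglongrightarrow> (\<integral>x. h x * X x \<omega> \<partial>\<mu>)"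
        using elim(1,2) by simp
      ultimately show ?case using LIMSEQ_unique by blast
    qed
  qed
  show ?thesis using gauss KC(2) identity by blast
qed

section \<open>The fractional field of a sub-Gaussian kernel\<close>

text \<open>
  The index \<open>0\<close> is the constant eigenfunction, which is left out of the kernel
  \<open>g\<^sub>x = \<Sum>\<^sub>j \<nu>\<^sub>j\<^bsup>-s\<^esup> \<psi>\<^sub>j(x) \<psi>\<^sub>j\<close>; this puts \<open>g\<^sub>x\<close> into \<open>L\<^sup>2\<^sub>0\<close>.
\<close>

theorem fractional_field:
  fixes K :: "'a::euclidean_space set" and W :: "('a \<Rightarrow> real) \<Rightarrow> 'w \<Rightarrow> real"
  assumes kernel: "subgaussian_kernel K \<mu> \<psi> p \<nu> c1 c2 c3 c4 \<theta> d_w"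
    and M: "prob_space M" and W: "white_noise M \<mu> W"
    and s: "\<theta> < 2 * s" "2 * s < 2 - \<theta>"
    and gap: "0 < \<nu>\<^sub>0" "\<And>j. \<nu>\<^sub>0 \<le> \<nu> (Suc j)"
    and psi0: "a \<noteq> 0" "\<And>x. x \<in> K \<Longrightarrow> \<psi> 0 x = a"
  shows "\<exists>X :: 'a \<Rightarrow> 'w \<Rightarrow> real. gaussian_field M K X \<and>
     (AE \<omega> in M. \<forall>\<epsilon>. 0 < \<epsilon> \<and> \<epsilon> < d_w * (s - \<theta> / 2) \<longrightarrow>
        hoelder_continuous_on K (d_w * (s - \<theta> / 2) - \<epsilon>) (\<lambda>x. X x \<omega>)) \<and>
     (\<forall>f\<in>L2_0 \<mu>. \<forall>h\<in>L2_0 \<mu>.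
        (\<forall>j. L2_inner \<mu> h (\<psi> (Suc j)) = \<nu> (Suc j) powr s * L2_inner \<mu> f (\<psi> (Suc j))) \<longrightarrow>
        (AE \<omega> in M. (\<integral>x. h x * X x \<omega> \<partial>\<mu>) = W f \<omega>))"
proof -
  interpret subgaussian_kernel K \<mu> \<psi> p \<nu> c1 c2 c3 c4 \<theta> d_w by fact
  define H where "H = d_w * (s - \<theta> / 2)"
  have H: "0 < H" using s d_w by (simp add: H_def)
  define c where "c x j = (if j = 0 then 0 else \<nu> j powr (- s) * \<psi> j x)" for x j
  have nu_pos: "0 < \<nu> (Suc j)" for j using gap(1) gap(2)[of j] by linarith
  have c_diff_sq: "(c x j - c y j)\<^sup>2 = (if j = 0 then 0 else \<nu> j powr (- (2 * s)) * (\<psi> j x - \<psi> j y)\<^sup>2)" for x y j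
  proof -
    have "(\<nu> j powr (- s))\<^sup>2 = \<nu> j powr (- (2 * s))" by (simp add: power2_eq_square powr_add[symmetric])
    then show ?thesis
      by (simp add: c_def right_diff_distrib[symmetric] power_mult_distrib)
  qed
  have c_sq: "(c x j)\<^sup>2 = (if j = 0 then 0 else \<nu> j powr (- (2 * s)) * (\<psi> j x)\<^sup>2)" for x j
  proof -
    have "(\<nu> j powr (- s))\<^sup>2 = \<nu> j powr (- (2 * s))" by (simp add: power2_eq_square powr_add[symmetric])
    then show ?thesis by (simp add: c_def power_mult_distrib)
  qed
  have gap': "\<nu>\<^sub>0 \<le> \<nu> j" if "j \<in> {1..<n}" for j n
    using gap(2)[of "j - 1"] that by simp
  have split: "(\<Sum>j<n. (if j = 0 then 0 else F j)) = (\<Sum>j\<in>{1..<n}. F j)" for F :: "nat \<Rightarrow> real" and n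
    by (rule sum.mono_neutral_cong_right) auto
  have c_summable: "summable (\<lambda>j. (c x j)\<^sup>2)" if x: "x \<in> K" for x
  proof -
    obtain C where C: "\<And>I x. finite I \<Longrightarrow> (\<And>j. j \<in> I \<Longrightarrow> \<nu>\<^sub>0 \<le> \<nu> j) \<Longrightarrow> x \<in> K \<Longrightarrow>
        (\<Sum>j\<in>I. \<nu> j powr (- (2 * s)) * (\<psi> j x)\<^sup>2) \<le> C"
      using fractional_diagonal[OF s(1) gap(1)] by blast
    have "(\<Sum>j<n. (c x j)\<^sup>2) \<le> C" for n
      unfolding c_sq split by (intro C gap' x) auto
    then show ?thesis by (intro summableI_nonneg_bounded) auto
  qed
  have "\<forall>x\<in>K. \<exists>g\<in>L2 \<mu>. \<forall>j. L2_inner \<mu> g (\<psi> j) = c x j"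
    using Riesz_Fischer[OF c_summable] by blast
  then obtain g where g: "\<And>x. x \<in> K \<Longrightarrow> g x \<in> L2 \<mu>" "\<And>x j. x \<in> K \<Longrightarrow> L2_inner \<mu> (g x) (\<psi> j) = c x j"
    by metis
  have mean: "(\<integral>z. u z \<partial>\<mu>) = L2_inner \<mu> u (\<psi> 0) / a" for u
  proof -
    have "L2_inner \<mu> u (\<psi> 0) = (\<integral>z. u z * a \<partial>\<mu>)"
      unfolding L2_inner_def by (rule Bochner_Integration.integral_cong) (auto simp: space_mu psi0(2))
    then show ?thesis using psi0(1) by simp
  qed
  have g0: "g x \<in> L2_0 \<mu>" if "x \<in> K" for x
    using g[OF that] mean[of "g x"] by (simp add: L2_0_def c_def)
  have cont: "continuous_on K (\<lambda>x. L2_inner \<mu> (g x) (\<psi> j))" for j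
  proof -
    have "continuous_on K (\<lambda>x. c x j)"
      unfolding c_def by (cases "j = 0") (auto intro!: continuous_intros psi_continuous)
    then show ?thesis by (rule continuous_on_eq) (simp add: g)
  qed
  have incr: "\<exists>C\<ge>0. \<forall>x\<in>K. \<forall>y\<in>K. L2_dist_sq \<mu> (g x) (g y) \<le> C * dist x y powr (2 * h)"
    if h: "0 < h" "h < H" for h
  proof -
    obtain C where C: "C > 0" "\<And>I x y. finite I \<Longrightarrow> (\<And>j. j \<in> I \<Longrightarrow> \<nu>\<^sub>0 \<le> \<nu> j) \<Longrightarrow> x \<in> K \<Longrightarrow> y \<in> K \<Longrightarrow>
       (\<Sum>j\<in>I. \<nu> j powr (- (2 * s)) * (\<psi> j x - \<psi> j y)\<^sup>2) \<le> C * dist x y powr (2 * h)"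
      using fractional_increments[OF s h(1) _ gap(1)] h(2) unfolding H_def by blast
    have "L2_dist_sq \<mu> (g x) (g y) \<le> C * dist x y powr (2 * h)" if K: "x \<in> K" "y \<in> K" for x y
    proof -
      have "(\<lambda>j. (c x j - c y j)\<^sup>2) sums L2_dist_sq \<mu> (g x) (g y)"
        using Parseval_norm[OF L2_diff[OF g(1)[OF K(1)] g(1)[OF K(2)]]]
        by (simp add: L2_dist_sq_norm L2_inner_diff[OF g(1)[OF K(1)] g(1)[OF K(2)] basis_L2] g(2) K)
      moreover have "(\<Sum>j<n. (c x j - c y j)\<^sup>2) \<le> C * dist x y powr (2 * h)" for n
        unfolding c_diff_sq split by (intro C gap' K) auto
      ultimately show ?thesis unfolding sums_def by (intro LIMSEQ_le_const2) auto
    qed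
    then show ?thesis using C(1) by (intro exI[of _ C]) auto
  qed
  obtain X :: "'a \<Rightarrow> 'w \<Rightarrow> real" where X: "gaussian_field M K X"
     "AE \<omega> in M. \<forall>\<epsilon>. 0 < \<epsilon> \<and> \<epsilon> < H \<longrightarrow> hoelder_continuous_on K (H - \<epsilon>) (\<lambda>x. X x \<omega>)"
     "\<forall>f\<in>L2_0 \<mu>. \<forall>h\<in>L2_0 \<mu>.
        (\<forall>j. L2_inner \<mu> f (\<psi> j) = (\<integral>x. h x * L2_inner \<mu> (g x) (\<psi> j) \<partial>\<mu>)) \<longrightarrow>
        (AE \<omega> in M. (\<integral>x. h x * X x \<omega> \<partial>\<mu>) = W f \<omega>)"
    using white_noise_field[OF compact_space_measure_axioms L2_basis_axioms M W H g0 cont incr] by blast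
  have "L2_inner \<mu> f (\<psi> j) = (\<integral>x. h x * L2_inner \<mu> (g x) (\<psi> j) \<partial>\<mu>)"
    if f: "f \<in> L2_0 \<mu>" and h: "h \<in> L2_0 \<mu>"
      and fh: "\<forall>j. L2_inner \<mu> h (\<psi> (Suc j)) = \<nu> (Suc j) powr s * L2_inner \<mu> f (\<psi> (Suc j))" for f h j
  proof -
    have "(\<integral>x. h x * L2_inner \<mu> (g x) (\<psi> j) \<partial>\<mu>) = (\<integral>x. h x * c x j \<partial>\<mu>)"
      by (rule Bochner_Integration.integral_cong) (auto simp: space_mu g)
    also have "\<dots> = L2_inner \<mu> f (\<psi> j)"
    proof (cases j)
      case 0
      have "L2_inner \<mu> f (\<psi> 0) = 0" using mean[of f] f psi0(1) by (simp add: L2_0_def)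
      then show ?thesis using 0 by (simp add: c_def)
    next
      case (Suc i)
      have "(\<integral>x. h x * c x j \<partial>\<mu>) = (\<integral>x. \<nu> j powr (- s) * (h x * \<psi> j x) \<partial>\<mu>)"
        using Suc by (simp add: c_def mult_ac)
      also have "\<dots> = \<nu> j powr (- s) * L2_inner \<mu> h (\<psi> j)" by (simp add: L2_inner_def)
      also have "\<dots> = (\<nu> j powr (- s) * \<nu> j powr s) * L2_inner \<mu> f (\<psi> j)"
        using fh Suc by simp
      also have "\<nu> j powr (- s) * \<nu> j powr s = 1"
        using nu_pos[of i] Suc by (simp add: powr_add[symmetric])
      finally show ?thesis by simp
    qed
    finally show ?thesis by simp
  qed
  then show ?thesis using X unfolding H_def by (intro exI[of _ X]) blast
qed

section \<open>Eigenbases of a Dirichlet form\<close>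

text \<open>
  Regularity yields a function in the domain that is uniformly close to \<open>1\<close>; the unit contraction of
  its double is \<open>1\<close>.  As \<open>1\<close> is constant on a neighbourhood of every support, strong locality
  makes it orthogonal to the whole domain.
\<close>

lemma constant_harmonic:
  assumes reg: "regular_dirichlet_form K \<mu> \<E> \<F>" and loc: "strongly_local \<mu> \<E> \<F>" and space: "space \<mu> = K"
  shows "generator \<mu> \<E> \<F> (\<lambda>_. 1) (\<lambda>_. 0)"
proof -
  have fin: "finite_measure \<mu>" and sym: "symmetric_form \<mu> \<E> \<F>" and mar: "markovian_form \<E> \<F>"
    using reg by (auto simp: regular_dirichlet_form_def dirichlet_form_def)
  interpret finite_measure \<mu> by fact
  have one_L2: "(\<lambda>_. 1) \<in> L2 \<mu>" by (simp add: L2_def)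
  have lin: "\<And>f g a b. f \<in> \<F> \<Longrightarrow> g \<in> \<F> \<Longrightarrow> (\<lambda>x. a * f x + b * g x) \<in> \<F>"
    and cong: "\<And>f g. f \<in> \<F> \<Longrightarrow> g \<in> L2 \<mu> \<Longrightarrow> (AE x in \<mu>. f x = g x) \<Longrightarrow> g \<in> \<F>"
    using sym unfolding symmetric_form_def by blast+
  have "continuous_on K (\<lambda>_. 1 :: real)" by simp
  then obtain g where g: "g \<in> \<F>" "\<forall>x\<in>K. \<bar>1 - g x\<bar> < 1/2"
    using reg[unfolded regular_dirichlet_form_def] by (metis half_gt_zero_iff zero_less_one)
  define g' where "g' x = min (max (2 * g x + 0 * g x) 0) 1" for x
  have "g' \<in> \<F>"
    using mar[unfolded markovian_form_def, rule_format, OF lin[OF g(1) g(1), of 2 0]]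
    by (simp add: g'_def[abs_def])
  moreover have "AE x in \<mu>. g' x = 1"
  proof (rule AE_I2)
    fix x assume "x \<in> space \<mu>"
    then have "\<bar>1 - g x\<bar> < 1/2" using g(2) space by blast
    then have "1 \<le> 2 * g x" by linarith
    then show "g' x = 1" unfolding g'_def by simp
  qed
  ultimately have one: "(\<lambda>_. 1) \<in> \<F>" using cong one_L2 by blast
  have "\<E> (\<lambda>_. 1) h = 0" if "h \<in> \<F>" for h
    by (rule loc[unfolded strongly_local_def, rule_format, OF one that], rule exI[of _ UNIV], rule exI[of _ 1]) simp
  then show ?thesis using one by (simp add: generator_def L2_zero)
qed

lemma eigenfunctions_orthogonal:
  assumes sym: "symmetric_form \<mu> \<E> \<F>"
    and f: "generator \<mu> \<E> \<F> f (\<lambda>x. - a * f x)" and g: "generator \<mu> \<E> \<F> g (\<lambda>x. - b * g x)" and "a \<noteq> b"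
  shows "L2_inner \<mu> f g = 0"
proof -
  have F: "f \<in> \<F>" "g \<in> \<F>" using f g by (auto simp: generator_def)
  have "\<E> f g = - (\<integral>x. - a * f x * g x \<partial>\<mu>)" "\<E> g f = - (\<integral>x. - b * g x * f x \<partial>\<mu>)"
    using f g F unfolding generator_def by blast+
  then have "\<E> f g = a * L2_inner \<mu> f g" "\<E> g f = b * L2_inner \<mu> g f"
    by (simp_all add: L2_inner_def mult.assoc)
  moreover have "\<E> f g = \<E> g f" using sym F unfolding symmetric_form_def by blast
  ultimately show ?thesis using \<open>a \<noteq> b\<close> by (simp add: L2_inner_commute[of \<mu> g f])
qed

text \<open>
  The fractional power may have been computed in another eigenbasis \<open>\<Phi>'\<close>.  Since \<open>\<Phi>'\<^sub>i\<close> and \<open>\<Phi>\<^sub>j\<close> are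
  orthogonal unless their eigenvalues agree, the factor \<open>\<lambda>'\<^sub>i\<^sup>s\<close> can be replaced by \<open>\<lambda>\<^sub>j\<^sup>s\<close> term by term.
\<close>

lemma frac_power_coefficients:
  assumes sym: "symmetric_form \<mu> \<E> \<F>" and basis: "eigenbasis \<mu> \<E> \<F> lam \<Phi>" and frac: "frac_power \<mu> \<E> \<F> s f h"
  shows "L2_inner \<mu> h (\<Phi> j) = lam j powr s * L2_inner \<mu> f (\<Phi> j)"
proof -
  obtain lam' \<Phi>' where basis': "eigenbasis \<mu> \<E> \<F> lam' \<Phi>'" and f: "f \<in> L2_0 \<mu>" and h: "h \<in> L2_0 \<mu>"
    and lim: "(\<lambda>n. L2_dist_sq \<mu> h (\<lambda>x. \<Sum>i<n. lam' i powr s * L2_inner \<mu> f (\<Phi>' i) * \<Phi>' i x)) \<longlonglongrightarrow> 0"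
    using frac unfolding frac_power_def by blast
  have Phi: "\<Phi> j \<in> L2 \<mu>" and gen: "generator \<mu> \<E> \<F> (\<Phi> j) (\<lambda>x. - lam j * \<Phi> j x)"
    using basis by (auto simp: eigenbasis_def L2_0_def)
  have Phi': "\<Phi>' i \<in> L2 \<mu>" and gen': "generator \<mu> \<E> \<F> (\<Phi>' i) (\<lambda>x. - lam' i * \<Phi>' i x)" for i
    using basis' by (auto simp: eigenbasis_def L2_0_def)
  have lim_f: "(\<lambda>n. L2_dist_sq \<mu> f (\<lambda>x. \<Sum>i<n. L2_inner \<mu> f (\<Phi>' i) * \<Phi>' i x)) \<longlonglongrightarrow> 0"
    using basis' f by (simp add: eigenbasis_def)
  have coeff: "(\<lambda>n. \<Sum>i<n. c i * L2_inner \<mu> (\<Phi>' i) (\<Phi> j)) \<longlonglongrightarrow> L2_inner \<mu> u (\<Phi> j)"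
    if u: "u \<in> L2 \<mu>" and "(\<lambda>n. L2_dist_sq \<mu> u (\<lambda>x. \<Sum>i<n. c i * \<Phi>' i x)) \<longlonglongrightarrow> 0" for u c
  proof -
    have "(\<lambda>n. L2_norm \<mu> (\<lambda>x. (\<Sum>i<n. c i * \<Phi>' i x) - u x)) \<longlonglongrightarrow> 0"
      using tendsto_real_sqrt[OF that(2)] by (simp add: sqrt_L2_dist_sq)
    then have "(\<lambda>n. L2_inner \<mu> (\<lambda>x. \<Sum>i<n. c i * \<Phi>' i x) (\<Phi> j)) \<longlonglongrightarrow> L2_inner \<mu> u (\<Phi> j)"
      by (intro L2_inner_tendsto L2_sum Phi' u Phi)
    then show ?thesis by (simp add: L2_inner_sum Phi' Phi)
  qed
  have "(\<lambda>n. \<Sum>i<n. lam' i powr s * L2_inner \<mu> f (\<Phi>' i) * L2_inner \<mu> (\<Phi>' i) (\<Phi> j)) \<longlonglongrightarrow> L2_inner \<mu> h (\<Phi> j)"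
    using h lim by (intro coeff) (auto simp: L2_0_def)
  moreover have "lam' i powr s * L2_inner \<mu> f (\<Phi>' i) * L2_inner \<mu> (\<Phi>' i) (\<Phi> j)
      = lam j powr s * (L2_inner \<mu> f (\<Phi>' i) * L2_inner \<mu> (\<Phi>' i) (\<Phi> j))" for i
    using eigenfunctions_orthogonal[OF sym gen'[of i] gen] by (cases "lam' i = lam j") auto
  ultimately have "(\<lambda>n. lam j powr s * (\<Sum>i<n. L2_inner \<mu> f (\<Phi>' i) * L2_inner \<mu> (\<Phi>' i) (\<Phi> j))) \<longlonglongrightarrow> L2_inner \<mu> h (\<Phi> j)"
    by (simp add: sum_distrib_left)
  moreover have "(\<lambda>n. lam j powr s * (\<Sum>i<n. L2_inner \<mu> f (\<Phi>' i) * L2_inner \<mu> (\<Phi>' i) (\<Phi> j))) \<longlonglongrightarrow> lam j powr s * L2_inner \<mu> f (\<Phi> j)"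
    using f lim_f by (intro tendsto_mult tendsto_const coeff) (auto simp: L2_0_def)
  ultimately show ?thesis using LIMSEQ_unique by blast
qed

definition augmented :: "'a measure \<Rightarrow> (nat \<Rightarrow> 'a \<Rightarrow> real) \<Rightarrow> nat \<Rightarrow> 'a \<Rightarrow> real" where
  "augmented \<mu> \<Phi> j = (case j of 0 \<Rightarrow> (\<lambda>_. 1 / sqrt (measure \<mu> (space \<mu>))) | Suc i \<Rightarrow> \<Phi> i)"

lemma augmented_basis:
  assumes fin: "finite_measure \<mu>" and basis: "eigenbasis \<mu> \<E> \<F> lam \<Phi>"
  shows "L2_basis \<mu> (augmented \<mu> \<Phi>)" and "measure \<mu> (space \<mu>) > 0"
proof -
  interpret finite_measure \<mu> by fact
  define m where "m = measure \<mu> (space \<mu>)"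
  have Phi: "\<Phi> j \<in> L2 \<mu>" "(\<integral>x. \<Phi> j x \<partial>\<mu>) = 0" for j
    using basis by (auto simp: eigenbasis_def L2_0_def)
  have orth: "L2_inner \<mu> (\<Phi> i) (\<Phi> j) = (if i = j then 1 else 0)" for i j
    using basis by (simp add: eigenbasis_def)
  have m: "m > 0"
  proof (rule ccontr)
    assume "\<not> m > 0"
    then have "m = 0" unfolding m_def using measure_nonneg[of \<mu> "space \<mu>"] by linarith
    then have "emeasure \<mu> (space \<mu>) = 0" unfolding m_def by (simp add: emeasure_eq_measure)
    then have "AE x in \<mu>. \<Phi> 0 x * \<Phi> 0 x = 0"
      by (intro AE_I[of _ _ "space \<mu>"]) auto
    then have "L2_inner \<mu> (\<Phi> 0) (\<Phi> 0) = 0"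
      unfolding L2_inner_def by (rule integral_eq_zero_AE)
    then show False using orth[of 0 0] by simp
  qed
  then show "measure \<mu> (space \<mu>) > 0" by (simp add: m_def)
  let ?e = "augmented \<mu> \<Phi>"
  have e0: "?e 0 = (\<lambda>_. 1 / sqrt m)" and eS: "?e (Suc j) = \<Phi> j" for j
    by (simp_all add: augmented_def m_def)
  have inner0: "L2_inner \<mu> f (?e 0) = (\<integral>x. f x \<partial>\<mu>) / sqrt m" for f
    by (simp add: e0 L2_inner_def)
  show "L2_basis \<mu> ?e"
  proof
    have "(\<lambda>_. 1 / sqrt m) \<in> L2 \<mu>" by (simp add: L2_def)
    then show "?e j \<in> L2 \<mu>" for j by (cases j) (simp_all add: e0 eS Phi(1))
    show "L2_inner \<mu> (?e i) (?e j) = (if i = j then 1 else 0)" for i j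
    proof (cases i)
      case 0
      show ?thesis
      proof (cases j)
        case 0
        have "L2_inner \<mu> (?e 0) (?e 0) = 1"
          unfolding inner0 using m by (simp add: e0 m_def[symmetric] real_div_sqrt)
        then show ?thesis using 0 \<open>i = 0\<close> by simp
      next
        case (Suc k)
        then show ?thesis
          using \<open>i = 0\<close> inner0[of "\<Phi> k"] Phi(2)[of k] by (simp add: eS L2_inner_commute[of \<mu> "?e 0"])
      qed
    next
      case (Suc k)
      then show ?thesis
        by (cases j) (simp_all add: eS orth inner0 Phi(2))
    qed
    show "(\<lambda>n. L2_dist_sq \<mu> f (\<lambda>x. \<Sum>j<n. L2_inner \<mu> f (?e j) * ?e j x)) \<longlonglongrightarrow> 0" if f: "f \<in> L2 \<mu>" for f
    proof (rule LIMSEQ_imp_Suc)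
      define a where "a = (\<integral>x. f x \<partial>\<mu>) / m"
      define f0 where "f0 x = f x - a" for x
      have cL: "(\<lambda>_. a) \<in> L2 \<mu>" by (simp add: L2_def)
      have f0: "f0 \<in> L2_0 \<mu>"
        using L2_diff[OF f cL] L2_integrable[OF fin f] m
        by (simp add: L2_0_def f0_def[abs_def] a_def m_def[symmetric])
      have co: "L2_inner \<mu> f (\<Phi> j) = L2_inner \<mu> f0 (\<Phi> j)" for j
      proof -
        have "L2_inner \<mu> (\<lambda>_. a) (\<Phi> j) = 0" using Phi(2)[of j] by (simp add: L2_inner_def)
        then show ?thesis using L2_inner_diff[OF f cL Phi(1)[of j]] by (simp add: f0_def[abs_def])
      qed
      have "L2_inner \<mu> f (?e 0) * ?e 0 x = a" for x
        unfolding inner0 using m by (simp add: e0 a_def)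
      then have "(\<Sum>j<Suc n. L2_inner \<mu> f (?e j) * ?e j x) = a + (\<Sum>j<n. L2_inner \<mu> f0 (\<Phi> j) * \<Phi> j x)" for n x
        by (simp only: sum.lessThan_Suc_shift eS co)
      then have "L2_dist_sq \<mu> f (\<lambda>x. \<Sum>j<Suc n. L2_inner \<mu> f (?e j) * ?e j x)
        = L2_dist_sq \<mu> f0 (\<lambda>x. \<Sum>j<n. L2_inner \<mu> f0 (\<Phi> j) * \<Phi> j x)" for n
        unfolding L2_dist_sq_def f0_def by (simp add: algebra_simps)
      moreover have "(\<lambda>n. L2_dist_sq \<mu> f0 (\<lambda>x. \<Sum>j<n. L2_inner \<mu> f0 (\<Phi> j) * \<Phi> j x)) \<longlonglongrightarrow> 0"
        using basis f0 by (simp add: eigenbasis_def)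
      ultimately show "(\<lambda>n. L2_dist_sq \<mu> f (\<lambda>x. \<Sum>j<Suc n. L2_inner \<mu> f (?e j) * ?e j x)) \<longlonglongrightarrow> 0"
        by simp
    qed
  qed
qed

context diagonal_semigroup
begin

lemma cont_basis_constant:
  assumes "\<And>x. x \<in> K \<Longrightarrow> e j x = a" "x \<in> K"
  shows "cont_basis j x = a"
proof (rule continuous_eq_if_AE_eq[OF cont_basis_continuous continuous_on_const _ assms(2)])
  have "AE x in \<mu>. e j x = a" by (rule AE_I2) (simp add: assms(1) space_mu)
  then show "AE x in \<mu>. cont_basis j x = a" using cont_basis_AE[of j] by eventually_elim simp
qed

lemma inner_cont_basis:
  assumes "f \<in> borel_measurable \<mu>"
  shows "L2_inner \<mu> f (cont_basis j) = L2_inner \<mu> f (e j)"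
  unfolding L2_inner_commute[of \<mu> f]
  by (intro L2_inner_cong_AE cont_basis_AE assms continuous_measurable[OF cont_basis_continuous] L2_measurable[OF basis_L2])

lemma heat_expansion_cont_basis:
  assumes nu: "\<And>j. 0 \<le> \<nu> j" and zero: "\<nu> 0 = 0" and const: "a \<noteq> 0" "\<And>x. x \<in> K \<Longrightarrow> e 0 x = a"
  shows "heat_expansion K \<mu> cont_basis p \<nu>"
proof (intro heat_expansion.intro heat_expansion_axioms.intro compact_space_measure_axioms cont_basis_is_basis)
  fix t x y j assume t: "(t::real) > 0"
  show "continuous_on (K \<times> K) (\<lambda>(x, y). p t x y)" by (rule p_continuous[OF t])
  {
    assume x: "x \<in> K"
    show "L2_inner \<mu> (p t x) (cont_basis j) = exp (- \<nu> j * t) * cont_basis j x"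
      using p_inner_basis[OF t x] inner_cont_basis[OF continuous_measurable[OF p_section[OF t x]]] by simp
    have "L2_inner \<mu> (p t x) (e 0) = a"
      using p_inner_basis[OF t x, of 0] cont_basis_constant[OF const(2) x] by (simp add: zero)
    moreover have "L2_inner \<mu> (p t x) (e 0) = (\<integral>y. p t x y * a \<partial>\<mu>)"
      unfolding L2_inner_def by (rule Bochner_Integration.integral_cong) (auto simp: space_mu const(2))
    ultimately show "(\<integral>y. p t x y \<partial>\<mu>) = 1" using const(1) by simp
    assume "y \<in> K"
    then show "(\<lambda>j. exp (- \<nu> j * t) * cont_basis j x * cont_basis j y) sums p t x y"
      by (rule Mercer[OF t x])
  }
  fix f assume f: "f \<in> L2 \<mu>"
  let ?T = "\<lambda>x. \<integral>y. p t x y * f y \<partial>\<mu>"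
  have Tc: "continuous_on K ?T" by (intro continuous_integral_kernel p_continuous t L2_integrable[OF finite_mu f])
  have "L2_inner \<mu> ?T (cont_basis j) = L2_inner \<mu> ?T (e j)"
    by (rule inner_cont_basis[OF continuous_measurable[OF Tc]])
  also have "\<dots> = L2_inner \<mu> (P t f) (e j)"
  proof (rule L2_inner_cong_AE)
    show "AE x in \<mu>. ?T x = P t f x" using P_kernel[OF t f] by eventually_elim simp
  qed (intro L2_measurable P_L2 t f basis_L2 continuous_L2[OF Tc])+
  also have "\<dots> = exp (- \<nu> j * t) * L2_inner \<mu> f (cont_basis j)"
    using P_coeff[OF t f] inner_cont_basis[OF L2_measurable[OF f]] by simp
  finally show "L2_inner \<mu> ?T (cont_basis j) = exp (- \<nu> j * t) * L2_inner \<mu> f (cont_basis j)" .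
qed (use nu cont_basis_continuous in auto)

end

lemma (in prob_space) gaussian_field_zero: "gaussian_field M I (\<lambda>_ _. 0)"
proof -
  have "distr M borel (\<lambda>_. 0 :: real) = return borel 0"
    by (rule measure_eqI) (auto simp: emeasure_distr emeasure_space_1 split: split_indicator)
  then have "gaussian_rv M (\<lambda>_. 0)"
    unfolding gaussian_rv_def by (auto intro!: exI[of _ 0])
  then show ?thesis by (simp add: gaussian_field_def)
qed

theorem theorem4p1:
  fixes K :: "'a::euclidean_space set"
    and \<mu> :: "'a measure"
    and \<E> :: "('a \<Rightarrow> real) \<Rightarrow> ('a \<Rightarrow> real) \<Rightarrow> real"
    and \<F> :: "('a \<Rightarrow> real) set"
    and P :: "real \<Rightarrow> ('a \<Rightarrow> real) \<Rightarrow> 'a \<Rightarrow> real"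
    and p :: "real \<Rightarrow> 'a \<Rightarrow> 'a \<Rightarrow> real"
    and c1 c2 c3 c4 d_h d_w s :: real
    and M :: "'w measure"
    and W :: "('a \<Rightarrow> real) \<Rightarrow> 'w \<Rightarrow> real"
  assumes "compact K"
    and "midpoint_property K"
    and "is_hausdorff_measure_on K \<mu>"
    and "regular_dirichlet_form K \<mu> \<E> \<F>"
    and "strongly_local \<mu> \<E> \<F>"
    and "heat_semigroup \<mu> \<E> \<F> P"
    and "continuous_heat_kernel K \<mu> P p"
    and "c1 > 0" "c2 > 0" "c3 > 0" "c4 > 0"
    and "d_h \<ge> 1" "d_w \<ge> 2" "d_w \<ge> d_h"
    and "\<And>t x y. 0 < t \<Longrightarrow> t < 1 \<Longrightarrow> x \<in> K \<Longrightarrow> y \<in> K \<Longrightarrow>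
           c1 * t powr (- d_h / d_w) *
             exp (- c2 * (dist x y powr d_w / t) powr (1 / (d_w - 1))) \<le> p t x y \<and>
           p t x y \<le>
             c3 * t powr (- d_h / d_w) *
               exp (- c4 * (dist x y powr d_w / t) powr (1 / (d_w - 1)))"
    and "prob_space M"
    and "white_noise M \<mu> W"
    and "d_h / (2 * d_w) < s" "s < 1 - d_h / (2 * d_w)"
  shows "\<exists>X :: 'a \<Rightarrow> 'w \<Rightarrow> real.
           gaussian_field M K X \<and>
           (AE \<omega> in M. \<forall>\<epsilon>. 0 < \<epsilon> \<and> \<epsilon> < s * d_w - d_h / 2 \<longrightarrow>
              hoelder_continuous_on K (s * d_w - d_h / 2 - \<epsilon>) (\<lambda>x. X x \<omega>)) \<and>
           (\<forall>f h. frac_power \<mu> \<E> \<F> s f h \<longrightarrow>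
              (AE \<omega> in M. (\<integral>x. h x * X x \<omega> \<partial>\<mu>) = W f \<omega>))"
proof (cases "\<exists>lam \<Phi>. eigenbasis \<mu> \<E> \<F> lam \<Phi>")
  \<comment> \<open>without an eigenbasis \<open>(-\<Delta>)\<^sup>s\<close> has empty graph, and the zero field will do\<close>
  case False
  then have "\<not> frac_power \<mu> \<E> \<F> s f h" for f h by (auto simp: frac_power_def)
  moreover have "hoelder_continuous_on K \<alpha> (\<lambda>_. 0)" for \<alpha>
    unfolding hoelder_continuous_on_def by (intro exI[of _ 0]) simp
  ultimately show ?thesis
    using prob_space.gaussian_field_zero[OF \<open>prob_space M\<close>, of K] by (intro exI[of _ "\<lambda>_ _. 0"]) auto
next
  case True
  then obtain lam \<Phi> where basis: "eigenbasis \<mu> \<E> \<F> lam \<Phi>" by blast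
  have space: "space \<mu> = K" and sets: "sets \<mu> = sets (restrict_space borel K)"
    using \<open>is_hausdorff_measure_on K \<mu>\<close> by (auto simp: is_hausdorff_measure_on_def)
  note reg = \<open>regular_dirichlet_form K \<mu> \<E> \<F>\<close>
  have fin: "finite_measure \<mu>" and sym: "symmetric_form \<mu> \<E> \<F>"
    and supp: "\<And>U. open U \<Longrightarrow> U \<inter> K \<noteq> {} \<Longrightarrow> 0 < emeasure \<mu> (U \<inter> K)"
    using reg by (auto simp: regular_dirichlet_form_def dirichlet_form_def)
  note HS = \<open>heat_semigroup \<mu> \<E> \<F> P\<close>
  note CK = \<open>continuous_heat_kernel K \<mu> P p\<close>
  define e where "e = augmented \<mu> \<Phi>"
  define \<nu> where "\<nu> = case_nat 0 lam"
  define a where "a = 1 / sqrt (measure \<mu> (space \<mu>))"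
  have m: "measure \<mu> (space \<mu>) > 0" by (rule augmented_basis(2)[OF fin basis])
  have a: "a \<noteq> 0" using m by (simp add: a_def)
  have e0: "e 0 = (\<lambda>_. a)" and eS: "e (Suc j) = \<Phi> j" for j by (simp_all add: e_def augmented_def a_def)
  have e_basis: "L2_basis \<mu> e" unfolding e_def by (rule augmented_basis(1)[OF fin basis])
  have lam: "0 < lam 0" "lam 0 \<le> lam j" for j using basis by (auto simp: eigenbasis_def mono_def)
  have nu: "0 \<le> \<nu> j" for j using lam(1) lam(2)[of "j - 1"] by (cases j) (auto simp: \<nu>_def)
  have PL: "P t f \<in> L2 \<mu>" "L2_norm \<mu> (P t f) \<le> L2_norm \<mu> f" if "t > 0" "f \<in> L2 \<mu>" for t f
    using HS that unfolding heat_semigroup_def L2_norm_def L2_inner_def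
    by (auto simp: power2_eq_square)
  have Plin: "AE x in \<mu>. P t (\<lambda>y. a * f y + b * g y) x = a * P t f x + b * P t g x"
    if "t > 0" "f \<in> L2 \<mu>" "g \<in> L2 \<mu>" for t f g a b
    using HS that unfolding heat_semigroup_def by (meson less_imp_le)
  have one_L2: "(\<lambda>_. 1) \<in> L2 \<mu>" using L2_basis.const_L2[OF e_basis] .
  have Peig: "AE x in \<mu>. P t (e j) x = exp (- \<nu> j * t) * e j x" if t: "t > 0" for t j
  proof (cases j)
    case 0
    have "AE x in \<mu>. P t (\<lambda>_. 1) x = exp (- 0 * t) * 1"
      using constant_harmonic[OF reg \<open>strongly_local \<mu> \<E> \<F>\<close> space] t
      by (intro semigroup_eigenfunction[OF HS one_L2]) auto
    moreover have "AE x in \<mu>. P t (\<lambda>y. a * 1 + 0 * 1) x = a * P t (\<lambda>_. 1) x + 0 * P t (\<lambda>_. 1) x"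
      by (rule Plin[OF t one_L2 one_L2])
    ultimately show ?thesis unfolding 0 e0 by eventually_elim (simp add: \<nu>_def)
  next
    case (Suc i)
    have "generator \<mu> \<E> \<F> (\<Phi> i) (\<lambda>x. - lam i * \<Phi> i x)" "\<Phi> i \<in> L2 \<mu>"
      using basis by (auto simp: eigenbasis_def L2_0_def)
    then have "AE x in \<mu>. P t (\<Phi> i) x = exp (- lam i * t) * \<Phi> i x"
      using lam(1) lam(2)[of i] t by (intro semigroup_eigenfunction[OF HS]) auto
    then show ?thesis using Suc by (simp add: eS \<nu>_def)
  qed
  have pc: "continuous_on (K \<times> K) (\<lambda>(x, y). p t x y)" if t: "t > 0" for t
  proof -
    have "continuous_on ({0<..} \<times> K \<times> K) (\<lambda>(t, x, y). p t x y)"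
      using CK by (simp add: continuous_heat_kernel_def)
    then have "continuous_on (K \<times> K) (\<lambda>z. (\<lambda>(t, x, y). p t x y) (t, z))"
      by (rule continuous_on_compose2) (use t in \<open>auto intro!: continuous_intros\<close>)
    then show ?thesis by (simp add: split_def)
  qed
  have cm: "compact_space_measure K \<mu>"
    by (rule compact_space_measure.intro[OF \<open>compact K\<close> space sets fin supp])
  have Pker: "AE x in \<mu>. P t f x = (\<integral>y. p t x y * f y \<partial>\<mu>)" if "t > 0" "f \<in> L2 \<mu>" for t f
    using CK that by (simp add: continuous_heat_kernel_def)
  interpret ds: diagonal_semigroup K \<mu> e P p \<nu>
    by (intro diagonal_semigroup.intro diagonal_semigroup_axioms.intro cm e_basis)
      (fact PL Plin Peig Pker pc)+
  define \<theta> where "\<theta> = d_h / d_w"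
  have dw: "d_w > 1" "d_w > 0" and dh: "d_h > 0" using \<open>d_w \<ge> 2\<close> \<open>d_h \<ge> 1\<close> by auto
  have s1: "\<theta> < 2 * s" "2 * s < 2 - \<theta>"
    using \<open>d_h / (2 * d_w) < s\<close> \<open>s < 1 - d_h / (2 * d_w)\<close> dw by (auto simp: \<theta>_def field_simps)
  have theta: "0 < \<theta>" "\<theta> < 1" using s1 dw dh by (simp add: \<theta>_def, linarith)
  have he: "heat_expansion K \<mu> ds.cont_basis p \<nu>"
    by (rule ds.heat_expansion_cont_basis[OF nu _ a]) (simp_all add: \<nu>_def e0)
  have kernel: "subgaussian_kernel K \<mu> ds.cont_basis p \<nu> c1 c2 c3 c4 \<theta> d_w"
    by (intro subgaussian_kernel.intro subgaussian_kernel_axioms.intro he dw theta)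
      (use assms(8-11) assms(15) in \<open>auto simp: \<theta>_def\<close>)
  have gap: "lam 0 \<le> \<nu> (Suc j)" for j by (simp add: \<nu>_def lam)
  have psi0: "ds.cont_basis 0 x = a" if "x \<in> K" for x
    by (rule ds.cont_basis_constant[OF _ that]) (simp add: e0)
  have H: "d_w * (s - \<theta> / 2) = s * d_w - d_h / 2" using dw by (simp add: \<theta>_def field_simps)
  obtain X :: "'a \<Rightarrow> 'w \<Rightarrow> real" where X: "gaussian_field M K X"
    "AE \<omega> in M. \<forall>\<epsilon>. 0 < \<epsilon> \<and> \<epsilon> < s * d_w - d_h / 2 \<longrightarrow>
        hoelder_continuous_on K (s * d_w - d_h / 2 - \<epsilon>) (\<lambda>x. X x \<omega>)"
    "\<And>f h. f \<in> L2_0 \<mu> \<Longrightarrow> h \<in> L2_0 \<mu> \<Longrightarrow>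
        \<forall>j. L2_inner \<mu> h (ds.cont_basis (Suc j)) = \<nu> (Suc j) powr s * L2_inner \<mu> f (ds.cont_basis (Suc j)) \<Longrightarrow>
        AE \<omega> in M. (\<integral>x. h x * X x \<omega> \<partial>\<mu>) = W f \<omega>"
    using fractional_field[OF kernel \<open>prob_space M\<close> \<open>white_noise M \<mu> W\<close> s1 lam(1) gap a psi0]
    unfolding H by blast
  have "AE \<omega> in M. (\<integral>x. h x * X x \<omega> \<partial>\<mu>) = W f \<omega>" if frac: "frac_power \<mu> \<E> \<F> s f h" for f h
  proof (rule X(3))
    show f: "f \<in> L2_0 \<mu>" and h: "h \<in> L2_0 \<mu>" using frac by (auto simp: frac_power_def)
    have co: "L2_inner \<mu> u (ds.cont_basis (Suc j)) = L2_inner \<mu> u (\<Phi> j)" if "u \<in> L2_0 \<mu>" for u j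
      using ds.inner_cont_basis[OF L2_measurable[OF L2_0_L2[OF that]], of "Suc j"] by (simp add: eS)
    show "\<forall>j. L2_inner \<mu> h (ds.cont_basis (Suc j)) = \<nu> (Suc j) powr s * L2_inner \<mu> f (ds.cont_basis (Suc j))"
      using frac_power_coefficients[OF sym basis frac] unfolding co[OF f] co[OF h] by (simp add: \<nu>_def)
  qed
  then show ?thesis using X(1,2) by blast
qed

end
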